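(* Let $K_1,K_2$ be infinite fields and $X,Y$ non-empty finite sets. Then the free associative non-unitary algebras $\mathbb{A}^0_{K_1}(X)$ and $\mathbb{A}^0_{K_2}(Y)$ are elementarily equivalent if and only if $|X|=|Y|$ and $HF(K_1)\equiv HF(K_2)$.
   Context: $\mathbb{A}^0_K(Z)$ denotes the free associative algebra without unity over the field $K$ with basis $Z$ (linear combinations of non-empty non-commutative monomials in $Z$), regarded in the language of rings $\{+,\cdot,0\}$. For a set $A$, let $Pf(A)$ be the set of finite subsets of $A$; $HF_0(A)=A$, $HF_{n+1}(A)=HF_n(A)\cup Pf(HF_n(A))$, $HF(A)=\bigcup_n HF_n(A)$. For a field $F$, $HF(F)$ is the two-sorted structure $\langle F, HF(F);\in\rangle$ consisting of the field $F$, the hereditarily finite sets over $F$, and membership; $\equiv$ is elementary equivalence. *)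

theory Defs
  imports "HOL-Library.Poly_Mapping" "HOL-Library.FSet"
begin

section \<open>Free associative algebras without unity\<close>

text \<open>
  Words form the free monoid under concatenation, written additively so that
  \<^typ>\<open>'x list \<Rightarrow>\<^sub>0 'k\<close> becomes the monoid algebra of the free monoid over
  \<^typ>\<open>'k\<close>, with the convolution product of \<^theory>\<open>HOL-Library.Poly_Mapping\<close>.
\<close>

instantiation list :: (type) monoid_add
begin

definition zero_list :: "'a list" where
  "zero_list = []"

definition plus_list :: "'a list \<Rightarrow> 'a list \<Rightarrow> 'a list" where
  "plus_list u v = u @ v"

instance
  by standard (simp_all add: zero_list_def plus_list_def)

end

definition free_alg :: "'x set \<Rightarrow> ('x list \<Rightarrow>\<^sub>0 'k::field) set" where
  "free_alg Z = {p. Poly_Mapping.keys p \<subseteq> lists Z - {[]}}"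

lemma single_mult_single_list:
  "Poly_Mapping.single u a * Poly_Mapping.single v b =
   Poly_Mapping.single (u @ v) (a * b :: 'k::field)"
  by (simp add: mult_single plus_list_def)

lemma free_alg_zero: "0 \<in> free_alg Z"
  by (simp add: free_alg_def)

lemma free_alg_add:
  assumes "p \<in> free_alg Z" "q \<in> free_alg Z"
  shows "p + q \<in> free_alg Z"
  using assms Poly_Mapping.keys_add[of p q] unfolding free_alg_def by blast

lemma free_alg_mult:
  assumes "p \<in> free_alg Z" "q \<in> free_alg Z"
  shows "p * q \<in> free_alg Z"
proof -
  have "Poly_Mapping.keys (p * q) \<subseteq>
      {u + v | u v. u \<in> Poly_Mapping.keys p \<and> v \<in> Poly_Mapping.keys q}"
    by (rule keys_mult)
  then show ?thesis
    using assms unfolding free_alg_def plus_list_def by fastforce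
qed


section \<open>First-order logic of rings in the language +, *, 0\<close>

datatype rng_term =
    RVar nat
  | RZero
  | RAdd rng_term rng_term
  | RMul rng_term rng_term

datatype rng_form =
    REq rng_term rng_term
  | RNot rng_form
  | RAnd rng_form rng_form
  | REx nat rng_form

primrec rng_term_vars :: "rng_term \<Rightarrow> nat set" where
  "rng_term_vars (RVar n) = {n}"
| "rng_term_vars RZero = {}"
| "rng_term_vars (RAdd s t) = rng_term_vars s \<union> rng_term_vars t"
| "rng_term_vars (RMul s t) = rng_term_vars s \<union> rng_term_vars t"

primrec rng_free_vars :: "rng_form \<Rightarrow> nat set" where
  "rng_free_vars (REq s t) = rng_term_vars s \<union> rng_term_vars t"
| "rng_free_vars (RNot \<phi>) = rng_free_vars \<phi>"
| "rng_free_vars (RAnd \<phi> \<psi>) = rng_free_vars \<phi> \<union> rng_free_vars \<psi>"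
| "rng_free_vars (REx n \<phi>) = rng_free_vars \<phi> - {n}"

definition rng_sentence :: "rng_form \<Rightarrow> bool" where
  "rng_sentence \<phi> \<longleftrightarrow> rng_free_vars \<phi> = {}"

primrec rng_term_val :: "(nat \<Rightarrow> 'a::ring) \<Rightarrow> rng_term \<Rightarrow> 'a" where
  "rng_term_val e (RVar n) = e n"
| "rng_term_val e RZero = 0"
| "rng_term_val e (RAdd s t) = rng_term_val e s + rng_term_val e t"
| "rng_term_val e (RMul s t) = rng_term_val e s * rng_term_val e t"

text \<open>
  The structure is a subset \<open>R\<close> of the ambient ring type that is closed under the
  operations; its universe is \<open>R\<close>, so quantifiers are relativised to it.
\<close>

primrec rng_sat :: "'a::ring set \<Rightarrow> (nat \<Rightarrow> 'a) \<Rightarrow> rng_form \<Rightarrow> bool" where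
  "rng_sat R e (REq s t) \<longleftrightarrow> rng_term_val e s = rng_term_val e t"
| "rng_sat R e (RNot \<phi>) \<longleftrightarrow> \<not> rng_sat R e \<phi>"
| "rng_sat R e (RAnd \<phi> \<psi>) \<longleftrightarrow> rng_sat R e \<phi> \<and> rng_sat R e \<psi>"
| "rng_sat R e (REx n \<phi>) \<longleftrightarrow> (\<exists>a\<in>R. rng_sat R (e(n := a)) \<phi>)"

definition rng_models :: "'a::ring set \<Rightarrow> rng_form \<Rightarrow> bool" where
  "rng_models R \<phi> \<longleftrightarrow> (\<forall>e. range e \<subseteq> R \<longrightarrow> rng_sat R e \<phi>)"

definition rng_elem_equiv :: "'a::ring set \<Rightarrow> 'b::ring set \<Rightarrow> bool" where
  "rng_elem_equiv R S \<longleftrightarrow>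
     (\<forall>\<phi>. rng_sentence \<phi> \<longrightarrow> (rng_models R \<phi> \<longleftrightarrow> rng_models S \<phi>))"


section \<open>Hereditarily finite sets\<close>

text \<open>
  Elements of the base set are urelements: \<open>Atom a\<close> has no members and differs from
  every \<open>HSet S\<close>, in particular from the empty set.
\<close>

datatype 'a hf = Atom 'a | HSet "'a hf fset"

definition Pf :: "'a hf set \<Rightarrow> 'a hf set" where
  "Pf U = {HSet S | S. fset S \<subseteq> U}"

primrec HF_level :: "nat \<Rightarrow> 'a set \<Rightarrow> 'a hf set" where
  "HF_level 0 A = Atom ` A"
| "HF_level (Suc n) A = HF_level n A \<union> Pf (HF_level n A)"

definition HF :: "'a set \<Rightarrow> 'a hf set" where
  "HF A = (\<Union>n. HF_level n A)"

primrec hf_mem :: "'a hf \<Rightarrow> 'a hf \<Rightarrow> bool" where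
  "hf_mem x (Atom a) \<longleftrightarrow> False"
| "hf_mem x (HSet S) \<longleftrightarrow> x |\<in>| S"


section \<open>Two-sorted first-order logic of hereditarily finite sets over a field\<close>

text \<open>
  The two sorts are the field \<open>F\<close> and \<open>HF(F)\<close>, each with its own variables. Since
  \<open>F = HF\<^sub>0(F) \<subseteq> HF(F)\<close>, a field term also denotes an element of \<open>HF(F)\<close>, via
  \<open>HElem\<close>; this is what allows membership statements between the two sorts. Equality of
  field terms is an instance of \<open>HEq\<close>, as \<open>Atom\<close> is injective.
\<close>

datatype field_term =
    FVar nat
  | FZero
  | FOne
  | FAdd field_term field_term
  | FMul field_term field_term

datatype hf_term =
    HVar nat
  | HElem field_term

datatype hf_form =
    HEq hf_term hf_term
  | HMem hf_term hf_term
  | HNot hf_form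
  | HAnd hf_form hf_form
  | HExF nat hf_form
  | HExS nat hf_form

primrec field_term_vars :: "field_term \<Rightarrow> nat set" where
  "field_term_vars (FVar n) = {n}"
| "field_term_vars FZero = {}"
| "field_term_vars FOne = {}"
| "field_term_vars (FAdd s t) = field_term_vars s \<union> field_term_vars t"
| "field_term_vars (FMul s t) = field_term_vars s \<union> field_term_vars t"

text \<open>Free variables are tagged by their sort: \<open>Inl\<close> for \<open>F\<close>, \<open>Inr\<close> for \<open>HF(F)\<close>.\<close>

primrec hf_term_vars :: "hf_term \<Rightarrow> (nat + nat) set" where
  "hf_term_vars (HVar n) = {Inr n}"
| "hf_term_vars (HElem t) = Inl ` field_term_vars t"

primrec hf_free_vars :: "hf_form \<Rightarrow> (nat + nat) set" where
  "hf_free_vars (HEq s t) = hf_term_vars s \<union> hf_term_vars t"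
| "hf_free_vars (HMem s t) = hf_term_vars s \<union> hf_term_vars t"
| "hf_free_vars (HNot \<phi>) = hf_free_vars \<phi>"
| "hf_free_vars (HAnd \<phi> \<psi>) = hf_free_vars \<phi> \<union> hf_free_vars \<psi>"
| "hf_free_vars (HExF n \<phi>) = hf_free_vars \<phi> - {Inl n}"
| "hf_free_vars (HExS n \<phi>) = hf_free_vars \<phi> - {Inr n}"

definition hf_sentence :: "hf_form \<Rightarrow> bool" where
  "hf_sentence \<phi> \<longleftrightarrow> hf_free_vars \<phi> = {}"

primrec field_term_val :: "(nat \<Rightarrow> 'k::field) \<Rightarrow> field_term \<Rightarrow> 'k" where
  "field_term_val e (FVar n) = e n"
| "field_term_val e FZero = 0"
| "field_term_val e FOne = 1"
| "field_term_val e (FAdd s t) = field_term_val e s + field_term_val e t"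
| "field_term_val e (FMul s t) = field_term_val e s * field_term_val e t"

primrec hf_term_val :: "(nat \<Rightarrow> 'k::field) \<Rightarrow> (nat \<Rightarrow> 'k hf) \<Rightarrow> hf_term \<Rightarrow> 'k hf" where
  "hf_term_val e h (HVar n) = h n"
| "hf_term_val e h (HElem t) = Atom (field_term_val e t)"

primrec hf_sat ::
  "'k::field set \<Rightarrow> (nat \<Rightarrow> 'k) \<Rightarrow> (nat \<Rightarrow> 'k hf) \<Rightarrow> hf_form \<Rightarrow> bool" where
  "hf_sat F e h (HEq s t) \<longleftrightarrow> hf_term_val e h s = hf_term_val e h t"
| "hf_sat F e h (HMem s t) \<longleftrightarrow> hf_mem (hf_term_val e h s) (hf_term_val e h t)"
| "hf_sat F e h (HNot \<phi>) \<longleftrightarrow> \<not> hf_sat F e h \<phi>"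
| "hf_sat F e h (HAnd \<phi> \<psi>) \<longleftrightarrow> hf_sat F e h \<phi> \<and> hf_sat F e h \<psi>"
| "hf_sat F e h (HExF n \<phi>) \<longleftrightarrow> (\<exists>a\<in>F. hf_sat F (e(n := a)) h \<phi>)"
| "hf_sat F e h (HExS n \<phi>) \<longleftrightarrow> (\<exists>x\<in>HF F. hf_sat F e (h(n := x)) \<phi>)"

definition hf_models :: "'k::field set \<Rightarrow> hf_form \<Rightarrow> bool" where
  "hf_models F \<phi> \<longleftrightarrow>
     (\<forall>e h. range e \<subseteq> F \<longrightarrow> range h \<subseteq> HF F \<longrightarrow> hf_sat F e h \<phi>)"

definition hf_elem_equiv :: "'k::field set \<Rightarrow> 'l::field set \<Rightarrow> bool" where
  "hf_elem_equiv F G \<longleftrightarrow>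
     (\<forall>\<phi>. hf_sentence \<phi> \<longrightarrow> (hf_models F \<phi> \<longleftrightarrow> hf_models G \<phi>))"

end

(*
  Each structure is interpreted in the other, by formulas that depend neither on the field nor on
  the names of the generators.

  For the forward direction let t be an element of A whose centralizer C behaves like t K[t]; this
  is a first-order condition (theta), and the generators satisfy it.  Comparing degrees shows that
  C = t K[t] for every such t, that K t is the set of c in C dividing t t in C, and that
  evaluation of polynomials is definable.  As K is infinite, interpolation codes every finite binary relation on K
  by polynomials (q, f, g) as {(f i, g i) | q i = 0}.  A hereditarily finite set is then a finite
  relation with a distinguished node, and equality of sets is the existence of a finite bisimulation.
  The number of generators is the least n for which n elements span A as a right ideal over K.

  For the backward direction a polynomial is coded as its finite set of (word, coefficient) pairs.
  Addition is coefficientwise.  The graph of multiplication is certified by a finite set of pairs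
  (p, p q) closed under left derivatives of p, by the rule d_x (p q) = (d_x p) q + p(0) d_x q.

  To avoid manipulating formulas, definability is treated semantically: a pair of predicates on
  environments of the two structures is definable if one formula defines both.
*)
theory Submission
  imports Defs "HOL-Computational_Algebra.Polynomial"
begin

section \<open>Definability in two structures by the same formula\<close>

text \<open>Without a unit the field does not lie in A, so t stands in for 1: a scalar \<alpha> is
  represented by \<alpha> t, a polynomial P by t P(t), and the product of two scalars by the c with
  t c = (\<alpha> t)(\<beta> t). The choice of t is not canonical, since any non-zero scalar
  multiple serves as well; hence t is a parameter, and a translated sentence must get the same truth
  value for every admissible t. Neither language can recurse over codes. Each inductive notion is
  therefore replaced by a finite witness over which the structure can quantify: besides
  bisimulations and tables of derivatives, these are sets without a minimal node for ill-foundedness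
  and tail-closed sets for words. In A such quantifiers rest on the infinity of K, which always
  leaves a fresh index for one more interpolation point. Codes in A of a hereditarily finite set are
  far from unique, so terms translate to properties of codes. Codes of polynomials as sets are
  unique, because zero coefficients are left out.\<close>

lemma ex_upd_fresh_iff:
  fixes R0 :: "(nat \<Rightarrow> 'c) \<Rightarrow> bool"
  assumes e: "range e \<subseteq> S" and R0: "\<And>e. R0 e = R (e 0) (\<lambda>i. e (Suc i))"
    and NR: "\<And>e e'. range e \<subseteq> S \<Longrightarrow> range e' \<subseteq> S \<Longrightarrow> \<forall>i<N. e i = e' i \<Longrightarrow> R0 e = R0 e'"
    and \<sigma>_def: "\<sigma> = case_nat N (\<lambda>j. j)"
  shows "(\<exists>a\<in>S. R0 (\<lambda>i. (e(N := a)) (\<sigma> i))) = (\<exists>a\<in>S. R a e)"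
proof -
  have "R0 (\<lambda>i. (e(N := a)) (\<sigma> i)) = R a e" if a: "a \<in> S" for a
  proof -
    have eS: "e i \<in> S" for i using e by auto
    \<comment> \<open>The two environments differ at most at index N + 1, where
      \<open>\<sigma>\<close> hits the overwritten variable N a second time; that index lies beyond
      the support.\<close>
    have "R0 (\<lambda>i. (e(N := a)) (\<sigma> i)) = R0 (case_nat a e)"
    proof (rule NR)
      show "range (\<lambda>i. (e(N := a)) (\<sigma> i)) \<subseteq> S"
        using a eS by (simp add: image_subset_iff)
      show "range (case_nat a e) \<subseteq> S"
        using a eS by (simp add: image_subset_iff split: nat.split)
      show "\<forall>i<N. (e(N := a)) (\<sigma> i) = case_nat a e i"
      proof (intro allI impI)
        fix i assume "i < N"
        then show "(e(N := a)) (\<sigma> i) = case_nat a e i"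
          by (cases i) (simp_all add: \<sigma>_def)
      qed
    qed
    then show ?thesis by (simp add: R0)
  qed
  then show ?thesis by blast
qed

text \<open>\<open>D P Q\<close> is meant as: one formula expresses P in the first structure and Q
  in the second. \<open>D_cong\<close> looks only at environments with values in the universes, and
  \<open>D_supp\<close> records that a formula mentions finitely many variables, which is the source
  of fresh ones.\<close>

locale definability =
  fixes A :: "'a set" and B :: "'b set"
    and D :: "((nat \<Rightarrow> 'a) \<Rightarrow> bool) \<Rightarrow> ((nat \<Rightarrow> 'b) \<Rightarrow> bool) \<Rightarrow> bool"
  assumes D_cong: "\<lbrakk>D P Q; \<And>e. range e \<subseteq> A \<Longrightarrow> P e = P' e; \<And>e. range e \<subseteq> B \<Longrightarrow> Q e = Q' e\<rbrakk> \<Longrightarrow> D P' Q'"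
    and D_var_eq: "D (\<lambda>e. e i = e j) (\<lambda>e. e i = e j)"
    and D_not: "D P Q \<Longrightarrow> D (\<lambda>e. \<not> P e) (\<lambda>e. \<not> Q e)"
    and D_and: "\<lbrakk>D P Q; D P' Q'\<rbrakk> \<Longrightarrow> D (\<lambda>e. P e \<and> P' e) (\<lambda>e. Q e \<and> Q' e)"
    and D_upd: "D P Q \<Longrightarrow> D (\<lambda>e. \<exists>a\<in>A. P (e(n := a))) (\<lambda>e. \<exists>b\<in>B. Q (e(n := b)))"
    and D_ren: "D P Q \<Longrightarrow> D (\<lambda>e. P (\<lambda>i. e (\<sigma> i))) (\<lambda>e. Q (\<lambda>i. e (\<sigma> i)))"
    and D_supp: "D P Q \<Longrightarrow> \<exists>N. (\<forall>e e'. range e \<subseteq> A \<longrightarrow> range e' \<subseteq> A \<longrightarrow> (\<forall>i<N. e i = e' i) \<longrightarrow> P e = P e') \<and>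
        (\<forall>e e'. range e \<subseteq> B \<longrightarrow> range e' \<subseteq> B \<longrightarrow> (\<forall>i<N. e i = e' i) \<longrightarrow> Q e = Q e')"
begin

text \<open>Unfolding a definition yields a quantifier with a bound HOL variable instead of a
  numbered one. In the premise that variable becomes index 0 and all others shift up, so the rule
  applies by plain resolution; \<open>\<sigma>\<close> moves index 0 to the fresh N over which
  \<open>D_upd\<close> quantifies.\<close>

lemma D_Bex:
  assumes "D (\<lambda>e. P (e 0) (\<lambda>i. e (Suc i))) (\<lambda>e. Q (e 0) (\<lambda>i. e (Suc i)))"
  shows "D (\<lambda>e. \<exists>a\<in>A. P a e) (\<lambda>e. \<exists>b\<in>B. Q b e)"
proof -
  define P0 where "P0 = (\<lambda>e. P (e 0) (\<lambda>i. e (Suc i)))"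
  define Q0 where "Q0 = (\<lambda>e. Q (e 0) (\<lambda>i. e (Suc i)))"
  have P0: "P0 e = P (e 0) (\<lambda>i. e (Suc i))" for e by (simp add: P0_def)
  have Q0: "Q0 e = Q (e 0) (\<lambda>i. e (Suc i))" for e by (simp add: Q0_def)
  have D0: "D P0 Q0" unfolding P0_def Q0_def by (rule assms)
  obtain N where
    NP: "\<And>e e'. range e \<subseteq> A \<Longrightarrow> range e' \<subseteq> A \<Longrightarrow> \<forall>i<N. e i = e' i \<Longrightarrow> P0 e = P0 e'" and
    NQ: "\<And>e e'. range e \<subseteq> B \<Longrightarrow> range e' \<subseteq> B \<Longrightarrow> \<forall>i<N. e i = e' i \<Longrightarrow> Q0 e = Q0 e'"
    using D_supp[OF D0] by blast
  define \<sigma> where "\<sigma> = case_nat N (\<lambda>j. j)"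
  have "D (\<lambda>e. \<exists>a\<in>A. P0 (\<lambda>i. (e(N := a)) (\<sigma> i))) (\<lambda>e. \<exists>a\<in>B. Q0 (\<lambda>i. (e(N := a)) (\<sigma> i)))"
    by (rule D_upd[OF D_ren[OF D0]])
  then show ?thesis
  proof (rule D_cong)
    show "(\<exists>a\<in>A. P0 (\<lambda>i. (e(N := a)) (\<sigma> i))) = (\<exists>a\<in>A. P a e)" if "range e \<subseteq> A" for e
      using ex_upd_fresh_iff[of e A P0 P N \<sigma>, OF that P0 NP \<sigma>_def] by blast
    show "(\<exists>a\<in>B. Q0 (\<lambda>i. (e(N := a)) (\<sigma> i))) = (\<exists>a\<in>B. Q a e)" if "range e \<subseteq> B" for e
      using ex_upd_fresh_iff[of e B Q0 Q N \<sigma>, OF that Q0 NQ \<sigma>_def] by blast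
  qed
qed

lemma D_or:
  assumes "D P Q" "D P' Q'"
  shows "D (\<lambda>e. P e \<or> P' e) (\<lambda>e. Q e \<or> Q' e)"
proof -
  have "D (\<lambda>e. \<not> (\<not> P e \<and> \<not> P' e)) (\<lambda>e. \<not> (\<not> Q e \<and> \<not> Q' e))"
    by (intro D_not D_and assms)
  then show ?thesis by simp
qed

lemma D_imp:
  assumes "D P Q" "D P' Q'"
  shows "D (\<lambda>e. P e \<longrightarrow> P' e) (\<lambda>e. Q e \<longrightarrow> Q' e)"
  using D_or[OF D_not[OF assms(1)] assms(2)] by (simp only: imp_conv_disj)

lemma D_iff:
  assumes "D P Q" "D P' Q'"
  shows "D (\<lambda>e. P e \<longleftrightarrow> P' e) (\<lambda>e. Q e \<longleftrightarrow> Q' e)"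
  using D_and[OF D_imp[OF assms] D_imp[OF assms(2,1)]] by (simp only: iff_conv_conj_imp)

lemma D_True: "D (\<lambda>e. True) (\<lambda>e. True)"
  using D_var_eq[of 0 0] by simp

lemma D_False: "D (\<lambda>e. False) (\<lambda>e. False)"
  using D_not[OF D_True] by simp

lemma D_Ball:
  assumes "D (\<lambda>e. P (e 0) (\<lambda>i. e (Suc i))) (\<lambda>e. Q (e 0) (\<lambda>i. e (Suc i)))"
  shows "D (\<lambda>e. \<forall>a\<in>A. P a e) (\<lambda>e. \<forall>b\<in>B. Q b e)"
proof -
  have "D (\<lambda>e. \<not> (\<exists>a\<in>A. \<not> P a e)) (\<lambda>e. \<not> (\<exists>b\<in>B. \<not> Q b e))"
    by (rule D_not, rule D_Bex, rule D_not, rule assms)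
  then show ?thesis by simp
qed

lemmas D_intros = D_not D_and D_or D_imp D_iff D_True D_False D_Bex D_Ball

end

subsection \<open>Rings\<close>

abbreviation rng_expr :: "'a::ring set \<Rightarrow> rng_form \<Rightarrow> ((nat \<Rightarrow> 'a) \<Rightarrow> bool) \<Rightarrow> bool" where
  "rng_expr A \<phi> P \<equiv> \<forall>e. range e \<subseteq> A \<longrightarrow> rng_sat A e \<phi> = P e"

definition rng_definable :: "'a::ring set \<Rightarrow> 'b::ring set \<Rightarrow> ((nat \<Rightarrow> 'a) \<Rightarrow> bool) \<Rightarrow> ((nat \<Rightarrow> 'b) \<Rightarrow> bool) \<Rightarrow> bool" where
  "rng_definable A B P Q \<longleftrightarrow> (\<exists>\<phi>. (rng_expr A \<phi> P) \<and> (rng_expr B \<phi> Q))"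

lemma rng_term_val_cong: "(\<And>i. i \<in> rng_term_vars t \<Longrightarrow> e i = e' i) \<Longrightarrow> rng_term_val e t = rng_term_val e' t"
  by (induction t) auto

lemma rng_sat_cong: "(\<And>i. i \<in> rng_free_vars \<phi> \<Longrightarrow> e i = e' i) \<Longrightarrow> rng_sat A e \<phi> = rng_sat A e' \<phi>"
proof (induction \<phi> arbitrary: e e')
  case (REq s t)
  then show ?case using rng_term_val_cong[of s e e'] rng_term_val_cong[of t e e'] by simp
next
  case (RNot \<phi>)
  have "rng_sat A e \<phi> = rng_sat A e' \<phi>" by (rule RNot.IH) (use RNot.prems in simp)
  then show ?case by simp
next
  case (RAnd \<phi> \<psi>)
  have "rng_sat A e \<phi> = rng_sat A e' \<phi>" by (rule RAnd.IH) (use RAnd.prems in simp)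
  moreover have "rng_sat A e \<psi> = rng_sat A e' \<psi>" by (rule RAnd.IH) (use RAnd.prems in simp)
  ultimately show ?case by simp
next
  case (REx n \<phi>)
  have "rng_sat A (e(n := a)) \<phi> = rng_sat A (e'(n := a)) \<phi>" for a
    by (rule REx.IH) (use REx.prems in auto)
  then show ?case by simp
qed

lemma finite_rng_term_vars: "finite (rng_term_vars t)"
  by (induction t) auto

lemma finite_rng_free_vars: "finite (rng_free_vars \<phi>)"
  by (induction \<phi>) (auto simp: finite_rng_term_vars)

primrec rng_term_ren :: "(nat \<Rightarrow> nat) \<Rightarrow> rng_term \<Rightarrow> rng_term" where
  "rng_term_ren \<sigma> (RVar n) = RVar (\<sigma> n)"
| "rng_term_ren \<sigma> RZero = RZero"
| "rng_term_ren \<sigma> (RAdd s t) = RAdd (rng_term_ren \<sigma> s) (rng_term_ren \<sigma> t)"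
| "rng_term_ren \<sigma> (RMul s t) = RMul (rng_term_ren \<sigma> s) (rng_term_ren \<sigma> t)"

definition fresh_var :: "nat set \<Rightarrow> nat" where
  "fresh_var V = (SOME m. m \<notin> V)"

lemma fresh_var: "finite V \<Longrightarrow> fresh_var V \<notin> V"
  unfolding fresh_var_def by (rule someI_ex) (rule ex_new_if_finite[OF infinite_UNIV_nat])

primrec rng_ren :: "rng_form \<Rightarrow> (nat \<Rightarrow> nat) \<Rightarrow> rng_form" where
  "rng_ren (REq s t) \<sigma> = REq (rng_term_ren \<sigma> s) (rng_term_ren \<sigma> t)"
| "rng_ren (RNot \<phi>) \<sigma> = RNot (rng_ren \<phi> \<sigma>)"
| "rng_ren (RAnd \<phi> \<psi>) \<sigma> = RAnd (rng_ren \<phi> \<sigma>) (rng_ren \<psi> \<sigma>)"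
| "rng_ren (REx n \<phi>) \<sigma> = (let m = fresh_var (\<sigma> ` rng_free_vars \<phi>) in REx m (rng_ren \<phi> (\<sigma>(n := m))))"

lemma rng_term_val_ren: "rng_term_val e (rng_term_ren \<sigma> t) = rng_term_val (\<lambda>i. e (\<sigma> i)) t"
  by (induction t) auto

lemma rng_sat_ren: "rng_sat A e (rng_ren \<phi> \<sigma>) = rng_sat A (\<lambda>i. e (\<sigma> i)) \<phi>"
proof (induction \<phi> arbitrary: e \<sigma>)
  case (REx n \<phi>)
  define m where "m = fresh_var (\<sigma> ` rng_free_vars \<phi>)"
  have m: "m \<notin> \<sigma> ` rng_free_vars \<phi>"
    unfolding m_def by (rule fresh_var) (simp add: finite_rng_free_vars)
  have "rng_sat A (\<lambda>i. (e(m := a)) ((\<sigma>(n := m)) i)) \<phi> = rng_sat A ((\<lambda>i. e (\<sigma> i))(n := a)) \<phi>" for a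
    by (rule rng_sat_cong) (use m in auto)
  then show ?case by (simp add: Let_def REx.IH flip: m_def)
qed (auto simp: rng_term_val_ren)

lemma range_upd_subset: "range e \<subseteq> S \<Longrightarrow> a \<in> S \<Longrightarrow> range (e(n := a)) \<subseteq> S"
  by auto

interpretation rng: definability A B "rng_definable A B" for A :: "'a::ring set" and B :: "'b::ring set"
proof
  show "rng_definable A B P' Q'" if "rng_definable A B P Q" "\<And>e. range e \<subseteq> A \<Longrightarrow> P e = P' e" "\<And>e. range e \<subseteq> B \<Longrightarrow> Q e = Q' e" for P Q P' Q'
    using that unfolding rng_definable_def by auto
  show "rng_definable A B (\<lambda>e. e i = e j) (\<lambda>e. e i = e j)" for i j
    unfolding rng_definable_def by (rule exI[of _ "REq (RVar i) (RVar j)"]) simp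
  show "rng_definable A B (\<lambda>e. \<not> P e) (\<lambda>e. \<not> Q e)" if PQ: "rng_definable A B P Q" for P Q
  proof -
    obtain \<phi> where "rng_expr A \<phi> P" "rng_expr B \<phi> Q"
      using PQ unfolding rng_definable_def by auto
    then show ?thesis unfolding rng_definable_def by (intro exI[of _ "RNot \<phi>"]) simp
  qed
  show "rng_definable A B (\<lambda>e. P e \<and> P' e) (\<lambda>e. Q e \<and> Q' e)" if PQ: "rng_definable A B P Q" "rng_definable A B P' Q'" for P Q P' Q'
  proof -
    obtain \<phi> \<psi> where "rng_expr A \<phi> P" "rng_expr B \<phi> Q"
       "rng_expr A \<psi> P'" "rng_expr B \<psi> Q'"
      using PQ unfolding rng_definable_def by auto
    then show ?thesis unfolding rng_definable_def by (intro exI[of _ "RAnd \<phi> \<psi>"]) simp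
  qed
  show "rng_definable A B (\<lambda>e. \<exists>a\<in>A. P (e(n := a))) (\<lambda>e. \<exists>b\<in>B. Q (e(n := b)))" if PQ: "rng_definable A B P Q" for P Q n
  proof -
    obtain \<phi> where \<phi>: "rng_expr A \<phi> P" "rng_expr B \<phi> Q"
      using PQ unfolding rng_definable_def by auto
    have "rng_sat A e (REx n \<phi>) = (\<exists>a\<in>A. P (e(n := a)))" if "range e \<subseteq> A" for e
      using \<phi>(1) range_upd_subset[OF that] unfolding rng_sat.simps by blast
    moreover have "rng_sat B e (REx n \<phi>) = (\<exists>a\<in>B. Q (e(n := a)))" if "range e \<subseteq> B" for e
      using \<phi>(2) range_upd_subset[OF that] unfolding rng_sat.simps by blast
    ultimately show ?thesis unfolding rng_definable_def by blast
  qed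
  show "rng_definable A B (\<lambda>e. P (\<lambda>i. e (\<sigma> i))) (\<lambda>e. Q (\<lambda>i. e (\<sigma> i)))" if PQ: "rng_definable A B P Q" for P Q \<sigma>
  proof -
    obtain \<phi> where \<phi>: "rng_expr A \<phi> P" "rng_expr B \<phi> Q"
      using PQ unfolding rng_definable_def by auto
    have *: "range (\<lambda>i. e (\<sigma> i)) \<subseteq> S" if "range e \<subseteq> S" for e :: "nat \<Rightarrow> 'c" and S
      using that by auto
    have "rng_sat A e (rng_ren \<phi> \<sigma>) = P (\<lambda>i. e (\<sigma> i))" if "range e \<subseteq> A" for e
      using \<phi>(1) *[OF that] unfolding rng_sat_ren by blast
    moreover have "rng_sat B e (rng_ren \<phi> \<sigma>) = Q (\<lambda>i. e (\<sigma> i))" if "range e \<subseteq> B" for e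
      using \<phi>(2) *[OF that] unfolding rng_sat_ren by blast
    ultimately show ?thesis unfolding rng_definable_def by blast
  qed
  show "\<exists>N. (\<forall>e e'. range e \<subseteq> A \<longrightarrow> range e' \<subseteq> A \<longrightarrow> (\<forall>i<N. e i = e' i) \<longrightarrow> P e = P e') \<and>
        (\<forall>e e'. range e \<subseteq> B \<longrightarrow> range e' \<subseteq> B \<longrightarrow> (\<forall>i<N. e i = e' i) \<longrightarrow> Q e = Q e')" if PQ: "rng_definable A B P Q" for P Q
  proof -
    obtain \<phi> where \<phi>: "rng_expr A \<phi> P" "rng_expr B \<phi> Q"
      using PQ unfolding rng_definable_def by auto
    obtain N where N: "\<forall>i\<in>rng_free_vars \<phi>. i < N"
      using finite_rng_free_vars[of \<phi>] finite_nat_set_iff_bounded by auto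
    show ?thesis
    proof (intro exI[of _ N] conjI allI impI)
      fix e e' :: "nat \<Rightarrow> 'a"
      assume "range e \<subseteq> A" "range e' \<subseteq> A" "\<forall>i<N. e i = e' i"
      then show "P e = P e'" using \<phi> rng_sat_cong[of \<phi> e e' A] N by auto
    next
      fix e e' :: "nat \<Rightarrow> 'b"
      assume "range e \<subseteq> B" "range e' \<subseteq> B" "\<forall>i<N. e i = e' i"
      then show "Q e = Q e'" using \<phi> rng_sat_cong[of \<phi> e e' B] N by auto
    qed
  qed
qed

section \<open>Ring equations and the passage to sentences\<close>

definition rng_term_definable :: "((nat \<Rightarrow> 'a::ring) \<Rightarrow> 'a) \<Rightarrow> ((nat \<Rightarrow> 'b::ring) \<Rightarrow> 'b) \<Rightarrow> bool" where
  "rng_term_definable x y \<longleftrightarrow> (\<exists>t. (\<forall>e. rng_term_val e t = x e) \<and> (\<forall>e. rng_term_val e t = y e))"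

lemma rng_term_definable_intros:
  "rng_term_definable (\<lambda>e. e i) (\<lambda>e. e i)"
  "rng_term_definable (\<lambda>e. 0) (\<lambda>e. 0)"
  "\<lbrakk>rng_term_definable x y; rng_term_definable x' y'\<rbrakk> \<Longrightarrow> rng_term_definable (\<lambda>e. x e + x' e) (\<lambda>e. y e + y' e)"
  "\<lbrakk>rng_term_definable x y; rng_term_definable x' y'\<rbrakk> \<Longrightarrow> rng_term_definable (\<lambda>e. x e * x' e) (\<lambda>e. y e * y' e)"
proof -
  show "rng_term_definable (\<lambda>e. e i) (\<lambda>e. e i)"
    unfolding rng_term_definable_def by (rule exI[of _ "RVar i"]) simp
  show "rng_term_definable (\<lambda>e. 0) (\<lambda>e. 0)"
    unfolding rng_term_definable_def by (rule exI[of _ RZero]) simp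
  assume "rng_term_definable x y" "rng_term_definable x' y'"
  then obtain s t where "\<And>e. rng_term_val e s = x e" "\<And>e. rng_term_val e s = y e"
    "\<And>e. rng_term_val e t = x' e" "\<And>e. rng_term_val e t = y' e"
    unfolding rng_term_definable_def by auto
  note st = this
  show "rng_term_definable (\<lambda>e. x e + x' e) (\<lambda>e. y e + y' e)"
    "rng_term_definable (\<lambda>e. x e * x' e) (\<lambda>e. y e * y' e)"
    unfolding rng_term_definable_def
    by (rule exI[of _ "RAdd s t"], simp add: st) (rule exI[of _ "RMul s t"], simp add: st)
qed

lemma rng_definable_eq:
  assumes "rng_term_definable x y" "rng_term_definable x' y'"
  shows "rng_definable A B (\<lambda>e. x e = x' e) (\<lambda>e. y e = y' e)"
proof -
  obtain s t where "\<And>e. rng_term_val e s = x e" "\<And>e. rng_term_val e s = y e"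
    "\<And>e. rng_term_val e t = x' e" "\<And>e. rng_term_val e t = y' e"
    using assms unfolding rng_term_definable_def by auto
  then show ?thesis
    unfolding rng_definable_def by (intro exI[of _ "REq s t"]) simp
qed

text \<open>True on every environment that counts, so carrier conditions may stay inside definitions
  such as \<open>cent\<close>.\<close>

lemma rng_definable_mem: "rng_definable A B (\<lambda>e. e i \<in> A) (\<lambda>e. e i \<in> B)"
  by (rule rng.D_cong[OF rng.D_True]) auto

text \<open>A formula of constant truth value may still have free variables. Existential
  quantification over a non-empty universe preserves a constant value, so they can be bound one at a
  time.\<close>

lemma rng_sat_closure:
  fixes A :: "'a::ring set" and B :: "'b::ring set"
  assumes "A \<noteq> {}" "B \<noteq> {}"
    and "rng_expr A \<phi> (\<lambda>_. b)" "rng_expr B \<phi> (\<lambda>_. c)"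
  shows "\<exists>\<psi>. rng_sentence \<psi> \<and> (rng_expr A \<psi> (\<lambda>_. b)) \<and> (rng_expr B \<psi> (\<lambda>_. c))"
  using assms(3,4)
proof (induction "card (rng_free_vars \<phi>)" arbitrary: \<phi>)
  case 0
  then show ?case using finite_rng_free_vars[of \<phi>] unfolding rng_sentence_def by auto
next
  case (Suc k)
  then obtain n where n: "n \<in> rng_free_vars \<phi>" by (metis card.empty ex_in_conv nat.distinct(1))
  have "rng_sat A e (REx n \<phi>) = b" if "range e \<subseteq> A" for e
    using assms(1) Suc.prems(1) range_upd_subset[OF that] unfolding rng_sat.simps by blast
  moreover have "rng_sat B e (REx n \<phi>) = c" if "range e \<subseteq> B" for e
    using assms(2) Suc.prems(2) range_upd_subset[OF that] unfolding rng_sat.simps by blast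
  ultimately have 1: "rng_expr A (REx n \<phi>) (\<lambda>_. b)" "rng_expr B (REx n \<phi>) (\<lambda>_. c)"
    by blast+
  have "k = card (rng_free_vars (REx n \<phi>))"
    using Suc.hyps(2) n finite_rng_free_vars[of \<phi>] by simp
  from Suc.hyps(1)[OF this 1] show ?case .
qed

text \<open>This is how elementary equivalence of algebras gets used: a property of the whole
  structure is viewed as a predicate that ignores its environment.\<close>

lemma rng_elem_equiv_const:
  assumes "rng_elem_equiv A B" "rng_definable A B (\<lambda>_. b) (\<lambda>_. c)" "A \<noteq> {}" "B \<noteq> {}"
  shows "b = c"
proof -
  obtain \<phi> where \<phi>: "rng_sentence \<phi>" "rng_expr A \<phi> (\<lambda>_. b)" "rng_expr B \<phi> (\<lambda>_. c)"
    using assms(2) rng_sat_closure[OF assms(3,4), of _ b c] unfolding rng_definable_def by blast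
  obtain x y where "x \<in> A" "y \<in> B" using assms(3,4) by auto
  then have "range (\<lambda>_::nat. x) \<subseteq> A" "range (\<lambda>_::nat. y) \<subseteq> B" by auto
  then have "rng_models A \<phi> = b" "rng_models B \<phi> = c" using \<phi> unfolding rng_models_def by blast+
  then show ?thesis using assms(1) \<phi>(1) unfolding rng_elem_equiv_def by auto
qed

subsection \<open>Hereditarily finite sets\<close>

text \<open>Only set variables are allowed to be free in definable predicates; the field enters
  through the atoms.\<close>

abbreviation hf_expr :: "hf_form \<Rightarrow> ((nat \<Rightarrow> 'k::field hf) \<Rightarrow> bool) \<Rightarrow> bool" where
  "hf_expr \<phi> P \<equiv> \<forall>e h. hf_sat UNIV e h \<phi> = P h"

definition hf_definable :: "'k::field itself \<Rightarrow> 'l::field itself \<Rightarrow> ((nat \<Rightarrow> 'k hf) \<Rightarrow> bool) \<Rightarrow> ((nat \<Rightarrow> 'l hf) \<Rightarrow> bool) \<Rightarrow> bool" where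
  "hf_definable _ _ P Q \<longleftrightarrow> (\<exists>\<phi>. hf_expr \<phi> P \<and> hf_expr \<phi> Q)"

text \<open>The levels increase, so the maximum of the levels of the finitely many members of a set
  contains all of them. Hence set quantifiers range over the whole type \<open>hf\<close>.\<close>

lemma HF_UNIV: "HF (UNIV :: 'k set) = UNIV"
proof -
  have mono: "HF_level m A \<subseteq> HF_level n A" if "m \<le> n" for m n and A :: "'k set"
    by (rule lift_Suc_mono_le[OF _ that]) simp
  have "\<exists>n. x \<in> HF_level n UNIV" for x :: "'k hf"
  proof (induction x)
    case (Atom a)
    then show ?case by (intro exI[of _ 0]) simp
  next
    case (HSet S)
    then obtain n where n: "\<And>x. x \<in> fset S \<Longrightarrow> x \<in> HF_level (n x) UNIV" by metis
    define N where "N = Max (insert 0 (n ` fset S))"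
    have "x \<in> HF_level N UNIV" if "x \<in> fset S" for x
      using mono[of "n x" N] n that unfolding N_def by auto
    then have "HSet S \<in> HF_level (Suc N) UNIV" by (auto simp: Pf_def)
    then show ?case by blast
  qed
  then show ?thesis by (auto simp: HF_def)
qed

lemma field_term_val_cong: "(\<And>i. i \<in> field_term_vars t \<Longrightarrow> e i = e' i) \<Longrightarrow> field_term_val e t = field_term_val e' t"
  by (induction t) auto

lemma hf_term_val_cong:
  "(\<And>i. Inl i \<in> hf_term_vars t \<Longrightarrow> e i = e' i) \<Longrightarrow> (\<And>i. Inr i \<in> hf_term_vars t \<Longrightarrow> h i = h' i) \<Longrightarrow>
   hf_term_val e h t = hf_term_val e' h' t"
  by (cases t) (auto intro: field_term_val_cong)

lemma hf_sat_cong: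
  "(\<And>i. Inl i \<in> hf_free_vars \<phi> \<Longrightarrow> e i = e' i) \<Longrightarrow> (\<And>i. Inr i \<in> hf_free_vars \<phi> \<Longrightarrow> h i = h' i) \<Longrightarrow>
   hf_sat F e h \<phi> = hf_sat F e' h' \<phi>"
proof (induction \<phi> arbitrary: e e' h h')
  case (HEq s t)
  then show ?case using hf_term_val_cong[of s e e' h h'] hf_term_val_cong[of t e e' h h'] by simp
next
  case (HMem s t)
  then show ?case using hf_term_val_cong[of s e e' h h'] hf_term_val_cong[of t e e' h h'] by simp
next
  case (HNot \<phi>)
  have "hf_sat F e h \<phi> = hf_sat F e' h' \<phi>" by (rule HNot.IH) (use HNot.prems in simp_all)
  then show ?case by simp
next
  case (HAnd \<phi> \<psi>)
  have "hf_sat F e h \<phi> = hf_sat F e' h' \<phi>" by (rule HAnd.IH) (use HAnd.prems in simp_all)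
  moreover have "hf_sat F e h \<psi> = hf_sat F e' h' \<psi>" by (rule HAnd.IH) (use HAnd.prems in simp_all)
  ultimately show ?case by simp
next
  case (HExF n \<phi>)
  have "hf_sat F (e(n := a)) h \<phi> = hf_sat F (e'(n := a)) h' \<phi>" for a
    by (rule HExF.IH) (use HExF.prems in auto)
  then show ?case by simp
next
  case (HExS n \<phi>)
  have "hf_sat F e (h(n := a)) \<phi> = hf_sat F e' (h'(n := a)) \<phi>" for a
    by (rule HExS.IH) (use HExS.prems in auto)
  then show ?case by simp
qed

lemma finite_field_term_vars: "finite (field_term_vars t)"
  by (induction t) auto

lemma finite_hf_free_vars: "finite (hf_free_vars \<phi>)"
proof -
  have "finite (hf_term_vars t)" for t
    by (induction t) (simp_all add: finite_field_term_vars)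
  then show ?thesis by (induction \<phi>) simp_all
qed

primrec hf_term_ren :: "(nat \<Rightarrow> nat) \<Rightarrow> hf_term \<Rightarrow> hf_term" where
  "hf_term_ren \<sigma> (HVar n) = HVar (\<sigma> n)"
| "hf_term_ren \<sigma> (HElem t) = HElem t"

primrec hf_ren :: "hf_form \<Rightarrow> (nat \<Rightarrow> nat) \<Rightarrow> hf_form" where
  "hf_ren (HEq s t) \<sigma> = HEq (hf_term_ren \<sigma> s) (hf_term_ren \<sigma> t)"
| "hf_ren (HMem s t) \<sigma> = HMem (hf_term_ren \<sigma> s) (hf_term_ren \<sigma> t)"
| "hf_ren (HNot \<phi>) \<sigma> = HNot (hf_ren \<phi> \<sigma>)"
| "hf_ren (HAnd \<phi> \<psi>) \<sigma> = HAnd (hf_ren \<phi> \<sigma>) (hf_ren \<psi> \<sigma>)"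
| "hf_ren (HExF n \<phi>) \<sigma> = HExF n (hf_ren \<phi> \<sigma>)"
| "hf_ren (HExS n \<phi>) \<sigma> = (let m = fresh_var (\<sigma> ` {i. Inr i \<in> hf_free_vars \<phi>}) in HExS m (hf_ren \<phi> (\<sigma>(n := m))))"

lemma hf_term_val_ren: "hf_term_val e h (hf_term_ren \<sigma> t) = hf_term_val e (\<lambda>i. h (\<sigma> i)) t"
  by (cases t) auto

lemma finite_hf_free_set_vars: "finite {i. Inr i \<in> hf_free_vars \<phi>}"
  using finite_vimageI[OF finite_hf_free_vars[of \<phi>], of Inr] by (simp add: vimage_def)

lemma hf_sat_ren: "hf_sat F e h (hf_ren \<phi> \<sigma>) = hf_sat F e (\<lambda>i. h (\<sigma> i)) \<phi>"
proof (induction \<phi> arbitrary: e h \<sigma>)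
  case (HExS n \<phi>)
  define m where "m = fresh_var (\<sigma> ` {i. Inr i \<in> hf_free_vars \<phi>})"
  have m: "m \<notin> \<sigma> ` {i. Inr i \<in> hf_free_vars \<phi>}"
    unfolding m_def by (rule fresh_var) (simp add: finite_hf_free_set_vars)
  have "hf_sat F e (\<lambda>i. (h(m := a)) ((\<sigma>(n := m)) i)) \<phi> = hf_sat F e ((\<lambda>i. h (\<sigma> i))(n := a)) \<phi>" for a
    by (rule hf_sat_cong) (use m in auto)
  then show ?case by (simp add: Let_def HExS.IH flip: m_def)
qed (auto simp: hf_term_val_ren)

interpretation hf: definability UNIV UNIV "hf_definable TYPE('k::field) TYPE('l::field)"
proof
  let ?D = "hf_definable TYPE('k) TYPE('l)"
  show "?D P' Q'" if "?D P Q" "\<And>e. range e \<subseteq> UNIV \<Longrightarrow> P e = P' e" "\<And>e. range e \<subseteq> UNIV \<Longrightarrow> Q e = Q' e" for P Q P' Q'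
    using that unfolding hf_definable_def by auto
  show "?D (\<lambda>e. e i = e j) (\<lambda>e. e i = e j)" for i j
    unfolding hf_definable_def by (rule exI[of _ "HEq (HVar i) (HVar j)"]) simp
  show "?D (\<lambda>e. \<not> P e) (\<lambda>e. \<not> Q e)" if PQ: "?D P Q" for P Q
  proof -
    obtain \<phi> where "hf_expr \<phi> P" "hf_expr \<phi> Q"
      using PQ unfolding hf_definable_def by auto
    then show ?thesis unfolding hf_definable_def by (intro exI[of _ "HNot \<phi>"]) simp
  qed
  show "?D (\<lambda>e. P e \<and> P' e) (\<lambda>e. Q e \<and> Q' e)" if PQ: "?D P Q" "?D P' Q'" for P Q P' Q'
  proof -
    obtain \<phi> \<psi> where "hf_expr \<phi> P" "hf_expr \<phi> Q"
       "hf_expr \<psi> P'" "hf_expr \<psi> Q'"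
      using PQ unfolding hf_definable_def by auto
    then show ?thesis unfolding hf_definable_def by (intro exI[of _ "HAnd \<phi> \<psi>"]) simp
  qed
  show "?D (\<lambda>e. \<exists>a\<in>UNIV. P (e(n := a))) (\<lambda>e. \<exists>b\<in>UNIV. Q (e(n := b)))" if PQ: "?D P Q" for P Q n
  proof -
    obtain \<phi> where \<phi>: "hf_expr \<phi> P" "hf_expr \<phi> Q"
      using PQ unfolding hf_definable_def by auto
    then show ?thesis unfolding hf_definable_def by (intro exI[of _ "HExS n \<phi>"]) (auto simp: HF_UNIV)
  qed
  show "?D (\<lambda>e. P (\<lambda>i. e (\<sigma> i))) (\<lambda>e. Q (\<lambda>i. e (\<sigma> i)))" if PQ: "?D P Q" for P Q \<sigma>
  proof -
    obtain \<phi> where \<phi>: "hf_expr \<phi> P" "hf_expr \<phi> Q"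
      using PQ unfolding hf_definable_def by auto
    then show ?thesis unfolding hf_definable_def
      by (intro exI[of _ "hf_ren \<phi> \<sigma>"]) (simp add: hf_sat_ren)
  qed
  show "\<exists>N. (\<forall>e e'. range e \<subseteq> UNIV \<longrightarrow> range e' \<subseteq> UNIV \<longrightarrow> (\<forall>i<N. e i = e' i) \<longrightarrow> P e = P e') \<and>
        (\<forall>e e'. range e \<subseteq> UNIV \<longrightarrow> range e' \<subseteq> UNIV \<longrightarrow> (\<forall>i<N. e i = e' i) \<longrightarrow> Q e = Q e')" if PQ: "?D P Q" for P Q
  proof -
    obtain \<phi> where \<phi>: "hf_expr \<phi> P" "hf_expr \<phi> Q"
      using PQ unfolding hf_definable_def by auto
    obtain N where N: "\<forall>i\<in>{i. Inr i \<in> hf_free_vars \<phi>}. i < N"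
      using finite_hf_free_set_vars[of \<phi>] finite_nat_set_iff_bounded by auto
    show ?thesis
    proof (intro exI[of _ N] conjI allI impI)
      fix e e' :: "nat \<Rightarrow> 'k hf"
      assume "\<forall>i<N. e i = e' i"
      then have "hf_sat UNIV undefined e \<phi> = hf_sat UNIV undefined e' \<phi>"
        by (intro hf_sat_cong) (use N in auto)
      then show "P e = P e'" using \<phi> by auto
    next
      fix e e' :: "nat \<Rightarrow> 'l hf"
      assume "\<forall>i<N. e i = e' i"
      then have "hf_sat UNIV undefined e \<phi> = hf_sat UNIV undefined e' \<phi>"
        by (intro hf_sat_cong) (use N in auto)
      then show "Q e = Q e'" using \<phi> by auto
    qed
  qed
qed

lemma hf_definable_mem: "hf_definable TYPE('k::field) TYPE('l::field) (\<lambda>e. hf_mem (e i) (e j)) (\<lambda>e. hf_mem (e i) (e j))"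
  unfolding hf_definable_def by (rule exI[of _ "HMem (HVar i) (HVar j)"]) simp

definition is_atom :: "'k hf \<Rightarrow> bool" where
  "is_atom x \<longleftrightarrow> (\<exists>a. x = Atom a)"

text \<open>The shape a + b c is the one that occurs in the Leibniz rule for left derivatives; with
  a = 0 it also expresses the product of constant terms.\<close>

definition atom_muladd :: "'k::field hf \<Rightarrow> 'k hf \<Rightarrow> 'k hf \<Rightarrow> 'k hf \<Rightarrow> bool" where
  "atom_muladd x y z w \<longleftrightarrow> (\<exists>a b c. x = Atom a \<and> y = Atom b \<and> z = Atom c \<and> w = Atom (a + b * c))"

lemma hf_definable_is_atom: "hf_definable TYPE('k::field) TYPE('l::field) (\<lambda>e. is_atom (e i)) (\<lambda>e. is_atom (e i))"
  unfolding hf_definable_def is_atom_def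
  by (rule exI[of _ "HExF 0 (HEq (HVar i) (HElem (FVar 0)))"]) simp

lemma hf_definable_atom_zero: "hf_definable TYPE('k::field) TYPE('l::field) (\<lambda>e. e i = Atom 0) (\<lambda>e. e i = Atom 0)"
  unfolding hf_definable_def
  by (rule exI[of _ "HEq (HVar i) (HElem FZero)"]) simp

lemma hf_definable_atom_muladd:
  "hf_definable TYPE('k::field) TYPE('l::field) (\<lambda>e. atom_muladd (e i) (e j) (e k) (e l)) (\<lambda>e. atom_muladd (e i) (e j) (e k) (e l))"
  unfolding hf_definable_def atom_muladd_def
  by (rule exI[of _ "HExF 0 (HExF 1 (HExF 2 (HAnd (HEq (HVar i) (HElem (FVar 0))) (HAnd (HEq (HVar j) (HElem (FVar 1)))
      (HAnd (HEq (HVar k) (HElem (FVar 2))) (HEq (HVar l) (HElem (FAdd (FVar 0) (FMul (FVar 1) (FVar 2))))))))))"])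
    simp

lemma hf_sat_closure:
  fixes b c :: bool
  assumes "hf_expr \<phi> (\<lambda>_ :: nat \<Rightarrow> 'k::field hf. b)" "hf_expr \<phi> (\<lambda>_ :: nat \<Rightarrow> 'l::field hf. c)"
  shows "\<exists>\<psi>. hf_sentence \<psi> \<and> (hf_expr \<psi> (\<lambda>_ :: nat \<Rightarrow> 'k hf. b)) \<and> (hf_expr \<psi> (\<lambda>_ :: nat \<Rightarrow> 'l hf. c))"
  using assms
proof (induction "card (hf_free_vars \<phi>)" arbitrary: \<phi>)
  case 0
  then show ?case using finite_hf_free_vars[of \<phi>] unfolding hf_sentence_def by auto
next
  case (Suc k)
  then obtain v where v: "v \<in> hf_free_vars \<phi>" by (metis card.empty ex_in_conv nat.distinct(1))
  define \<psi> where "\<psi> = (case v of Inl n \<Rightarrow> HExF n \<phi> | Inr n \<Rightarrow> HExS n \<phi>)"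
  have 1: "hf_expr \<psi> (\<lambda>_ :: nat \<Rightarrow> 'k hf. b)" "hf_expr \<psi> (\<lambda>_ :: nat \<Rightarrow> 'l hf. c)"
    using Suc.prems by (auto simp: \<psi>_def HF_UNIV split: sum.splits)
  have "k = card (hf_free_vars \<psi>)"
    using Suc.hyps(2) v finite_hf_free_vars[of \<phi>] by (auto simp: \<psi>_def split: sum.splits)
  from Suc.hyps(1)[OF this 1] show ?case .
qed

lemma hf_elem_equiv_const:
  fixes b c :: bool
  assumes "hf_elem_equiv (UNIV :: 'k::field set) (UNIV :: 'l::field set)" "hf_definable TYPE('k) TYPE('l) (\<lambda>_. b) (\<lambda>_. c)"
  shows "b = c"
proof -
  obtain \<phi> where \<phi>: "hf_sentence \<phi>" "hf_expr \<phi> (\<lambda>_ :: nat \<Rightarrow> 'k hf. b)" "hf_expr \<phi> (\<lambda>_ :: nat \<Rightarrow> 'l hf. c)"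
    using assms(2) hf_sat_closure[where 'k='k and 'l='l, of _ b c] unfolding hf_definable_def by blast
  have "hf_models (UNIV :: 'k set) \<phi> = b" "hf_models (UNIV :: 'l set) \<phi> = c"
    using \<phi> unfolding hf_models_def by (auto simp: HF_UNIV)
  then show ?thesis using assms(1) \<phi>(1) unfolding hf_elem_equiv_def by auto
qed

section \<open>Free algebras\<close>

type_synonym ('x, 'k) ncp = "'x list \<Rightarrow>\<^sub>0 'k"

abbreviation lookup :: "('a \<Rightarrow>\<^sub>0 'b::zero) \<Rightarrow> 'a \<Rightarrow> 'b" where
  "lookup \<equiv> Poly_Mapping.lookup"

abbreviation keys :: "('a \<Rightarrow>\<^sub>0 'b::zero) \<Rightarrow> 'a set" where
  "keys \<equiv> Poly_Mapping.keys"

abbreviation single :: "'a \<Rightarrow> 'b \<Rightarrow> ('a \<Rightarrow>\<^sub>0 'b::zero)" where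
  "single \<equiv> Poly_Mapping.single"

lemma poly_mapping_sum_single:
  fixes p :: "'a \<Rightarrow>\<^sub>0 'b::comm_monoid_add"
  shows "p = (\<Sum>u\<in>keys p. single u (lookup p u))"
proof (rule poly_mapping_eqI)
  fix w
  have "(\<Sum>u\<in>keys p. lookup (single u (lookup p u)) w) = (\<Sum>u\<in>keys p. if u = w then lookup p u else 0)"
    by (intro sum.cong) (auto simp: lookup_single when_def)
  also have "\<dots> = lookup p w"
    by (simp add: in_keys_iff)
  finally show "lookup p w = lookup (\<Sum>u\<in>keys p. single u (lookup p u)) w"
    by (simp add: lookup_sum)
qed

lemma poly_mapping_add_induct [case_names zero single add]:
  fixes p :: "'a \<Rightarrow>\<^sub>0 'b::comm_monoid_add"
  assumes "P 0" "\<And>u c. P (single u c)" "\<And>p q. P p \<Longrightarrow> P q \<Longrightarrow> P (p + q)"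
  shows "P p"
proof -
  have "P (\<Sum>u\<in>S. single u (lookup p u))" if "finite S" for S
    using that by (induction S rule: finite_induct) (auto intro: assms)
  then have "P (\<Sum>u\<in>keys p. single u (lookup p u))" by simp
  then show ?thesis by (simp flip: poly_mapping_sum_single)
qed

text \<open>Both sides are additive in \<open>p\<close> and in \<open>q\<close>, which reduces the
  claim to two monomials u and v. There only the cut of w at the length of u can contribute, and it
  does so iff w = u @ v.\<close>

lemma lookup_mult_list:
  fixes p q :: "('x, 'k::field) ncp"
  shows "lookup (p * q) w = (\<Sum>k\<le>length w. lookup p (take k w) * lookup q (drop k w))"
proof (induction p rule: poly_mapping_add_induct)
  case (single u a)
  show ?case
  proof (induction q rule: poly_mapping_add_induct)
    case (single v b)
    have "(\<Sum>k\<le>length w. lookup (single u a) (take k w) * lookup (single v b) (drop k w)) =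
        (\<Sum>k\<le>length w. if k = length u then (if w = u @ v then a * b else 0) else 0)"
    proof (intro sum.cong refl)
      fix k assume k: "k \<in> {..length w}"
      have iff: "u = take k w \<and> v = drop k w \<longleftrightarrow> k = length u \<and> w = u @ v"
      proof
        assume "u = take k w \<and> v = drop k w"
        then show "k = length u \<and> w = u @ v" using k by simp
      qed simp
      have "lookup (single u a) (take k w) * lookup (single v b) (drop k w) =
          (if u = take k w \<and> v = drop k w then a * b else 0)"
        by (simp add: lookup_single when_def)
      then show "lookup (single u a) (take k w) * lookup (single v b) (drop k w) =
          (if k = length u then (if w = u @ v then a * b else 0) else 0)"
        unfolding iff by simp
    qed
    also have "\<dots> = (if w = u @ v then a * b else 0)"
      by auto
    finally show ?case
      by (auto simp: single_mult_single_list lookup_single when_def)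
  qed (simp_all add: lookup_add distrib_left sum.distrib)
qed (simp_all add: lookup_add distrib_right sum.distrib)

abbreviation sc :: "'k \<Rightarrow> ('x, 'k::field) ncp" where
  "sc c \<equiv> single [] c"

lemma lookup_sc_mult: "lookup (sc c * p) w = c * lookup p w"
proof -
  have "lookup (sc c * p) w = (\<Sum>k\<le>length w. if k = 0 then c * lookup p w else 0)"
    unfolding lookup_mult_list by (intro sum.cong) (auto simp: lookup_single when_def)
  then show ?thesis by simp
qed

lemma lookup_mult_sc: "lookup (p * sc c) w = lookup p w * c"
proof -
  have "lookup (p * sc c) w = (\<Sum>k\<le>length w. if k = length w then lookup p w * c else 0)"
    unfolding lookup_mult_list by (intro sum.cong) (auto simp: lookup_single when_def)
  then show ?thesis by simp
qed

lemma sc_commute: "p * sc c = sc c * (p :: ('x, 'k::field) ncp)"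
  by (rule poly_mapping_eqI) (simp add: lookup_sc_mult lookup_mult_sc)

lemma sc_left_commute: "p * (sc c * q) = sc c * (p * (q :: ('x, 'k::field) ncp))"
  by (metis mult.assoc sc_commute)

lemma sc_1: "(sc 1 :: ('x, 'k::field) ncp) = 1"
  by (rule poly_mapping_eqI) (auto simp: lookup_single lookup_one zero_list_def when_def)

lemma sc_mult_sc: "sc a * sc b = sc (a * b)"
  by (simp add: single_mult_single_list)

subsection \<open>Degree\<close>

text \<open>The inserted 0 gives the zero polynomial degree 0, so statements about degrees carry
  their non-zero hypotheses separately.\<close>

definition deg :: "('x, 'k::field) ncp \<Rightarrow> nat" where
  "deg p = Max (insert 0 (length ` keys p))"

lemma deg_le_iff: "deg p \<le> n \<longleftrightarrow> (\<forall>w. lookup p w \<noteq> 0 \<longrightarrow> length w \<le> n)"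
  by (auto simp: deg_def in_keys_iff)

lemma length_le_deg: "lookup p w \<noteq> 0 \<Longrightarrow> length w \<le> deg p"
  using deg_le_iff[of p "deg p"] by simp

lemma deg_attained:
  assumes "p \<noteq> 0"
  shows "\<exists>w. lookup p w \<noteq> 0 \<and> length w = deg p"
proof -
  have "keys p \<noteq> {}" using assms by simp
  then have "deg p = Max (length ` keys p)"
    unfolding deg_def by (subst Max_insert) auto
  then have "deg p \<in> length ` keys p"
    using \<open>keys p \<noteq> {}\<close> by (metis Max_in finite_imageI finite_keys image_is_empty)
  then show ?thesis by (auto simp: in_keys_iff)
qed

text \<open>A cut of u @ v inside u leaves more than \<open>deg q\<close> letters on the right, and
  one beyond u more than \<open>deg p\<close> letters on the left; only the cut between u and v
  survives.\<close>

lemma lookup_mult_top: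
  assumes "deg p \<le> length u" "deg q \<le> length v"
  shows "lookup (p * q) (u @ v) = lookup p u * lookup q v"
proof -
  have "lookup p (take k (u @ v)) * lookup q (drop k (u @ v)) = 0" if "k \<le> length (u @ v)" "k \<noteq> length u" for k
  proof (cases "k < length u")
    case True
    then have "length (drop k (u @ v)) > deg q" using assms(2) by simp
    then show ?thesis using length_le_deg[of q] by (metis leD mult_zero_right)
  next
    case False
    then have "length (take k (u @ v)) > deg p" using assms(1) that by simp
    then show ?thesis using length_le_deg[of p] by (metis leD mult_zero_left)
  qed
  then have "lookup (p * q) (u @ v) = (\<Sum>k\<le>length (u @ v). if k = length u then lookup p u * lookup q v else 0)"
    unfolding lookup_mult_list by (intro sum.cong) auto
  then show ?thesis by simp
qed

lemma deg_mult_le: "deg (p * q) \<le> deg p + deg q"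
proof -
  have "length w \<le> deg p + deg q" if w: "lookup (p * q) w \<noteq> 0" for w
  proof -
    obtain k where "lookup p (take k w) * lookup q (drop k w) \<noteq> 0" "k \<le> length w"
      using sum.not_neutral_contains_not_neutral[OF w[unfolded lookup_mult_list]] by auto
    then have "length (take k w) \<le> deg p" "length (drop k w) \<le> deg q" "k \<le> length w"
      by (auto intro: length_le_deg simp del: length_take length_drop)
    then show ?thesis by simp
  qed
  then show ?thesis by (simp add: deg_le_iff)
qed

text \<open>No monomial order is involved: a word of length deg p + deg q splits in one way only
  into words of the two top lengths, so top terms cannot cancel.\<close>

lemma free_mult_nonzero_deg:
  assumes "p \<noteq> 0" "q \<noteq> 0"
  shows "p * q \<noteq> 0" and "deg (p * q) = deg p + deg q"
proof -
  obtain u v where uv: "lookup p u \<noteq> 0" "length u = deg p" "lookup q v \<noteq> 0" "length v = deg q"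
    using deg_attained assms by metis
  then have *: "lookup (p * q) (u @ v) \<noteq> 0" using lookup_mult_top[of p u q v] by simp
  then show "p * q \<noteq> 0" by auto
  show "deg (p * q) = deg p + deg q"
    using length_le_deg[OF *] uv deg_mult_le[of p q] by simp
qed

lemma free_mult_left_cancel:
  fixes t :: "('x, 'k::field) ncp"
  assumes "t \<noteq> 0"
  shows "t * p = t * q \<longleftrightarrow> p = q"
  using free_mult_nonzero_deg(1)[OF assms, of "p - q"] by (auto simp: right_diff_distrib)

text \<open>Reading the coefficient of u @ w in c t = t c gives c(u) t(w) = t(u) c(w). The leading
  forms are thus proportional, with factor c(w) / t(w) for any w at which t attains its
  degree.\<close>

lemma commuting_same_deg:
  assumes "t \<noteq> 0" "c * t = t * c" "deg c = deg t"
  shows "\<exists>a. \<forall>u. deg t \<le> length u \<longrightarrow> lookup (c - sc a * t) u = 0"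
proof -
  obtain w where w: "lookup t w \<noteq> 0" "length w = deg t" using deg_attained[OF assms(1)] by blast
  define a where "a = lookup c w / lookup t w"
  have "lookup (c - sc a * t) u = 0" if u: "deg t \<le> length u" for u
  proof -
    have "lookup c u * lookup t w = lookup t u * lookup c w"
      using lookup_mult_top[of c u t w] lookup_mult_top[of t u c w] u w assms(2,3) by simp
    then show ?thesis using w by (simp add: lookup_minus lookup_sc_mult a_def field_simps)
  qed
  then show ?thesis by blast
qed

subsection \<open>Closure properties\<close>

lemma free_alg_iff: "p \<in> free_alg X \<longleftrightarrow> (\<forall>w. lookup p w \<noteq> 0 \<longrightarrow> w \<in> lists X \<and> w \<noteq> [])"
  by (auto simp: free_alg_def in_keys_iff)

lemma free_alg_diff: "p \<in> free_alg X \<Longrightarrow> q \<in> free_alg X \<Longrightarrow> p - q \<in> free_alg X"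
  unfolding free_alg_iff lookup_minus by (metis diff_self)

lemma free_alg_sc: "p \<in> free_alg X \<Longrightarrow> sc c * p \<in> free_alg X"
  unfolding free_alg_iff lookup_sc_mult by (metis mult_zero_right)

lemma free_alg_deg_pos: "p \<in> free_alg X \<Longrightarrow> p \<noteq> 0 \<Longrightarrow> deg p > 0"
  using deg_attained[of p] by (fastforce simp: free_alg_iff)

subsection \<open>Evaluation of polynomials\<close>

text \<open>Horner evaluation in the ambient unital algebra. Since P may have a constant term,
  \<open>ev t P\<close> itself can lie outside the algebra without unity; \<open>t * ev t P\<close>
  lies inside.\<close>

definition ev :: "('x, 'k::field) ncp \<Rightarrow> 'k poly \<Rightarrow> ('x, 'k) ncp" where
  "ev t P = fold_coeffs (\<lambda>c q. sc c + t * q) P 0"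

lemma ev_0 [simp]: "ev t 0 = 0"
  by (simp add: ev_def)

lemma ev_pCons [simp]: "ev t (pCons c P) = sc c + t * ev t P"
  by (cases "c = 0 \<and> P = 0") (auto simp: ev_def)

lemma ev_add: "ev t (P + Q) = ev t P + ev t Q"
  by (induction P Q rule: poly_induct2) (simp_all add: single_add algebra_simps)

lemma ev_smult: "ev t (smult a P) = sc a * ev t P"
  by (induction P) (simp_all add: sc_mult_sc distrib_left sc_left_commute[of t])

lemma ev_commute: "ev t P * t = t * ev t P"
  by (induction P) (simp_all add: distrib_left distrib_right sc_commute[of t] mult.assoc)

lemma ev_mult: "ev t (P * Q) = ev t P * ev t Q"
  by (induction P) (simp_all add: ev_add ev_smult distrib_right mult.assoc)

lemma ev_in_free_alg:
  assumes "t \<in> free_alg X"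
  shows "t * ev t P \<in> free_alg X"
proof (induction P)
  case 0
  then show ?case by (simp add: free_alg_zero)
next
  case (pCons a P)
  have "t * ev t (pCons a P) = sc a * t + t * (t * ev t P)"
    by (simp add: distrib_left sc_commute[of t])
  then show ?case using pCons assms by (metis free_alg_add free_alg_mult free_alg_sc)
qed

text \<open>Since t has no constant term, the constant term of \<open>ev t (pCons c P)\<close> is c.
  After comparing it, t can be cancelled and the remaining coefficients follow by induction.\<close>

lemma ev_inj:
  assumes "t \<in> free_alg X" "t \<noteq> 0"
  shows "ev t P = ev t Q \<longleftrightarrow> P = Q"
proof -
  have "lookup (t * ev t P) [] = 0" for P
    using ev_in_free_alg[OF assms(1), of P] by (auto simp: free_alg_iff)
  then have const: "lookup (ev t (pCons c P)) [] = c" for c P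
    by (simp add: lookup_add lookup_single)
  have "P = Q" if "ev t P = ev t Q"
    using that
  proof (induction P Q rule: poly_induct2)
    case (pCons a P b Q)
    have ab: "a = b" using const[of a P] const[of b Q] pCons.prems by metis
    then have "t * ev t P = t * ev t Q" using pCons.prems by simp
    then show ?case using pCons.IH ab assms(2) by (simp add: free_mult_left_cancel)
  qed simp
  then show ?thesis by blast
qed

section \<open>Elements whose centralizer is a polynomial ring\<close>

definition cent :: "'a::ring set \<Rightarrow> 'a \<Rightarrow> 'a set" where
  "cent A t = {p \<in> A. t * p = p * t}"

text \<open>Inside t K[t] a factorization of t t has both factors linear in t, so its factors are
  the non-zero scalar multiples of t; 0 divides no non-zero element and is added by hand.\<close>

definition ksc :: "'a::ring set \<Rightarrow> 'a \<Rightarrow> 'a set" where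
  "ksc A t = {c \<in> cent A t. c = 0 \<or> (\<exists>d\<in>A. d \<in> cent A t \<and> c * d = t * t)}"

text \<open>The clause on products forces t to have least degree among the non-zero elements of its
  centralizer. The last clause is division by t with remainder in K t, and it drives the descent to
  t K[t].\<close>

definition theta :: "'a::ring set \<Rightarrow> 'a \<Rightarrow> bool" where
  "theta A t \<longleftrightarrow> t \<noteq> 0 \<and>
     (\<forall>p\<in>A. \<forall>r\<in>A. p \<in> cent A t \<and> r \<in> cent A t \<longrightarrow> (\<exists>s\<in>A. s \<in> cent A t \<and> t * s = p * r)) \<and>
     (\<forall>p\<in>A. p \<in> cent A t \<longrightarrow> (\<exists>c\<in>A. \<exists>q\<in>A. c \<in> ksc A t \<and> q \<in> cent A t \<and> p = c + t * q))"

lemma cent_diff: "p \<in> cent (free_alg X) t \<Longrightarrow> q \<in> cent (free_alg X) t \<Longrightarrow> p - q \<in> cent (free_alg X) t"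
  by (auto simp: cent_def free_alg_diff algebra_simps)

lemma cent_sc: "p \<in> cent (free_alg X) t \<Longrightarrow> sc c * p \<in> cent (free_alg X) t"
  by (auto simp: cent_def free_alg_sc sc_left_commute[of t] mult.assoc)

lemma sc_mult_self_in_ksc:
  assumes "t \<in> free_alg X"
  shows "sc a * t \<in> ksc (free_alg X) t"
proof -
  have t: "t \<in> cent (free_alg X) t" using assms by (simp add: cent_def)
  have "(sc a * t) * (sc (1 / a) * t) = t * t" if "a \<noteq> 0"
  proof -
    have "(sc a * t) * (sc (1 / a) * t) = sc a * sc (1 / a) * (t * t)"
      by (simp only: mult.assoc sc_left_commute[of t])
    then show ?thesis using that by (simp add: sc_mult_sc sc_1)
  qed
  then show ?thesis
    using cent_sc[OF t, of a] cent_sc[OF t, of "1 / a"] free_alg_sc[OF assms, of "1 / a"]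
    unfolding ksc_def by (cases "a = 0") auto
qed

text \<open>Let m have least degree in the centralizer, apart from 0. Then m m = t s with s in the
  centralizer, so deg t + deg s = 2 deg m, while deg s is at least deg m.\<close>

lemma theta_min_deg:
  assumes th: "theta (free_alg X) t" and t: "t \<in> free_alg X"
    and p: "p \<in> cent (free_alg X) t" "p \<noteq> 0"
  shows "deg t \<le> deg p"
proof -
  let ?C = "cent (free_alg X) t"
  obtain m where m: "m \<in> ?C - {0}" "\<And>q. q \<in> ?C - {0} \<Longrightarrow> deg m \<le> deg q"
    using ex_has_least_nat[of "\<lambda>q. q \<in> ?C - {0}" p deg] p by auto
  then obtain s where s: "s \<in> ?C" "t * s = m * m"
    using th unfolding theta_def cent_def by (smt (verit) DiffD1 mem_Collect_eq)
  have mm: "m * m \<noteq> 0" "deg (m * m) = deg m + deg m" using free_mult_nonzero_deg[of m m] m by auto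
  then have "s \<noteq> 0" "t \<noteq> 0" using s by auto
  then have "deg t + deg s = deg m + deg m"
    using free_mult_nonzero_deg(2)[of t s] s mm by simp
  moreover have "deg m \<le> deg s" using m(2)[of s] s \<open>s \<noteq> 0\<close> by simp
  moreover have "deg m \<le> deg p" using m(2)[of p] p by simp
  ultimately show ?thesis by simp
qed

section \<open>Scalars and polynomials inside the centralizer of t\<close>

locale theta_elem =
  fixes X :: "'x set" and t :: "('x, 'k::field) ncp"
  assumes th: "theta (free_alg X) t" and tA: "t \<in> free_alg X"
begin

abbreviation "A \<equiv> (free_alg X :: ('x, 'k) ncp set)"

lemma t0: "t \<noteq> 0"
  using th by (simp add: theta_def)

text \<open>If c d = t t, minimality of deg t applied to both c and d gives deg c = deg t. Some c -
  \<alpha> t then has smaller degree but still commutes with t, so it vanishes by minimality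
  again.\<close>

lemma ksc_eq: "ksc A t = range (\<lambda>a. sc a * t)"
proof -
  have "\<exists>a. c = sc a * t" if c: "c \<in> ksc A t" for c
  proof (cases "c = 0")
    case True
    then show ?thesis by (intro exI[of _ 0]) simp
  next
    case False
    then obtain d where d: "c \<in> cent A t" "d \<in> cent A t" "c * d = t * t"
      using c by (auto simp: ksc_def)
    have tt: "t * t \<noteq> 0" "deg (t * t) = deg t + deg t" using free_mult_nonzero_deg[OF t0 t0] by auto
    then have "d \<noteq> 0" using d by auto
    then have "deg c + deg d = deg t + deg t"
      using free_mult_nonzero_deg(2)[OF False] d tt by metis
    then have "deg c = deg t"
      using theta_min_deg[OF th tA d(1) False] theta_min_deg[OF th tA d(2) \<open>d \<noteq> 0\<close>] by simp
    moreover have "c * t = t * c" using d(1) by (simp add: cent_def)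
    ultimately obtain a where a: "\<forall>u. deg t \<le> length u \<longrightarrow> lookup (c - sc a * t) u = 0"
      using commuting_same_deg[OF t0] by blast
    have tC: "t \<in> cent A t" using tA by (simp add: cent_def)
    have "c - sc a * t = 0"
    proof (rule ccontr)
      assume n: "c - sc a * t \<noteq> 0"
      then obtain w where "lookup (c - sc a * t) w \<noteq> 0" "length w = deg (c - sc a * t)"
        using deg_attained by blast
      then have "deg (c - sc a * t) < deg t" using a by (metis not_le)
      then show False
        using theta_min_deg[OF th tA cent_diff[OF d(1) cent_sc[OF tC]] n] by simp
    qed
    then show ?thesis by auto
  qed
  then show ?thesis using sc_mult_self_in_ksc[OF tA] by blast
qed

text \<open>Descent on the degree: in p = \<alpha> t + t q the summand \<alpha> t does not exceed
  the degree of p, and t has positive degree, so deg q < deg p. From q = t Q(t) follows p = t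
  (\<alpha> + t Q(t)).\<close>

lemma cent_eq: "cent A t = range (\<lambda>P. t * ev t P)"
proof -
  have "\<exists>P. p = t * ev t P" if "p \<in> cent A t" for p
    using that
  proof (induction "deg p" arbitrary: p rule: less_induct)
    case less
    show ?case
    proof (cases "p = 0")
      case True
      then show ?thesis by (intro exI[of _ 0]) simp
    next
      case False
      have "p \<in> A" using less.prems by (simp add: cent_def)
      then obtain c q where cq: "c \<in> ksc A t" "q \<in> cent A t" "p = c + t * q"
        using th less.prems unfolding theta_def by blast
      then obtain a where a: "c = sc a * t" using ksc_eq by auto
      have "\<exists>Q. q = t * ev t Q"
      proof (cases "q = 0")
        case True
        then show ?thesis by (intro exI[of _ 0]) simp
      next
        case q0: False
        have tq: "t * q = p - sc a * t" using cq a by simp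
        have "deg t \<le> deg p" by (rule theta_min_deg[OF th tA less.prems False])
        then have "deg (p - sc a * t) \<le> deg p"
          unfolding deg_le_iff lookup_minus lookup_sc_mult
          by (metis diff_0_right length_le_deg mult_zero_right order.trans)
        then have "deg t + deg q \<le> deg p" using free_mult_nonzero_deg(2)[OF t0 q0] tq by simp
        then have "deg q < deg p" using free_alg_deg_pos[OF tA t0] by simp
        then show ?thesis using less.hyps cq(2) by blast
      qed
      then obtain Q where "q = t * ev t Q" by blast
      then have "p = t * ev t (pCons a Q)" using cq a by (simp add: distrib_left sc_commute[of t])
      then show ?thesis by blast
    qed
  qed
  moreover have "t * ev t P \<in> cent A t" for P
    using ev_in_free_alg[OF tA] by (simp add: cent_def mult.assoc ev_commute)
  ultimately show ?thesis by blast
qed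

lemma sc_t_inj: "sc a * t = sc b * t \<longleftrightarrow> a = b"
proof
  assume *: "sc a * t = sc b * t"
  obtain w where "lookup t w \<noteq> 0" using deg_attained[OF t0] by blast
  then show "a = b" using arg_cong[OF *, of "\<lambda>p. lookup p w"] by (simp add: lookup_sc_mult)
qed simp

end

text \<open>For \<open>p = t P(t)\<close>, \<open>a = \<alpha> t\<close>, \<open>b = \<beta> t\<close> and \<open>s = t S(t)\<close> the equation says
  \<open>P - \<beta> = (x - \<alpha>) S\<close>, so \<open>ev_rel\<close> expresses \<open>P(\<alpha>) = \<beta>\<close>.\<close>

definition ev_rel :: "'a::ring set \<Rightarrow> 'a \<Rightarrow> 'a \<Rightarrow> 'a \<Rightarrow> 'a \<Rightarrow> bool" where
  "ev_rel A t p a b \<longleftrightarrow> (\<exists>s\<in>A. s \<in> cent A t \<and> t * p + a * s = t * b + t * t * s)"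

lemma (in theta_elem) ev_rel_iff:
  "ev_rel A t (t * ev t P) (sc a * t) (sc b * t) \<longleftrightarrow> poly P a = b"
proof -
  have "t * (t * ev t P) + sc a * t * (t * ev t S) = t * (sc b * t) + t * t * (t * ev t S) \<longleftrightarrow>
      P + smult a S = pCons b S" for S
  proof -
    have "t * (t * ev t P) + sc a * t * (t * ev t S) = t * (t * ev t (P + smult a S))"
      by (simp add: ev_add ev_smult distrib_left sc_left_commute[of t] mult.assoc)
    moreover have "t * (sc b * t) + t * t * (t * ev t S) = t * (t * ev t (pCons b S))"
      by (simp add: distrib_left sc_left_commute[of t] sc_commute[of t] mult.assoc)
    ultimately show ?thesis by (simp only: free_mult_left_cancel[OF t0] ev_inj[OF tA t0])
  qed
  note eq = this
  have "s \<in> A \<and> s \<in> cent A t \<longleftrightarrow> (\<exists>S. s = t * ev t S)" for s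
    unfolding cent_eq using ev_in_free_alg[OF tA] by blast
  then have "ev_rel A t (t * ev t P) (sc a * t) (sc b * t) \<longleftrightarrow>
      (\<exists>S. t * (t * ev t P) + sc a * t * (t * ev t S) = t * (sc b * t) + t * t * (t * ev t S))"
    unfolding ev_rel_def by (metis (no_types))
  then have "ev_rel A t (t * ev t P) (sc a * t) (sc b * t) \<longleftrightarrow> (\<exists>S. P + smult a S = pCons b S)"
    by (simp only: eq)
  also have "\<dots> \<longleftrightarrow> poly P a = b"
  proof
    assume "\<exists>S. P + smult a S = pCons b S"
    then obtain S where "P + smult a S = pCons b S" by blast
    from arg_cong[OF this, of "\<lambda>p. poly p a"] show "poly P a = b" by simp
  next
    assume "poly P a = b"
    then show "\<exists>S. P + smult a S = pCons b S"
      \<comment> \<open>The witness S is the quotient of P by x - a, whose remainder is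
        P(a).\<close>
      using synthetic_div_correct[of P a] by auto
  qed
  finally show ?thesis .
qed

subsection \<open>Left derivatives\<close>

text \<open>Strips a leading x. For a finite alphabet, p is its constant term plus the sum of x *
  \<open>lder x p\<close> over the letters x; this decomposition serves both the count of generators
  and the recursion for products.\<close>

definition lder :: "'x \<Rightarrow> ('x, 'k::field) ncp \<Rightarrow> ('x, 'k) ncp" where
  "lder x p = Abs_poly_mapping (\<lambda>w. lookup p (x # w))"

lemma lookup_lder [simp]: "lookup (lder x p) w = lookup p (x # w)"
proof -
  have "finite ((#) x -` keys p)" by (rule finite_vimageI) auto
  then have "finite {w. lookup p (x # w) \<noteq> 0}"
    by (simp add: vimage_def in_keys_iff)
  then show ?thesis by (simp add: lder_def)
qed

section \<open>The centralizer of a letter\<close>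

lemma lookup_single_Cons_mult:
  fixes p :: "('x, 'k::field) ncp"
  shows "lookup (single [x] 1 * p) w = (case w of [] \<Rightarrow> 0 | y # v \<Rightarrow> if y = x then lookup p v else 0)"
proof (cases w)
  case (Cons y v)
  have "lookup (single [x] 1 * p) w = (\<Sum>k\<le>length w. if k = 1 then (if y = x then lookup p v else 0) else 0)"
    unfolding lookup_mult_list
  proof (intro sum.cong refl)
    fix k
    show "lookup (single [x] 1) (take k w) * lookup p (drop k w) = (if k = 1 then if y = x then lookup p v else 0 else 0)" if "k \<in> {..length w}"
    proof (cases k)
      case (Suc j)
      then show ?thesis using that Cons by (cases j; cases v) (auto simp: lookup_single when_def)
    qed (simp add: lookup_single)
  qed
  also have "\<dots> = (if y = x then lookup p v else 0)"
    using Cons by (subst sum.delta) auto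
  finally show ?thesis using Cons by simp
qed (simp add: lookup_mult_list lookup_single)

lemma lookup_mult_single_snoc:
  fixes p :: "('x, 'k::field) ncp"
  shows "lookup (p * single [x] 1) (u @ [x]) = lookup p u"
proof -
  have "lookup (p * single [x] 1) (u @ [x]) = (\<Sum>k\<le>length (u @ [x]). if k = length u then lookup p u else 0)"
    unfolding lookup_mult_list
  proof (intro sum.cong refl)
    fix k assume k: "k \<in> {..length (u @ [x])}"
    show "lookup p (take k (u @ [x])) * lookup (single [x] 1) (drop k (u @ [x])) = (if k = length u then lookup p u else 0)"
    proof (cases "k = length u")
      case False
      then have "length (drop k (u @ [x])) \<noteq> length [x]" using k by simp
      then have "[x] \<noteq> drop k (u @ [x])" by metis
      then show ?thesis using False by (simp add: lookup_single when_def)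
    qed simp
  qed
  then show ?thesis by simp
qed

lemma commutes_letter:
  fixes p :: "('x, 'k::field) ncp"
  assumes "p \<in> free_alg X" "single [x] 1 * p = p * single [x] 1"
  shows "\<exists>P. p = single [x] 1 * ev (single [x] 1) P"
  using assms
proof (induction "deg p" arbitrary: p rule: less_induct)
  case less
  let ?t = "single [x] 1 :: ('x, 'k) ncp"
  have t0: "?t \<noteq> 0" by (metis lookup_single_eq lookup_zero zero_neq_one)
  show ?case
  proof (cases "p = 0")
    case True
    then show ?thesis by (intro exI[of _ 0]) simp
  next
    case False
    define r where "r = lder x p"
    have "lookup p w = lookup (?t * r) w" for w
    proof (cases w)
      case Nil
      then show ?thesis using less.prems(1) by (auto simp: free_alg_iff lookup_single_Cons_mult)
    next
      case (Cons y v)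
      \<comment> \<open>The word y v x is read in p x = x p: on the left its coefficient is that of
        y v in p, on the right it vanishes unless y = x. So every word of p starts with x.\<close>
      have "lookup p (y # v) = lookup (?t * p) (y # v @ [x])"
        using lookup_mult_single_snoc[of p x "y # v"] less.prems(2) by simp
      then have "lookup p (y # v) = 0" if "y \<noteq> x" using that by (simp add: lookup_single_Cons_mult)
      then show ?thesis using Cons by (simp add: lookup_single_Cons_mult r_def)
    qed
    then have p: "p = ?t * r" by (intro poly_mapping_eqI) blast
    have "?t * (?t * r) = ?t * (r * ?t)" using less.prems(2) p by (simp add: mult.assoc)
    then have tr: "?t * r = r * ?t" by (simp only: free_mult_left_cancel[OF t0])
    define c where "c = lookup r []"
    \<comment> \<open>The cofactor r commutes with x but may have a constant term; removing it gives
      an element of the algebra to which the induction applies.\<close>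
    define q where "q = r - sc c"
    have q: "?t * q = q * ?t" using tr by (simp add: q_def left_diff_distrib right_diff_distrib sc_commute[of ?t])
    have lq: "lookup q w = (if w = [] then 0 else lookup p (x # w))" for w
      by (simp add: q_def lookup_minus lookup_single c_def r_def when_def)
    then have qA: "q \<in> free_alg X" using less.prems(1) by (auto simp: free_alg_iff)
    have "length w < deg p" if "lookup q w \<noteq> 0" for w
      using that length_le_deg[of p "x # w"] by (auto simp: lq split: if_splits)
    moreover have "deg p > 0" using free_alg_deg_pos less.prems(1) False by blast
    ultimately have "deg q \<le> deg p - 1" by (fastforce simp: deg_le_iff)
    then have "deg q < deg p" using \<open>deg p > 0\<close> by simp
    then obtain Q where "q = ?t * ev ?t Q" using less.hyps q qA by blast
    then have "p = ?t * ev ?t (pCons c Q)" using p by (simp add: q_def algebra_simps)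
    then show ?thesis by blast
  qed
qed

text \<open>With centralizer x K[x] the two clauses of \<open>theta\<close> are the identities x
  P(x) x R(x) = x (x P(x) R(x)) and x (c + x Q(x)) = c x + x (x Q(x)). This makes
  \<open>theta\<close> satisfiable whenever there is a letter.\<close>

lemma theta_letter:
  fixes X :: "'x set"
  assumes "x \<in> X"
  shows "theta (free_alg X) (single [x] (1 :: 'k::field))" and "single [x] (1 :: 'k) \<in> free_alg X"
proof -
  let ?t = "single [x] 1 :: ('x, 'k) ncp" and ?A = "free_alg X :: ('x, 'k) ncp set"
  have t0: "?t \<noteq> 0" by (metis lookup_single_eq lookup_zero zero_neq_one)
  show tA: "?t \<in> ?A" using assms by (auto simp: free_alg_iff lookup_single when_def split: if_splits)
  have ev: "?t * ev ?t P \<in> ?A \<and> ?t * ev ?t P \<in> cent ?A ?t" for P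
    using ev_in_free_alg[OF tA] by (simp add: cent_def mult.assoc ev_commute)
  have ex: "\<exists>P. p = ?t * ev ?t P" if "p \<in> cent ?A ?t" for p
    using commutes_letter that by (auto simp: cent_def)
  have "\<exists>s\<in>?A. s \<in> cent ?A ?t \<and> ?t * s = p * r" if p: "p \<in> cent ?A ?t" "r \<in> cent ?A ?t" for p r
  proof -
    obtain P R where PR: "p = ?t * ev ?t P" "r = ?t * ev ?t R" using ex p by metis
    have "p * r = ?t * (ev ?t P * ?t) * ev ?t R" using PR by (simp add: mult.assoc)
    also have "\<dots> = ?t * (?t * ev ?t (P * R))" by (simp add: ev_commute ev_mult mult.assoc)
    finally show ?thesis using ev[of "P * R"] by (intro bexI[of _ "?t * ev ?t (P * R)"]) simp_all
  qed
  moreover have "\<exists>c\<in>?A. \<exists>q\<in>?A. c \<in> ksc ?A ?t \<and> q \<in> cent ?A ?t \<and> p = c + ?t * q" if p: "p \<in> cent ?A ?t" for p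
  proof -
    obtain P where P: "p = ?t * ev ?t P" using ex p by metis
    obtain c Q where "P = pCons c Q" by (cases P)
    then have "p = sc c * ?t + ?t * (?t * ev ?t Q)" using P by (simp add: distrib_left sc_commute[of ?t])
    then show ?thesis using ev[of Q] sc_mult_self_in_ksc[OF tA] free_alg_sc[OF tA] by blast
  qed
  ultimately show "theta ?A ?t" using t0 by (simp add: theta_def)
qed

section \<open>Hereditarily finite sets as finite relations\<close>

text \<open>Newton interpolation, one pair at a time. An infinite field has an index c that is not a
  root of Q; adding multiples of Q to F and G changes nothing at the old indices and reaches any
  values at c.\<close>

lemma finite_relation_by_polys:
  fixes R :: "('k::field \<times> 'k) set"
  assumes "infinite (UNIV :: 'k set)" "finite R"
  shows "\<exists>Q F G. Q \<noteq> 0 \<and> {(poly F i, poly G i) | i. poly Q i = 0} = R"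
  using assms(2)
proof (induction R rule: finite_induct)
  case empty
  show ?case by (intro exI[of _ 1]) simp
next
  case (insert r R)
  then obtain Q F G where QFG: "Q \<noteq> 0" "{(poly F i, poly G i) | i. poly Q i = 0} = R" by blast
  obtain a b where r: "r = (a, b)" by (cases r)
  have "finite {i. poly Q i = 0}" using QFG(1) by (rule poly_roots_finite)
  then obtain c where c: "poly Q c \<noteq> 0" using ex_new_if_finite[OF assms(1)] by blast
  define Q' where "Q' = Q * [:- c, 1:]"
  define F' where "F' = F + smult ((a - poly F c) / poly Q c) Q"
  define G' where "G' = G + smult ((b - poly G c) / poly Q c) Q"
  have Q': "poly Q' i = 0 \<longleftrightarrow> poly Q i = 0 \<or> i = c" for i by (simp add: Q'_def)
  have old: "poly F' i = poly F i" "poly G' i = poly G i" if "poly Q i = 0" for i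
    using that by (simp_all add: F'_def G'_def)
  have new: "poly F' c = a" "poly G' c = b" using c by (simp_all add: F'_def G'_def)
  have "{(poly F' i, poly G' i) | i. poly Q' i = 0} = insert (a, b) {(poly F' i, poly G' i) | i. poly Q i = 0}"
    unfolding Q' using new by blast
  also have "{(poly F' i, poly G' i) | i. poly Q i = 0} = {(poly F i, poly G i) | i. poly Q i = 0}"
    using old by (metis (no_types, lifting))
  finally have "{(poly F' i, poly G' i) | i. poly Q' i = 0} = insert r R" using QFG(2) r by simp
  moreover have "Q' \<noteq> 0" unfolding Q'_def using QFG(1) by (simp del: mult_pCons_right)
  ultimately show ?case by blast
qed

text \<open>A node on the diagonal of \<open>R\<close> stands for itself as an atom; any other node stands for the
  set of what its \<open>R\<close>-predecessors stand for.\<close>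

inductive den :: "('k \<times> 'k) set \<Rightarrow> 'k \<Rightarrow> 'k hf \<Rightarrow> bool" for R where
  atom: "(x, x) \<in> R \<Longrightarrow> den R x (Atom x)"
| set: "\<lbrakk>(x, x) \<notin> R; \<forall>y. (y, x) \<in> R \<longrightarrow> (\<exists>u. u \<in> fset S \<and> den R y u);
        \<forall>u. u \<in> fset S \<longrightarrow> (\<exists>y. (y, x) \<in> R \<and> den R y u)\<rbrakk> \<Longrightarrow> den R x (HSet S)"

inductive_cases den_HSetE: "den R x (HSet S)"
inductive_cases den_AtomE: "den R x (Atom a)"

lemma den_Atom_iff: "den R x (Atom a) \<longleftrightarrow> x = a \<and> (a, a) \<in> R"
  by (auto intro: den.atom elim: den_AtomE)

lemma den_diag: "den R x u \<Longrightarrow> (x, x) \<in> R \<Longrightarrow> u = Atom x"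
  by (cases u) (auto elim: den_HSetE den_AtomE)

lemma den_off_diag:
  assumes "den R x u" "(x, x) \<notin> R"
  shows "\<exists>S. u = HSet S \<and> (\<forall>y. (y, x) \<in> R \<longrightarrow> (\<exists>u. u \<in> fset S \<and> den R y u)) \<and>
    (\<forall>u. u \<in> fset S \<longrightarrow> (\<exists>y. (y, x) \<in> R \<and> den R y u))"
  using assms by (cases rule: den.cases) blast+

section \<open>Equality, membership and well-foundedness by finite witnesses\<close>

definition bisim :: "('k \<times> 'k) set \<Rightarrow> ('k \<times> 'k) set \<Rightarrow> ('k \<times> 'k) set \<Rightarrow> bool" where
  "bisim R R' B \<longleftrightarrow> (\<forall>a b. (a, b) \<in> B \<longrightarrow>
     a = b \<and> (a, a) \<in> R \<and> (b, b) \<in> R' \<or>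
     (a, a) \<notin> R \<and> (b, b) \<notin> R' \<and>
     (\<forall>a'. (a', a) \<in> R \<longrightarrow> (\<exists>b'. (b', b) \<in> R' \<and> (a', b') \<in> B)) \<and>
     (\<forall>b'. (b', b) \<in> R' \<longrightarrow> (\<exists>a'. (a', a) \<in> R \<and> (a', b') \<in> B)))"

text \<open>The derivation of \<open>den R x u\<close> supplies the well-founded induction. Related
  atoms coincide as elements of the field; for sets, each half of the back-and-forth condition gives
  one inclusion.\<close>

lemma bisim_imp_eq:
  assumes B: "bisim R R' B"
  shows "den R x u \<Longrightarrow> (x, y) \<in> B \<Longrightarrow> den R' y v \<Longrightarrow> u = v"
proof (induction arbitrary: y v rule: den.induct)
  case (atom x)
  then have "x = y \<and> (y, y) \<in> R'" using B unfolding bisim_def by blast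
  then show ?case using atom den_diag by metis
next
  case (set x S)
  have off: "(y, y) \<notin> R'"
    and zig: "\<And>a'. (a', x) \<in> R \<Longrightarrow> \<exists>b'. (b', y) \<in> R' \<and> (a', b') \<in> B"
    and zag: "\<And>b'. (b', y) \<in> R' \<Longrightarrow> \<exists>a'. (a', x) \<in> R \<and> (a', b') \<in> B"
    using B set.hyps(1) set.prems(1) unfolding bisim_def by blast+
  obtain S' where S': "v = HSet S'" "\<And>y'. (y', y) \<in> R' \<Longrightarrow> \<exists>u. u \<in> fset S' \<and> den R' y' u"
    "\<And>u. u \<in> fset S' \<Longrightarrow> \<exists>y'. (y', y) \<in> R' \<and> den R' y' u"
    using den_off_diag[OF set.prems(2) off] by blast
  have "z \<in> fset S'" if z: "z \<in> fset S" for z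
  proof -
    obtain a where a: "(a, x) \<in> R" "\<And>y v. (a, y) \<in> B \<Longrightarrow> den R' y v \<Longrightarrow> z = v"
      using set.IH(2) z by blast
    obtain b where "(b, y) \<in> R'" "(a, b) \<in> B" using zig[OF a(1)] by blast
    then show ?thesis using S'(2) a(2) by blast
  qed
  moreover have "z \<in> fset S" if z: "z \<in> fset S'" for z
  proof -
    obtain b where b: "(b, y) \<in> R'" "den R' b z" using S'(3) z by blast
    obtain a where a: "(a, x) \<in> R" "(a, b) \<in> B" using zag[OF b(1)] by blast
    then show ?thesis using set.IH(1) b(2) by blast
  qed
  ultimately show ?case using S'(1) by (auto intro: fset_eqI)
qed

text \<open>The witness relates all nodes with a common denotation, cut down to the fields of the
  relations for finiteness. The nodes x and y are inserted because a node for the empty set may lie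
  on no edge.\<close>

lemma eq_imp_bisim:
  assumes "finite R" "finite R'" "den R x u" "den R' y u"
  shows "\<exists>B. finite B \<and> bisim R R' B \<and> (x, y) \<in> B"
proof -
  define B where "B = {(a, b) \<in> insert x (Field R) \<times> insert y (Field R'). \<exists>w. den R a w \<and> den R' b w}"
  have "finite B" unfolding B_def
    by (rule finite_subset[of _ "insert x (Field R) \<times> insert y (Field R')"])
       (auto simp: finite_Field assms(1,2))
  moreover have "bisim R R' B" unfolding bisim_def
  proof (intro allI impI)
    fix a b assume "(a, b) \<in> B"
    then obtain w where w: "den R a w" "den R' b w" by (auto simp: B_def)
    have mem: "(a', b') \<in> B" if "(a', a) \<in> R" "(b', b) \<in> R'" "den R a' z" "den R' b' z" for a' b' z
      using that unfolding B_def Field_def by blast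
    show "a = b \<and> (a, a) \<in> R \<and> (b, b) \<in> R' \<or> (a, a) \<notin> R \<and> (b, b) \<notin> R' \<and>
     (\<forall>a'. (a', a) \<in> R \<longrightarrow> (\<exists>b'. (b', b) \<in> R' \<and> (a', b') \<in> B)) \<and>
     (\<forall>b'. (b', b) \<in> R' \<longrightarrow> (\<exists>a'. (a', a) \<in> R \<and> (a', b') \<in> B))"
    proof (cases w)
      case (Atom c)
      then show ?thesis using w by (simp add: den_Atom_iff)
    next
      case (HSet S)
      have off: "(a, a) \<notin> R" "(b, b) \<notin> R'" using den_diag[OF w(1)] den_diag[OF w(2)] HSet by auto
      obtain S1 where S1: "w = HSet S1" "\<And>y. (y, a) \<in> R \<Longrightarrow> \<exists>u. u \<in> fset S1 \<and> den R y u"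
          "\<And>u. u \<in> fset S1 \<Longrightarrow> \<exists>y. (y, a) \<in> R \<and> den R y u"
        using den_off_diag[OF w(1) off(1)] by blast
      obtain S2 where S2: "w = HSet S2" "\<And>y. (y, b) \<in> R' \<Longrightarrow> \<exists>u. u \<in> fset S2 \<and> den R' y u"
          "\<And>u. u \<in> fset S2 \<Longrightarrow> \<exists>y. (y, b) \<in> R' \<and> den R' y u"
        using den_off_diag[OF w(2) off(2)] by blast
      have "S1 = S2" using S1(1) S2(1) by simp
      then have "\<exists>b'. (b', b) \<in> R' \<and> (a', b') \<in> B" if "(a', a) \<in> R" for a'
        using S1(2)[OF that] S2(3) mem[OF that] by blast
      moreover have "\<exists>a'. (a', a) \<in> R \<and> (a', b') \<in> B" if "(b', b) \<in> R'" for b'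
        using S2(2)[OF that] S1(3) mem[OF _ that] \<open>S1 = S2\<close> by blast
      ultimately show ?thesis using off by blast
    qed
  qed
  moreover have "(x, y) \<in> B" using assms(3,4) by (auto simp: B_def)
  ultimately show ?thesis by blast
qed

lemma den_eq_iff:
  assumes "finite R" "finite R'" "den R x u" "den R' y v"
  shows "u = v \<longleftrightarrow> (\<exists>B. finite B \<and> bisim R R' B \<and> (x, y) \<in> B)"
  using eq_imp_bisim[OF assms(1,2)] bisim_imp_eq assms(3,4) by metis

lemma den_unique: "den R x u \<Longrightarrow> den R x v \<Longrightarrow> u = v"
  by (rule bisim_imp_eq[of R R Id]) (auto simp: bisim_def)

text \<open>The members of v are what the predecessors of y denote. A loop at y must be excluded
  first: it is its own predecessor, yet denotes an atom, which has no members.\<close>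

lemma den_mem_iff:
  assumes "finite R" "finite R'" "den R x u" "den R' y v"
  shows "hf_mem u v \<longleftrightarrow> (y, y) \<notin> R' \<and> (\<exists>z. (z, y) \<in> R' \<and> (\<exists>B. finite B \<and> bisim R R' B \<and> (x, z) \<in> B))"
proof (cases "(y, y) \<in> R'")
  case True
  then show ?thesis using den_diag[OF assms(4)] by simp
next
  case False
  obtain S where S: "v = HSet S" "\<And>y'. (y', y) \<in> R' \<Longrightarrow> \<exists>u. u \<in> fset S \<and> den R' y' u"
    "\<And>u. u \<in> fset S \<Longrightarrow> \<exists>y'. (y', y) \<in> R' \<and> den R' y' u"
    using den_off_diag[OF assms(4) False] by blast
  have "u \<in> fset S \<longleftrightarrow> (\<exists>z. (z, y) \<in> R' \<and> den R' z u)"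
    using S(2,3) den_unique by metis
  also have "\<dots> \<longleftrightarrow> (\<exists>z. (z, y) \<in> R' \<and> (\<exists>B. finite B \<and> bisim R R' B \<and> (x, z) \<in> B))"
    using den_eq_iff[OF assms(1-3)] S(2) by metis
  finally show ?thesis using S(1) False by simp
qed

text \<open>A node that denotes nothing would yield the set S of all such nodes, and a minimal
  element of S could be given a denotation from those of its predecessors. Minimality over finite
  sets replaces descending chains, because finite sets are what codes can quantify over.\<close>

lemma den_ex_iff:
  assumes "finite R"
  shows "(\<exists>u. den R x u) \<longleftrightarrow> (\<forall>S. finite S \<and> x \<in> S \<longrightarrow> (\<exists>m\<in>S. (m, m) \<in> R \<or> \<not> (\<exists>y\<in>S. (y, m) \<in> R)))"
proof
  assume "\<exists>u. den R x u"
  then obtain u where "den R x u" by blast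
  then show "\<forall>S. finite S \<and> x \<in> S \<longrightarrow> (\<exists>m\<in>S. (m, m) \<in> R \<or> \<not> (\<exists>y\<in>S. (y, m) \<in> R))"
  proof (induction rule: den.induct)
    case (set x S)
    then show ?case by (metis (no_types, lifting))
  qed blast
next
  assume *: "\<forall>S. finite S \<and> x \<in> S \<longrightarrow> (\<exists>m\<in>S. (m, m) \<in> R \<or> \<not> (\<exists>y\<in>S. (y, m) \<in> R))"
  show "\<exists>u. den R x u"
  proof (rule ccontr)
    assume n: "\<nexists>u. den R x u"
    define S where "S = {y \<in> insert x (Field R). \<nexists>u. den R y u}"
    have "finite S" "x \<in> S" using assms n by (auto simp: S_def finite_Field)
    then obtain m where m: "m \<in> S" "(m, m) \<in> R \<or> \<not> (\<exists>y\<in>S. (y, m) \<in> R)" using * by blast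
    have nm: "(m, m) \<notin> R" using m(1) den.atom[of m R] by (auto simp: S_def)
    have "\<exists>u. den R y u" if "(y, m) \<in> R" for y
    proof -
      have "y \<in> Field R" using that by (auto simp: Field_def)
      then show ?thesis using m(2) nm that by (auto simp: S_def)
    qed
    then obtain d where d: "\<And>y. (y, m) \<in> R \<Longrightarrow> den R y (d y)" by metis
    have fin: "finite {y. (y, m) \<in> R}"
      using finite_Field[OF assms] by (rule rev_finite_subset) (auto simp: Field_def)
    have "den R m (HSet (Abs_fset (d ` {y. (y, m) \<in> R})))"
      using d nm fin by (intro den.set) (auto simp: Abs_fset_inverse)
    then show False using m(1) by (auto simp: S_def)
  qed
qed

section \<open>Every hereditarily finite set is denoted by a finite relation\<close>

lemma finite_transitive_superset: "\<exists>T. finite T \<and> u \<in> T \<and> (\<forall>S. HSet S \<in> T \<longrightarrow> fset S \<subseteq> T)"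
proof (induction u)
  case (Atom a)
  show ?case by (intro exI[of _ "{Atom a}"]) simp
next
  case (HSet S)
  then obtain T where T: "\<And>v. v \<in> fset S \<Longrightarrow> finite (T v) \<and> v \<in> T v \<and> (\<forall>S'. HSet S' \<in> T v \<longrightarrow> fset S' \<subseteq> T v)"
    by metis
  show ?case
    by (rule exI[of _ "insert (HSet S) (\<Union>v\<in>fset S. T v)"]) (use T in fastforce)
qed

lemma hf_mem_irrefl: "\<not> hf_mem x x"
  by (induction x) (simp, metis hf_mem.simps(2))

text \<open>R copies membership on a finite transitive set containing u, with loops at the atoms. An
  atom must be its own node, so the sets receive distinct nodes among the field elements that do not
  occur as atoms; infinity of the field provides enough of them.\<close>

lemma den_surj:
  fixes u :: "'k hf"
  assumes "infinite (UNIV :: 'k set)"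
  shows "\<exists>R x. finite R \<and> den R x u"
proof -
  obtain T where T: "finite T" "u \<in> T" "\<And>S. HSet S \<in> T \<Longrightarrow> fset S \<subseteq> T"
    using finite_transitive_superset[of u] by blast
  define At where "At = {a. Atom a \<in> T}"
  define Se where "Se = {v \<in> T. \<not> is_atom v}"
  have "finite (Atom -` T)" using T(1) by (rule finite_vimageI) (auto simp: inj_def)
  then have fAt: "finite At" by (simp add: At_def vimage_def)
  have "finite Se" using T(1) by (simp add: Se_def)
  moreover have "infinite (- At)" using fAt assms by (simp add: Compl_eq_Diff_UNIV Diff_infinite_finite)
  ultimately obtain C where C: "C \<subseteq> - At" "finite C" "card C = card Se"
    using infinite_arbitrarily_large by metis
  obtain g where "bij_betw g Se C"
    using finite_same_card_bij[OF \<open>finite Se\<close> C(2) C(3)[symmetric]] by blast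
  then have g: "inj_on g Se" "g ` Se \<subseteq> - At" using C(1) by (auto simp: bij_betw_def)
  define f where "f v = (case v of Atom a \<Rightarrow> a | HSet S \<Rightarrow> g v)" for v
  have f_inj: "v = w" if vw: "v \<in> T" "w \<in> T" "f v = f w" for v w
  proof (cases v)
    case (Atom a)
    show ?thesis
    proof (cases w)
      case (HSet S)
      then have "w \<in> Se" using vw by (simp add: Se_def is_atom_def)
      then have "g w \<notin> At" using g(2) by blast
      then show ?thesis using vw Atom HSet by (simp add: f_def At_def)
    qed (use vw Atom in \<open>simp add: f_def\<close>)
  next
    case v: (HSet S)
    then have vS: "v \<in> Se" using vw by (simp add: Se_def is_atom_def)
    show ?thesis
    proof (cases w)
      case (Atom a)
      have "g v \<notin> At" using g(2) vS by blast
      then show ?thesis using vw v Atom by (simp add: f_def At_def)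
    next
      case (HSet S')
      then have "w \<in> Se" using vw by (simp add: Se_def is_atom_def)
      then show ?thesis using vw v g(1) vS HSet inj_onD[OF g(1), of v w] by (simp add: f_def)
    qed
  qed
  define R where "R = {(f v, f w) | v w. v \<in> T \<and> w \<in> T \<and> (hf_mem v w \<or> v = w \<and> is_atom v)}"
  have "finite R"
    by (rule finite_subset[of _ "(f ` T) \<times> (f ` T)"]) (use T(1) in \<open>auto simp: R_def\<close>)
  moreover have R_iff: "(f v, f w) \<in> R \<longleftrightarrow> hf_mem v w \<or> v = w \<and> is_atom v" if "v \<in> T" "w \<in> T" for v w
    unfolding R_def using f_inj that by blast
  have "v \<in> T \<longrightarrow> den R (f v) v" for v
  proof (induction v)
    case (Atom a)
    show ?case using R_iff[of "Atom a" "Atom a"] by (auto simp: is_atom_def den_Atom_iff f_def)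
  next
    case (HSet S)
    show ?case
    proof
      assume v: "HSet S \<in> T"
      have sub: "w \<in> T" if "w \<in> fset S" for w using T(3)[OF v] that by blast
      have mem: "(f w, f (HSet S)) \<in> R \<longleftrightarrow> w \<in> fset S" if "w \<in> T" for w
        using R_iff[OF that v] by (auto simp: is_atom_def)
      have fR: "\<exists>w. y = f w \<and> w \<in> T" if "(y, f (HSet S)) \<in> R" for y
        using that unfolding R_def by blast
      show "den R (f (HSet S)) (HSet S)"
      proof (rule den.set)
        show "(f (HSet S), f (HSet S)) \<notin> R"
          using mem[OF v] hf_mem_irrefl[of "HSet S"] by simp
        show "\<forall>y. (y, f (HSet S)) \<in> R \<longrightarrow> (\<exists>u. u \<in> fset S \<and> den R y u)"
          using fR mem HSet.IH by blast
        show "\<forall>u. u \<in> fset S \<longrightarrow> (\<exists>y. (y, f (HSet S)) \<in> R \<and> den R y u)"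
          using mem HSet.IH sub by blast
      qed
    qed
  qed
  ultimately show ?thesis using T(2) by blast
qed

section \<open>Interpreting hereditarily finite sets in the free algebra\<close>

text \<open>\<open>(q, f, g)\<close> codes the relation \<open>{(f i, g i) | q i = 0}\<close>, and the empty relation if \<open>q = 0\<close>.\<close>

definition rl :: "'a::ring set \<Rightarrow> 'a \<Rightarrow> 'a \<Rightarrow> 'a \<Rightarrow> 'a \<Rightarrow> 'a \<Rightarrow> 'a \<Rightarrow> bool" where
  "rl A t q f g a b \<longleftrightarrow> q \<noteq> 0 \<and> (\<exists>z\<in>A. \<exists>i\<in>A. z = 0 \<and> i \<in> ksc A t \<and>
     ev_rel A t q i z \<and> ev_rel A t f i a \<and> ev_rel A t g i b)"

definition rlcode :: "'a::ring set \<Rightarrow> 'a \<Rightarrow> 'a \<Rightarrow> 'a \<Rightarrow> 'a \<Rightarrow> bool" where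
  "rlcode A t q f g \<longleftrightarrow> q \<in> cent A t \<and> f \<in> cent A t \<and> g \<in> cent A t"

definition bisimc where
  "bisimc A t q f g q' f' g' Q F G \<longleftrightarrow> (\<forall>a\<in>A. a \<in> ksc A t \<longrightarrow> (\<forall>b\<in>A. b \<in> ksc A t \<longrightarrow> rl A t Q F G a b \<longrightarrow>
     a = b \<and> rl A t q f g a a \<and> rl A t q' f' g' b b \<or>
     \<not> rl A t q f g a a \<and> \<not> rl A t q' f' g' b b \<and>
     (\<forall>a'\<in>A. a' \<in> ksc A t \<longrightarrow> rl A t q f g a' a \<longrightarrow> (\<exists>b'\<in>A. b' \<in> ksc A t \<and> rl A t q' f' g' b' b \<and> rl A t Q F G a' b')) \<and>
     (\<forall>b'\<in>A. b' \<in> ksc A t \<longrightarrow> rl A t q' f' g' b' b \<longrightarrow> (\<exists>a'\<in>A. a' \<in> ksc A t \<and> rl A t q f g a' a \<and> rl A t Q F G a' b'))))"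

definition eqc where
  "eqc A t q f g x q' f' g' x' \<longleftrightarrow> (\<exists>Q\<in>A. \<exists>F\<in>A. \<exists>G\<in>A. rlcode A t Q F G \<and>
     bisimc A t q f g q' f' g' Q F G \<and> rl A t Q F G x x')"

definition memc where
  "memc A t q f g x q' f' g' x' \<longleftrightarrow> \<not> rl A t q' f' g' x' x' \<and>
     (\<exists>y\<in>A. y \<in> ksc A t \<and> rl A t q' f' g' y x' \<and> eqc A t q f g x q' f' g' y)"

text \<open>A node denotes a set iff no finite set containing it witnesses that the relation below it is
  not well-founded; finite sets are coded as diagonals of relations.\<close>

definition validc where
  "validc A t q f g x \<longleftrightarrow> rlcode A t q f g \<and> x \<in> ksc A t \<and>
     (\<forall>Q\<in>A. \<forall>F\<in>A. \<forall>G\<in>A. rlcode A t Q F G \<longrightarrow> rl A t Q F G x x \<longrightarrow>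
       (\<exists>m\<in>A. m \<in> ksc A t \<and> rl A t Q F G m m \<and>
         (rl A t q f g m m \<or> \<not> (\<exists>y\<in>A. y \<in> ksc A t \<and> rl A t Q F G y y \<and> rl A t q f g y m))))"

subsection \<open>Definability\<close>

lemmas rng_intros = rng.D_intros rng_definable_mem rng_definable_eq rng_term_definable_intros

lemma D_cent: "rng_definable A B (\<lambda>e. e j \<in> cent A (e i)) (\<lambda>e. e j \<in> cent B (e i))"
  unfolding cent_def mem_Collect_eq by (intro rng_intros)

lemma D_ksc: "rng_definable A B (\<lambda>e. e j \<in> ksc A (e i)) (\<lambda>e. e j \<in> ksc B (e i))"
  unfolding ksc_def mem_Collect_eq by (intro rng_intros D_cent)

lemma D_theta: "rng_definable A B (\<lambda>e. theta A (e i)) (\<lambda>e. theta B (e i))"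
  unfolding theta_def by (intro rng_intros D_cent D_ksc)

text \<open>Definability lemmas have bare variables as arguments so that they resolve at any shifted
  index. Other arguments get a name by a quantifier first, like z for 0 in \<open>rl\<close> and r
  for t * p in \<open>gens\<close>.\<close>

lemma D_ev_rel: "rng_definable A B (\<lambda>e. ev_rel A (e t) (e p) (e a) (e b)) (\<lambda>e. ev_rel B (e t) (e p) (e a) (e b))"
  unfolding ev_rel_def by (intro rng_intros D_cent D_ksc)

lemma D_rl: "rng_definable A B (\<lambda>e. rl A (e t) (e q) (e f) (e g) (e a) (e b)) (\<lambda>e. rl B (e t) (e q) (e f) (e g) (e a) (e b))"
  unfolding rl_def by (intro rng_intros D_cent D_ksc D_ev_rel)

lemma D_rlcode: "rng_definable A B (\<lambda>e. rlcode A (e t) (e q) (e f) (e g)) (\<lambda>e. rlcode B (e t) (e q) (e f) (e g))"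
  unfolding rlcode_def by (intro rng_intros D_cent)

lemma D_bisimc: "rng_definable A B
    (\<lambda>e. bisimc A (e t) (e q) (e f) (e g) (e q') (e f') (e g') (e q'') (e f'') (e g''))
    (\<lambda>e. bisimc B (e t) (e q) (e f) (e g) (e q') (e f') (e g') (e q'') (e f'') (e g''))"
  unfolding bisimc_def by (intro rng_intros D_ksc D_rl)

lemma D_eqc: "rng_definable A B
    (\<lambda>e. eqc A (e t) (e q) (e f) (e g) (e x) (e q') (e f') (e g') (e x'))
    (\<lambda>e. eqc B (e t) (e q) (e f) (e g) (e x) (e q') (e f') (e g') (e x'))"
  unfolding eqc_def by (intro rng_intros D_rl D_rlcode D_bisimc)

lemma D_memc: "rng_definable A B
    (\<lambda>e. memc A (e t) (e q) (e f) (e g) (e x) (e q') (e f') (e g') (e x'))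
    (\<lambda>e. memc B (e t) (e q) (e f) (e g) (e x) (e q') (e f') (e g') (e x'))"
  unfolding memc_def by (intro rng_intros D_rl D_ksc D_eqc)

lemma D_validc: "rng_definable A B
    (\<lambda>e. validc A (e t) (e q) (e f) (e g) (e x)) (\<lambda>e. validc B (e t) (e q) (e f) (e g) (e x))"
  unfolding validc_def by (intro rng_intros D_rl D_ksc D_rlcode)

subsection \<open>Meaning of the codes\<close>

context theta_elem
begin

definition relof :: "('x, 'k) ncp \<Rightarrow> ('x, 'k) ncp \<Rightarrow> ('x, 'k) ncp \<Rightarrow> ('k \<times> 'k) set" where
  "relof q f g = {(a, b). rl A t q f g (sc a * t) (sc b * t)}"

definition code where
  "code q f g x u \<longleftrightarrow> rlcode A t q f g \<and> (\<exists>\<xi>. x = sc \<xi> * t \<and> den (relof q f g) \<xi> u)"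

lemma rl_relof: "rl A t q f g (sc a * t) (sc b * t) \<longleftrightarrow> (a, b) \<in> relof q f g"
  by (simp add: relof_def)

lemma sc_t_in: "sc a * t \<in> A"
  using tA by (rule free_alg_sc)

lemma ksc_all: "(\<forall>a\<in>A. a \<in> ksc A t \<longrightarrow> \<Phi> a) \<longleftrightarrow> (\<forall>\<alpha>. \<Phi> (sc \<alpha> * t))"
  unfolding ksc_eq using sc_t_in by blast

lemma ksc_ex: "(\<exists>a\<in>A. a \<in> ksc A t \<and> \<Phi> a) \<longleftrightarrow> (\<exists>\<alpha>. \<Phi> (sc \<alpha> * t))"
  unfolding ksc_eq using sc_t_in by blast

lemma relof_ev: "relof (t * ev t Q) (t * ev t F) (t * ev t G) =
  (if Q = 0 then {} else {(poly F i, poly G i) | i. poly Q i = 0})"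
proof -
  have "t * ev t Q \<noteq> 0 \<longleftrightarrow> Q \<noteq> 0"
    using free_mult_left_cancel[OF t0, of "ev t Q" "ev t 0"] ev_inj[OF tA t0, of Q 0] by simp
  moreover have "(\<exists>z\<in>A. \<exists>i\<in>A. z = 0 \<and> i \<in> ksc A t \<and> ev_rel A t (t * ev t Q) i z \<and> ev_rel A t (t * ev t F) i (sc a * t)
      \<and> ev_rel A t (t * ev t G) i (sc b * t)) \<longleftrightarrow> (\<exists>\<iota>. poly Q \<iota> = 0 \<and> poly F \<iota> = a \<and> poly G \<iota> = b)" for a b
  proof -
    have "(\<exists>z\<in>A. \<exists>i\<in>A. z = 0 \<and> i \<in> ksc A t \<and> ev_rel A t (t * ev t Q) i z \<and> ev_rel A t (t * ev t F) i (sc a * t)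
      \<and> ev_rel A t (t * ev t G) i (sc b * t)) \<longleftrightarrow> (\<exists>i\<in>A. i \<in> ksc A t \<and> (ev_rel A t (t * ev t Q) i (sc 0 * t) \<and>
       ev_rel A t (t * ev t F) i (sc a * t) \<and> ev_rel A t (t * ev t G) i (sc b * t)))"
      using free_alg_zero[of X] by auto
    then show ?thesis unfolding ksc_ex ev_rel_iff .
  qed
  ultimately show ?thesis unfolding relof_def rl_def by auto
qed

lemma rlcode_ev: "rlcode A t q f g \<longleftrightarrow> (\<exists>Q F G. q = t * ev t Q \<and> f = t * ev t F \<and> g = t * ev t G)"
  unfolding rlcode_def cent_eq by blast

text \<open>This is the purpose of the condition \<open>q \<noteq> 0\<close> in \<open>rl\<close>:
  the zero polynomial has every scalar as a root and could produce infinitely many pairs.\<close>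

lemma finite_relof:
  assumes "rlcode A t q f g"
  shows "finite (relof q f g)"
proof -
  obtain Q F G where e: "q = t * ev t Q" "f = t * ev t F" "g = t * ev t G" using assms rlcode_ev by blast
  have "finite {(poly F i, poly G i) | i. poly Q i = 0}" if "Q \<noteq> 0"
  proof -
    have "{(poly F i, poly G i) | i. poly Q i = 0} = (\<lambda>i. (poly F i, poly G i)) ` {i. poly Q i = 0}" by blast
    then show ?thesis using poly_roots_finite[OF that] by simp
  qed
  then show ?thesis unfolding e relof_ev by simp
qed

lemma relof_surj:
  assumes "infinite (UNIV :: 'k set)" "finite R"
  shows "\<exists>q\<in>A. \<exists>f\<in>A. \<exists>g\<in>A. rlcode A t q f g \<and> relof q f g = R"
proof -
  obtain Q F G where QFG: "Q \<noteq> 0" "{(poly F i, poly G i) | i. poly Q i = 0} = R"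
    using finite_relation_by_polys[OF assms] by blast
  have "rlcode A t (t * ev t Q) (t * ev t F) (t * ev t G)" using rlcode_ev by blast
  moreover have "relof (t * ev t Q) (t * ev t F) (t * ev t G) = R" using QFG by (simp add: relof_ev)
  ultimately show ?thesis using ev_in_free_alg[OF tA] by blast
qed

text \<open>Here first-order quantifiers over the algebra acquire the strength of weak second-order
  quantifiers over the field.\<close>

lemma rlcode_ex:
  assumes "infinite (UNIV :: 'k set)"
  shows "(\<exists>Q\<in>A. \<exists>F\<in>A. \<exists>G\<in>A. rlcode A t Q F G \<and> \<Phi> (relof Q F G)) \<longleftrightarrow> (\<exists>R. finite R \<and> \<Phi> R)"
proof
  assume "\<exists>R. finite R \<and> \<Phi> R"
  then obtain R where R: "finite R" "\<Phi> R" by blast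
  obtain q f g where "q \<in> A" "f \<in> A" "g \<in> A" "rlcode A t q f g" "relof q f g = R"
    using relof_surj[OF assms R(1)] by blast
  then show "\<exists>Q\<in>A. \<exists>F\<in>A. \<exists>G\<in>A. rlcode A t Q F G \<and> \<Phi> (relof Q F G)" using R(2) by blast
qed (use finite_relof in blast)

lemma bisimc_iff: "bisimc A t q f g q' f' g' Q F G \<longleftrightarrow> bisim (relof q f g) (relof q' f' g') (relof Q F G)"
  unfolding bisimc_def bisim_def ksc_all ksc_ex rl_relof sc_t_inj ..

lemma eqc_rel:
  assumes "infinite (UNIV :: 'k set)"
  shows "eqc A t q f g (sc \<xi> * t) q' f' g' (sc \<xi>' * t) \<longleftrightarrow>
    (\<exists>B. finite B \<and> bisim (relof q f g) (relof q' f' g') B \<and> (\<xi>, \<xi>') \<in> B)"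
  unfolding eqc_def bisimc_iff rl_relof
  by (rule rlcode_ex[OF assms, of "\<lambda>B. bisim (relof q f g) (relof q' f' g') B \<and> (\<xi>, \<xi>') \<in> B"])

lemma eqc_iff:
  assumes "infinite (UNIV :: 'k set)" "code q f g x u" "code q' f' g' x' v"
  shows "eqc A t q f g x q' f' g' x' \<longleftrightarrow> u = v"
proof -
  obtain \<xi> \<xi>' where *: "x = sc \<xi> * t" "den (relof q f g) \<xi> u" "x' = sc \<xi>' * t" "den (relof q' f' g') \<xi>' v"
    and fin: "finite (relof q f g)" "finite (relof q' f' g')"
    using assms(2,3) finite_relof unfolding code_def by blast
  show ?thesis unfolding *(1,3) eqc_rel[OF assms(1)] using den_eq_iff[OF fin *(2,4)] by simp
qed

lemma memc_iff:
  assumes "infinite (UNIV :: 'k set)" "code q f g x u" "code q' f' g' x' v"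
  shows "memc A t q f g x q' f' g' x' \<longleftrightarrow> hf_mem u v"
proof -
  obtain \<xi> \<xi>' where *: "x = sc \<xi> * t" "den (relof q f g) \<xi> u" "x' = sc \<xi>' * t" "den (relof q' f' g') \<xi>' v"
    and fin: "finite (relof q f g)" "finite (relof q' f' g')"
    using assms(2,3) finite_relof unfolding code_def by blast
  show ?thesis
    unfolding *(1,3) memc_def ksc_ex rl_relof eqc_rel[OF assms(1)] using den_mem_iff[OF fin *(2,4)] by simp
qed

lemma rlcode_all_sets:
  assumes "infinite (UNIV :: 'k set)"
  shows "(\<forall>Q\<in>A. \<forall>F\<in>A. \<forall>G\<in>A. rlcode A t Q F G \<longrightarrow> \<Phi> {a. (a, a) \<in> relof Q F G}) \<longleftrightarrow> (\<forall>S. finite S \<longrightarrow> \<Phi> S)"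
proof
  assume L: "\<forall>Q\<in>A. \<forall>F\<in>A. \<forall>G\<in>A. rlcode A t Q F G \<longrightarrow> \<Phi> {a. (a, a) \<in> relof Q F G}"
  show "\<forall>S. finite S \<longrightarrow> \<Phi> S"
  proof (intro allI impI)
    fix S :: "'k set" assume "finite S"
    then have "finite (Id_on S)" by (simp add: Id_on_def)
    from relof_surj[OF assms this]
    obtain q f g where q: "q \<in> A" "f \<in> A" "g \<in> A" "rlcode A t q f g" "relof q f g = Id_on S"
      by blast
    then have "\<Phi> {a. (a, a) \<in> relof q f g}" using L by blast
    then show "\<Phi> S" by (simp add: q(5) Id_on_iff)
  qed
next
  assume R: "\<forall>S. finite S \<longrightarrow> \<Phi> S"
  show "\<forall>Q\<in>A. \<forall>F\<in>A. \<forall>G\<in>A. rlcode A t Q F G \<longrightarrow> \<Phi> {a. (a, a) \<in> relof Q F G}"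
  proof (intro ballI impI)
    fix Q F G assume "rlcode A t Q F G"
    then have "finite (relof Q F G)" by (rule finite_relof)
    then have "finite (fst ` relof Q F G)" by simp
    then have "finite {a. (a, a) \<in> relof Q F G}" by (rule rev_finite_subset) force
    then show "\<Phi> {a. (a, a) \<in> relof Q F G}" using R by blast
  qed
qed

lemma validc_iff:
  assumes "infinite (UNIV :: 'k set)"
  shows "validc A t q f g x \<longleftrightarrow> (\<exists>u. code q f g x u)"
proof -
  have *: "validc A t q f g (sc \<xi> * t) \<longleftrightarrow> rlcode A t q f g \<and> (\<exists>u. den (relof q f g) \<xi> u)" for \<xi>
  proof (cases "rlcode A t q f g")
    case True
    have "sc \<xi> * t \<in> ksc A t" by (simp add: ksc_eq)
    then have "validc A t q f g (sc \<xi> * t) \<longleftrightarrow> (\<forall>Q\<in>A. \<forall>F\<in>A. \<forall>G\<in>A. rlcode A t Q F G \<longrightarrow> (\<xi>, \<xi>) \<in> relof Q F G \<longrightarrow>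
        (\<exists>m. (m, m) \<in> relof Q F G \<and> ((m, m) \<in> relof q f g \<or> \<not> (\<exists>y. (y, y) \<in> relof Q F G \<and> (y, m) \<in> relof q f g))))"
      using True unfolding validc_def ksc_ex rl_relof by simp
    also have "\<dots> \<longleftrightarrow> (\<forall>S. finite S \<longrightarrow> \<xi> \<in> S \<longrightarrow>
        (\<exists>m. m \<in> S \<and> ((m, m) \<in> relof q f g \<or> \<not> (\<exists>y. y \<in> S \<and> (y, m) \<in> relof q f g))))"
      using rlcode_all_sets[OF assms, of "\<lambda>S. \<xi> \<in> S \<longrightarrow>
        (\<exists>m. m \<in> S \<and> ((m, m) \<in> relof q f g \<or> \<not> (\<exists>y. y \<in> S \<and> (y, m) \<in> relof q f g)))"]
      by (simp only: mem_Collect_eq)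
    also have "\<dots> \<longleftrightarrow> (\<exists>u. den (relof q f g) \<xi> u)"
      by (simp only: den_ex_iff[OF finite_relof[OF True]] Bex_def imp_conjL)
    finally show ?thesis using True by simp
  qed (simp add: validc_def)
  show ?thesis
  proof
    assume v: "validc A t q f g x"
    then have "x \<in> ksc A t" by (simp add: validc_def)
    then obtain \<xi> where "x = sc \<xi> * t" using ksc_eq by blast
    then show "\<exists>u. code q f g x u" using v * unfolding code_def by blast
  qed (use * in \<open>auto simp: code_def\<close>)
qed

lemma code_surj:
  assumes "infinite (UNIV :: 'k set)"
  shows "\<exists>q\<in>A. \<exists>f\<in>A. \<exists>g\<in>A. \<exists>x\<in>A. code q f g x u"
proof -
  obtain R \<xi> where R: "finite R" "den R \<xi> u" using den_surj[OF assms] by blast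
  then show ?thesis using relof_surj[OF assms R(1)] sc_t_in unfolding code_def by blast
qed

lemma code_Atom:
  assumes "rlcode A t q f g"
  shows "code q f g (sc a * t) (Atom a) \<longleftrightarrow> rl A t q f g (sc a * t) (sc a * t)"
  unfolding code_def rl_relof using assms by (auto simp: den_Atom_iff sc_t_inj)

text \<open>Ring variable \<open>0\<close> holds \<open>t\<close>, variable \<open>5n + 1\<close> the field variable \<open>n\<close>, and the next four
  the code of the set variable \<open>n\<close>.\<close>

definition codes :: "(nat \<Rightarrow> ('x, 'k) ncp) \<Rightarrow> (nat \<Rightarrow> 'k) \<Rightarrow> (nat \<Rightarrow> 'k hf) \<Rightarrow> bool" where
  "codes r e h \<longleftrightarrow> range r \<subseteq> A \<and> r 0 = t \<and> (\<forall>n. r (5 * n + 1) = sc (e n) * t) \<and>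
    (\<forall>n. code (r (5 * n + 2)) (r (5 * n + 3)) (r (5 * n + 4)) (r (5 * n + 5)) (h n))"

end

subsection \<open>Translating formulas about hereditarily finite sets\<close>

text \<open>A field term turns into a property of b rather than a ring term, because the product of
  two represented scalars has to be divided by t, which only an equation can express.\<close>

definition fterm_ok :: "'x set \<Rightarrow> (('x, 'k::field) ncp \<Rightarrow> (nat \<Rightarrow> ('x, 'k) ncp) \<Rightarrow> bool) \<Rightarrow> field_term \<Rightarrow> bool" where
  "fterm_ok X P s \<longleftrightarrow> (\<forall>t r e h b. theta_elem X t \<longrightarrow> theta_elem.codes X t r e h \<longrightarrow> b \<in> free_alg X \<longrightarrow>
     (P b r \<longleftrightarrow> b = sc (field_term_val e s) * t))"

lemma fterm_ok_FVar: "fterm_ok X (\<lambda>b r. b = r (5 * n + 1)) (FVar n)"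
  by (auto simp: fterm_ok_def theta_elem.codes_def)

lemma fterm_ok_FZero: "fterm_ok X (\<lambda>b r. b = 0) FZero"
  by (auto simp: fterm_ok_def)

lemma fterm_ok_FOne: "fterm_ok X (\<lambda>b r. b = r 0) FOne"
  by (auto simp: fterm_ok_def theta_elem.codes_def sc_1)

lemma fterm_okD:
  assumes "fterm_ok X P s" "theta_elem X t" "theta_elem.codes X t r e h" "b \<in> free_alg X"
  shows "P b r \<longleftrightarrow> b = sc (field_term_val e s) * t"
  using assms unfolding fterm_ok_def by blast

lemma fterm_ok_binop:
  fixes X :: "'x set" and P Q :: "('x, 'k::field) ncp \<Rightarrow> (nat \<Rightarrow> ('x, 'k) ncp) \<Rightarrow> bool"
  assumes "fterm_ok X P s" "fterm_ok X Q u"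
    and S: "\<And>t b e. theta_elem X t \<Longrightarrow> S t b (sc (field_term_val e s) * t) (sc (field_term_val e u) * t) \<longleftrightarrow>
        b = sc (field_term_val e v) * t"
  shows "fterm_ok X (\<lambda>b r. \<exists>b1\<in>free_alg X. \<exists>b2\<in>free_alg X. P b1 r \<and> Q b2 r \<and> S (r 0) b b1 b2) v"
  unfolding fterm_ok_def
proof (intro allI impI)
  fix t e h b and r :: "nat \<Rightarrow> ('x, 'k) ncp"
  assume t: "theta_elem X t" and r: "theta_elem.codes X t r e h"
  have "sc c * t \<in> free_alg X" for c using theta_elem.sc_t_in[OF t] .
  moreover have "r 0 = t" using r by (simp add: theta_elem.codes_def[OF t])
  ultimately show "(\<exists>b1\<in>free_alg X. \<exists>b2\<in>free_alg X. P b1 r \<and> Q b2 r \<and> S (r 0) b b1 b2) \<longleftrightarrow> b = sc (field_term_val e v) * t"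
    using fterm_okD[OF assms(1) t r] fterm_okD[OF assms(2) t r] S[OF t] by auto
qed

lemma fterm_ok_FAdd:
  "fterm_ok X P s \<Longrightarrow> fterm_ok X Q u \<Longrightarrow>
    fterm_ok X (\<lambda>b r. \<exists>b1\<in>free_alg X. \<exists>b2\<in>free_alg X. P b1 r \<and> Q b2 r \<and> b = b1 + b2) (FAdd s u)"
  by (rule fterm_ok_binop[where S = "\<lambda>t b b1 b2. b = b1 + b2"]) (simp_all add: single_add distrib_right)

lemma fterm_ok_FMul:
  fixes X :: "'x set" and P Q :: "('x, 'k::field) ncp \<Rightarrow> (nat \<Rightarrow> ('x, 'k) ncp) \<Rightarrow> bool"
  assumes "fterm_ok X P s" "fterm_ok X Q u"
  shows "fterm_ok X (\<lambda>b r. \<exists>b1\<in>free_alg X. \<exists>b2\<in>free_alg X. P b1 r \<and> Q b2 r \<and> r 0 * b = b1 * b2) (FMul s u)"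
proof (rule fterm_ok_binop[where S = "\<lambda>t b b1 b2. t * b = b1 * b2", OF assms])
  fix t b :: "('x, 'k) ncp" and e :: "nat \<Rightarrow> 'k" assume t: "theta_elem X t"
  let ?x = "field_term_val e s" and ?y = "field_term_val e u"
  have "sc ?x * t * (sc ?y * t) = sc ?x * (sc ?y * (t * t))"
    by (simp only: mult.assoc sc_left_commute[of t])
  also have "\<dots> = t * (sc (?x * ?y) * t)"
    by (simp only: mult.assoc[symmetric] sc_mult_sc) (simp only: mult.assoc sc_left_commute[of t])
  finally show "t * b = sc ?x * t * (sc ?y * t) \<longleftrightarrow> b = sc (field_term_val e (FMul s u)) * t"
    using free_mult_left_cancel[OF theta_elem.t0[OF t]] by simp
qed

section \<open>Substitution and block quantification for definable predicates\<close>

abbreviation unary :: "('a \<Rightarrow> (nat \<Rightarrow> 'a) \<Rightarrow> bool) \<Rightarrow> (nat \<Rightarrow> 'a) \<Rightarrow> bool" where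
  "unary P \<equiv> \<lambda>e. P (e 0) (\<lambda>i. e (Suc i))"

abbreviation quaternary :: "('a \<Rightarrow> 'a \<Rightarrow> 'a \<Rightarrow> 'a \<Rightarrow> (nat \<Rightarrow> 'a) \<Rightarrow> bool) \<Rightarrow> (nat \<Rightarrow> 'a) \<Rightarrow> bool" where
  "quaternary P \<equiv> \<lambda>e. P (e 0) (e 1) (e 2) (e 3) (\<lambda>i. e (i + 4))"

context definability
begin

lemma D_sub1:
  assumes "D (unary P) (unary Q)"
  shows "D (\<lambda>e. P (e j) (\<lambda>i. e (f i))) (\<lambda>e. Q (e j) (\<lambda>i. e (f i)))"
  using D_ren[OF assms, of "case_nat j f"] by simp

lemma D_sub4:
  assumes "D (quaternary P) (quaternary Q)"
  shows "D (\<lambda>e. P (e j) (e k) (e l) (e m) (\<lambda>i. e (f i))) (\<lambda>e. Q (e j) (e k) (e l) (e m) (\<lambda>i. e (f i)))"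
  using D_ren[OF assms, of "\<lambda>i. if i = 0 then j else if i = 1 then k else if i = 2 then l else if i = 3 then m else f (i - 4)"]
  by simp

text \<open>Quantifies over the first n variables for an n outside the language, one
  \<open>D_upd\<close> at a time. The witness is a full sequence, of which only the first n values
  are read.\<close>

lemma D_block:
  assumes "D P Q"
  shows "D (\<lambda>e. \<exists>a. range a \<subseteq> A \<and> P (\<lambda>j. if j < n then a j else e j))
    (\<lambda>e. \<exists>a. range a \<subseteq> B \<and> Q (\<lambda>j. if j < n then a j else e j))"
  using assms
proof (induction n arbitrary: P Q)
  case 0
  then show ?case by (rule D_cong) auto
next
  case (Suc n)
  have eq: "(\<exists>a. range a \<subseteq> S \<and> (\<exists>x\<in>S. R ((\<lambda>j. if j < n then a j else e j)(n := x)))) \<longleftrightarrow>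
      (\<exists>a. range a \<subseteq> S \<and> R (\<lambda>j. if j < Suc n then a j else e j))" for S :: "'c set" and R e
  proof
    assume "\<exists>a. range a \<subseteq> S \<and> (\<exists>x\<in>S. R ((\<lambda>j. if j < n then a j else e j)(n := x)))"
    then obtain a x where ax: "range a \<subseteq> S" "x \<in> S" "R ((\<lambda>j. if j < n then a j else e j)(n := x))" by blast
    have "(\<lambda>j. if j < n then a j else e j)(n := x) = (\<lambda>j. if j < Suc n then (a(n := x)) j else e j)"
      by (auto simp: fun_eq_iff)
    then show "\<exists>a. range a \<subseteq> S \<and> R (\<lambda>j. if j < Suc n then a j else e j)"
      using ax range_upd_subset[OF ax(1,2), of n] by metis
  next
    assume "\<exists>a. range a \<subseteq> S \<and> R (\<lambda>j. if j < Suc n then a j else e j)"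
    then obtain a where a: "range a \<subseteq> S" "R (\<lambda>j. if j < Suc n then a j else e j)" by blast
    have "(\<lambda>j. if j < n then a j else e j)(n := a n) = (\<lambda>j. if j < Suc n then a j else e j)"
      by (auto simp: fun_eq_iff)
    moreover have "a n \<in> S" using a(1) by auto
    ultimately show "\<exists>a. range a \<subseteq> S \<and> (\<exists>x\<in>S. R ((\<lambda>j. if j < n then a j else e j)(n := x)))"
      using a by metis
  qed
  show ?case using Suc.IH[OF D_upd[OF Suc.prems, where n = n]] unfolding eq .
qed

end

lemma field_term_definable:
  fixes X :: "'x set" and Y :: "'y set" and s :: field_term
  shows "\<exists>(P :: ('x, 'k::field) ncp \<Rightarrow> _) (Q :: ('y, 'l::field) ncp \<Rightarrow> _).
    rng_definable (free_alg X) (free_alg Y) (unary P) (unary Q) \<and>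
    fterm_ok X P s \<and> fterm_ok Y Q s"
  (is "\<exists>P Q. ?D (unary P) (unary Q) \<and> _ P \<and> _ Q")
proof (induction s)
  case (FVar n)
  show ?case
    by (intro exI conjI, rule_tac[2] fterm_ok_FVar, rule_tac[2] fterm_ok_FVar) (intro rng_intros)
next
  case FZero
  show ?case
    by (intro exI conjI, rule_tac[2] fterm_ok_FZero, rule_tac[2] fterm_ok_FZero) (intro rng_intros)
next
  case FOne
  show ?case
    by (intro exI conjI, rule_tac[2] fterm_ok_FOne, rule_tac[2] fterm_ok_FOne) (intro rng_intros)
next
  case (FAdd s u)
  obtain P1 Q1 P2 Q2 where 1: "?D (unary P1) (unary Q1)" "fterm_ok X P1 s" "fterm_ok Y Q1 s"
    and 2: "?D (unary P2) (unary Q2)" "fterm_ok X P2 u" "fterm_ok Y Q2 u"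
    using FAdd.IH by (elim exE conjE)
  show ?case
    by (intro exI conjI, rule_tac[2] fterm_ok_FAdd[OF 1(2) 2(2)], rule_tac[2] fterm_ok_FAdd[OF 1(3) 2(3)])
      (intro rng_intros rng.D_sub1[where P = P1 and Q = Q1, OF 1(1)] rng.D_sub1[where P = P2 and Q = Q2, OF 2(1)])
next
  case (FMul s u)
  obtain P1 Q1 P2 Q2 where 1: "?D (unary P1) (unary Q1)" "fterm_ok X P1 s" "fterm_ok Y Q1 s"
    and 2: "?D (unary P2) (unary Q2)" "fterm_ok X P2 u" "fterm_ok Y Q2 u"
    using FMul.IH by (elim exE conjE)
  show ?case
    by (intro exI conjI, rule_tac[2] fterm_ok_FMul[OF 1(2) 2(2)], rule_tac[2] fterm_ok_FMul[OF 1(3) 2(3)])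
      (intro rng_intros rng.D_sub1[where P = P1 and Q = Q1, OF 1(1)] rng.D_sub1[where P = P2 and Q = Q2, OF 2(1)])
qed

text \<open>A value has many codes, so the predicate is only required to contain nothing but codes
  of the value and to contain at least one.\<close>

definition hterm_ok :: "'x set \<Rightarrow> (('x, 'k::field) ncp \<Rightarrow> ('x, 'k) ncp \<Rightarrow> ('x, 'k) ncp \<Rightarrow> ('x, 'k) ncp \<Rightarrow>
    (nat \<Rightarrow> ('x, 'k) ncp) \<Rightarrow> bool) \<Rightarrow> hf_term \<Rightarrow> bool" where
  "hterm_ok X P s \<longleftrightarrow> (\<forall>t r e h. theta_elem X t \<longrightarrow> theta_elem.codes X t r e h \<longrightarrow>
     (\<forall>q f g x. P q f g x r \<longrightarrow> theta_elem.code X t q f g x (hf_term_val e h s)) \<and>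
     (\<exists>q\<in>free_alg X. \<exists>f\<in>free_alg X. \<exists>g\<in>free_alg X. \<exists>x\<in>free_alg X. P q f g x r))"

lemma hterm_ok_HVar:
  "hterm_ok X (\<lambda>q f g x r. q = r (5 * n + 2) \<and> f = r (5 * n + 3) \<and> g = r (5 * n + 4) \<and> x = r (5 * n + 5)) (HVar n)"
  unfolding hterm_ok_def by (auto simp: theta_elem.codes_def)

text \<open>Any coded relation with a loop at the scalar codes the atom.\<close>

lemma hterm_ok_HElem:
  fixes X :: "'x set" and P :: "('x, 'k::field) ncp \<Rightarrow> (nat \<Rightarrow> ('x, 'k) ncp) \<Rightarrow> bool"
  assumes "infinite (UNIV :: 'k set)" "fterm_ok X P s"
  shows "hterm_ok X (\<lambda>q f g x r. x \<in> free_alg X \<and> rlcode (free_alg X) (r 0) q f g \<and> P x r \<and>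
      rl (free_alg X) (r 0) q f g x x) (HElem s)"
  unfolding hterm_ok_def
proof (intro allI impI)
  fix t :: "('x, 'k) ncp" and r e h
  assume t: "theta_elem X t" and r: "theta_elem.codes X t r e h"
  interpret theta_elem X t by (rule t)
  let ?a = "field_term_val e s"
  have r0: "r 0 = t" using r by (simp add: codes_def)
  have P: "P b r \<longleftrightarrow> b = sc ?a * t" if "b \<in> A" for b
    using fterm_okD[OF assms(2) t r that] .
  obtain q f g x where c: "q \<in> A" "f \<in> A" "g \<in> A" "x \<in> A" "code q f g x (Atom ?a)"
    using code_surj[OF assms(1)] by blast
  then have x: "x = sc ?a * t" "rlcode A t q f g" by (auto simp: code_def den_Atom_iff)
  then have "rl A t q f g x x" using c(5) code_Atom by simp
  then have "\<exists>q\<in>A. \<exists>f\<in>A. \<exists>g\<in>A. \<exists>x\<in>A. x \<in> A \<and> rlcode A (r 0) q f g \<and> P x r \<and> rl A (r 0) q f g x x"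
    using c x P r0 by blast
  moreover have "code q f g x (hf_term_val e h (HElem s))"
    if "x \<in> A \<and> rlcode A (r 0) q f g \<and> P x r \<and> rl A (r 0) q f g x x" for q f g x
  proof -
    have "x = sc ?a * t" "rlcode A t q f g" "rl A t q f g x x" using that P r0 by auto
    then show ?thesis using code_Atom by simp
  qed
  ultimately show "(\<forall>q f g x. x \<in> A \<and> rlcode A (r 0) q f g \<and> P x r \<and> rl A (r 0) q f g x x \<longrightarrow>
       code q f g x (hf_term_val e h (HElem s))) \<and>
     (\<exists>q\<in>A. \<exists>f\<in>A. \<exists>g\<in>A. \<exists>x\<in>A. x \<in> A \<and> rlcode A (r 0) q f g \<and> P x r \<and> rl A (r 0) q f g x x)"
    by blast
qed

lemma hf_term_definable:
  fixes X :: "'x set" and Y :: "'y set" and s :: hf_term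
  assumes "infinite (UNIV :: 'k::field set)" "infinite (UNIV :: 'l::field set)"
  shows "\<exists>(P :: ('x, 'k) ncp \<Rightarrow> _) (Q :: ('y, 'l) ncp \<Rightarrow> _).
    rng_definable (free_alg X) (free_alg Y) (quaternary P)
      (quaternary Q) \<and>
    hterm_ok X P s \<and> hterm_ok Y Q s"
proof (cases s)
  case (HVar n)
  show ?thesis unfolding HVar
    by (intro exI conjI, rule_tac[2] hterm_ok_HVar, rule_tac[2] hterm_ok_HVar) (intro rng_intros)
next
  case (HElem s')
  from field_term_definable[of X Y s'] obtain P1 :: "('x, 'k) ncp \<Rightarrow> _" and Q1 :: "('y, 'l) ncp \<Rightarrow> _" where
    1: "rng_definable (free_alg X) (free_alg Y) (unary P1) (unary Q1)"
      "fterm_ok X P1 s'" "fterm_ok Y Q1 s'" by (elim exE conjE)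
  show ?thesis unfolding HElem
    by (intro exI conjI, rule_tac[2] hterm_ok_HElem[OF assms(1) 1(2)], rule_tac[2] hterm_ok_HElem[OF assms(2) 1(3)])
      (intro rng_intros rng.D_sub1[where P = P1 and Q = Q1, OF 1(1)] D_rl D_rlcode)
qed

definition form_ok :: "'x set \<Rightarrow> ((nat \<Rightarrow> ('x, 'k::field) ncp) \<Rightarrow> bool) \<Rightarrow> hf_form \<Rightarrow> bool" where
  "form_ok X P \<phi> \<longleftrightarrow> (\<forall>t r e h. theta_elem X t \<longrightarrow> theta_elem.codes X t r e h \<longrightarrow> (P r \<longleftrightarrow> hf_sat UNIV e h \<phi>))"

lemma form_okD:
  "form_ok X P \<phi> \<Longrightarrow> theta_elem X t \<Longrightarrow> theta_elem.codes X t r e h \<Longrightarrow> P r \<longleftrightarrow> hf_sat UNIV e h \<phi>"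
  unfolding form_ok_def by blast

definition hterm_pair where
  "hterm_pair A P Q S r \<longleftrightarrow> (\<exists>q\<in>A. \<exists>f\<in>A. \<exists>g\<in>A. \<exists>x\<in>A. \<exists>q'\<in>A. \<exists>f'\<in>A. \<exists>g'\<in>A. \<exists>x'\<in>A.
     P q f g x r \<and> Q q' f' g' x' r \<and> S A (r (0::nat)) q f g x q' f' g' x')"

text \<open>Codes of both values exist, and S answers alike on all of them, so the existential
  choice of codes is harmless.\<close>

lemma hterm_pair_iff:
  fixes X :: "'x set" and t :: "('x, 'k::field) ncp"
  assumes "hterm_ok X P s" "hterm_ok X Q u" and t: "theta_elem X t" and r: "theta_elem.codes X t r e h"
    and S: "\<And>q f g x q' f' g' x'. theta_elem.code X t q f g x (hf_term_val e h s) \<Longrightarrow>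
        theta_elem.code X t q' f' g' x' (hf_term_val e h u) \<Longrightarrow> S (free_alg X) t q f g x q' f' g' x' \<longleftrightarrow> b"
  shows "hterm_pair (free_alg X) P Q S r \<longleftrightarrow> b"
proof -
  interpret theta_elem X t by (rule t)
  have r0: "r 0 = t" using r by (simp add: codes_def)
  have P: "P q f g x r \<Longrightarrow> code q f g x (hf_term_val e h s)" for q f g x
    using assms(1) t r unfolding hterm_ok_def by blast
  have Q: "Q q f g x r \<Longrightarrow> code q f g x (hf_term_val e h u)" for q f g x
    using assms(2) t r unfolding hterm_ok_def by blast
  obtain q f g x where "q \<in> A" "f \<in> A" "g \<in> A" "x \<in> A" "P q f g x r"
    using assms(1) t r unfolding hterm_ok_def by blast
  moreover obtain q' f' g' x' where "q' \<in> A" "f' \<in> A" "g' \<in> A" "x' \<in> A" "Q q' f' g' x' r"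
    using assms(2) t r unfolding hterm_ok_def by blast
  ultimately have "hterm_pair A P Q S r" if b
    unfolding hterm_pair_def r0 using S[OF P Q] that by blast
  moreover have b if "hterm_pair A P Q S r"
    using that S[OF P Q] unfolding hterm_pair_def r0 by blast
  ultimately show ?thesis by blast
qed

lemma form_ok_HEq:
  fixes P Q :: "('x, 'k::field) ncp \<Rightarrow> _"
  assumes "infinite (UNIV :: 'k set)" "hterm_ok X P s" "hterm_ok X Q u"
  shows "form_ok X (hterm_pair (free_alg X) P Q eqc) (HEq s u)"
  unfolding form_ok_def
  by (intro allI impI, rule hterm_pair_iff[OF assms(2,3)], assumption, assumption,
      simp only: theta_elem.eqc_iff[OF _ assms(1)] hf_sat.simps)

lemma form_ok_HMem:
  fixes P Q :: "('x, 'k::field) ncp \<Rightarrow> _"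
  assumes "infinite (UNIV :: 'k set)" "hterm_ok X P s" "hterm_ok X Q u"
  shows "form_ok X (hterm_pair (free_alg X) P Q memc) (HMem s u)"
  unfolding form_ok_def
  by (intro allI impI, rule hterm_pair_iff[OF assms(2,3)], assumption, assumption,
      simp only: theta_elem.memc_iff[OF _ assms(1)] hf_sat.simps)

lemma form_ok_HNot: "form_ok X P \<phi> \<Longrightarrow> form_ok X (\<lambda>r. \<not> P r) (HNot \<phi>)"
  unfolding form_ok_def by simp

lemma form_ok_HAnd: "form_ok X P \<phi> \<Longrightarrow> form_ok X Q \<psi> \<Longrightarrow> form_ok X (\<lambda>r. P r \<and> Q r) (HAnd \<phi> \<psi>)"
  unfolding form_ok_def by simp

lemma (in theta_elem) codes_upd_field:
  assumes "codes r e h"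
  shows "codes (r(5 * n + 1 := sc a * t)) (e(n := a)) h"
proof -
  let ?r = "r(5 * n + 1 := sc a * t)"
  have "5 * m + 2 \<noteq> 5 * n + 1" "5 * m + 3 \<noteq> 5 * n + 1" "5 * m + 4 \<noteq> 5 * n + 1" "5 * m + 5 \<noteq> 5 * n + 1" for m
    by presburger+
  then have "?r (5 * m + 2) = r (5 * m + 2)" "?r (5 * m + 3) = r (5 * m + 3)" "?r (5 * m + 4) = r (5 * m + 4)"
      "?r (5 * m + 5) = r (5 * m + 5)" for m
    by (simp_all only: fun_upd_apply if_False)
  moreover have "range ?r \<subseteq> A"
    using assms by (intro range_upd_subset sc_t_in) (simp add: codes_def)
  moreover have "?r (5 * m + 1) = sc ((e(n := a)) m) * t" "?r 0 = t" for m
    using assms by (simp_all add: codes_def)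
  moreover have "code (r (5 * m + 2)) (r (5 * m + 3)) (r (5 * m + 4)) (r (5 * m + 5)) (h m)" for m
    using assms unfolding codes_def by blast
  ultimately show ?thesis unfolding codes_def by presburger
qed

lemma (in theta_elem) codes_upd_set:
  assumes "codes r e h" "code q f g x u" "q \<in> A" "f \<in> A" "g \<in> A" "x \<in> A"
  shows "codes (r(5 * n + 2 := q, 5 * n + 3 := f, 5 * n + 4 := g, 5 * n + 5 := x)) e (h(n := u))"
proof -
  let ?r = "r(5 * n + 2 := q, 5 * n + 3 := f, 5 * n + 4 := g, 5 * n + 5 := x)"
  have "range ?r \<subseteq> A"
    using assms by (intro range_upd_subset) (simp_all add: codes_def)
  moreover have "?r 0 = t" using assms(1) by (simp add: codes_def)
  moreover have "?r (5 * m + 1) = r (5 * m + 1)" for m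
  proof -
    have "5 * m + 1 \<noteq> 5 * n + 2" "5 * m + 1 \<noteq> 5 * n + 3" "5 * m + 1 \<noteq> 5 * n + 4" "5 * m + 1 \<noteq> 5 * n + 5"
      by presburger+
    then show ?thesis by (simp only: fun_upd_apply if_False)
  qed
  moreover have "code (?r (5 * m + 2)) (?r (5 * m + 3)) (?r (5 * m + 4)) (?r (5 * m + 5)) ((h(n := u)) m)" for m
  proof (cases "m = n")
    case False
    \<comment> \<open>Offsets between 2 and 5 differ by at most 3, less than the block length
      5.\<close>
    have "5 * m + i \<noteq> 5 * n + j" if "i \<in> {2, 3, 4, 5}" "j \<in> {2, 3, 4, 5}" for i j :: nat
    proof
      assume "5 * m + i = 5 * n + j"
      moreover have "i < 6" "2 \<le> i" "j < 6" "2 \<le> j" using that by auto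
      ultimately have "m = n" by presburger
      then show False using False by blast
    qed
    then have "?r (5 * m + i) = r (5 * m + i)" if "i \<in> {2, 3, 4, 5}" for i
      using that by (simp only: fun_upd_apply if_False insert_iff simp_thms)
    then show ?thesis using assms(1) False by (simp add: codes_def)
  qed (use assms(2) in simp)
  ultimately show ?thesis using assms(1) by (simp add: codes_def)
qed

text \<open>The unreduced \<open>(r(5 * n + 1 := a)) (5 * n + 1)\<close> is literally what
  \<open>D_upd\<close> makes of the conjunction of \<open>ksc\<close> membership and P, so the two
  can be matched without rewriting under the quantifier.\<close>

lemma form_ok_HExF:
  fixes X :: "'x set" and P :: "(nat \<Rightarrow> ('x, 'k::field) ncp) \<Rightarrow> bool"
  assumes "form_ok X P \<phi>"
  shows "form_ok X (\<lambda>r. \<exists>a\<in>free_alg X. (r(5 * n + 1 := a)) (5 * n + 1) \<in> ksc (free_alg X) ((r(5 * n + 1 := a)) 0) \<and>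
      P (r(5 * n + 1 := a))) (HExF n \<phi>)"
  unfolding form_ok_def
proof (intro allI impI)
  fix t :: "('x, 'k) ncp" and r e h assume t: "theta_elem X t" and r: "theta_elem.codes X t r e h"
  interpret theta_elem X t by (rule t)
  have r0: "r 0 = t" using r by (simp add: codes_def)
  have "(\<exists>a\<in>A. (r(5 * n + 1 := a)) (5 * n + 1) \<in> ksc A ((r(5 * n + 1 := a)) 0) \<and> P (r(5 * n + 1 := a))) \<longleftrightarrow>
      (\<exists>a. P (r(5 * n + 1 := sc a * t)))"
    using ksc_ex[of "\<lambda>a. P (r(5 * n + 1 := a))"] r0 by simp
  also have "\<dots> \<longleftrightarrow> hf_sat UNIV e h (HExF n \<phi>)"
    using form_okD[OF assms t codes_upd_field[OF r]] by simp
  finally show "(\<exists>a\<in>A. (r(5 * n + 1 := a)) (5 * n + 1) \<in> ksc A ((r(5 * n + 1 := a)) 0) \<and> P (r(5 * n + 1 := a))) \<longleftrightarrow>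
      hf_sat UNIV e h (HExF n \<phi>)" .
qed

definition valid_at where
  "valid_at A n r \<longleftrightarrow> validc A (r 0) (r (5 * n + 2)) (r (5 * n + 3)) (r (5 * n + 4)) (r (5 * n + 5 :: nat))"

lemma form_ok_HExS:
  fixes X :: "'x set" and P :: "(nat \<Rightarrow> ('x, 'k::field) ncp) \<Rightarrow> bool"
  assumes "infinite (UNIV :: 'k set)" "form_ok X P \<phi>"
  shows "form_ok X (\<lambda>r. \<exists>q\<in>free_alg X. \<exists>f\<in>free_alg X. \<exists>g\<in>free_alg X. \<exists>x\<in>free_alg X.
      valid_at (free_alg X) n (r(5 * n + 2 := q, 5 * n + 3 := f, 5 * n + 4 := g, 5 * n + 5 := x)) \<and>
      P (r(5 * n + 2 := q, 5 * n + 3 := f, 5 * n + 4 := g, 5 * n + 5 := x))) (HExS n \<phi>)"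
  unfolding form_ok_def
proof (intro allI impI)
  fix t :: "('x, 'k) ncp" and r e h assume t: "theta_elem X t" and r: "theta_elem.codes X t r e h"
  interpret theta_elem X t by (rule t)
  let ?r = "\<lambda>q f g x. r(5 * n + 2 := q, 5 * n + 3 := f, 5 * n + 4 := g, 5 * n + 5 := x)"
  have v: "valid_at A n (?r q f g x) \<longleftrightarrow> (\<exists>u. code q f g x u)" for q f g x
    using r unfolding validc_iff[OF assms(1), symmetric] by (simp add: valid_at_def codes_def)
  have P: "P (?r q f g x) \<longleftrightarrow> hf_sat UNIV e (h(n := u)) \<phi>"
    if "code q f g x u" "q \<in> A" "f \<in> A" "g \<in> A" "x \<in> A" for q f g x u
    by (rule form_okD[OF assms(2) t codes_upd_set[OF r that]])
  have "(\<exists>q\<in>A. \<exists>f\<in>A. \<exists>g\<in>A. \<exists>x\<in>A. valid_at A n (?r q f g x) \<and> P (?r q f g x)) \<longleftrightarrow> (\<exists>u. hf_sat UNIV e (h(n := u)) \<phi>)"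
  proof
    assume "\<exists>u. hf_sat UNIV e (h(n := u)) \<phi>"
    then obtain u where u: "hf_sat UNIV e (h(n := u)) \<phi>" by blast
    from code_surj[OF assms(1), of u] show "\<exists>q\<in>A. \<exists>f\<in>A. \<exists>g\<in>A. \<exists>x\<in>A. valid_at A n (?r q f g x) \<and> P (?r q f g x)"
      using u v P by (metis (no_types, lifting))
  next
    assume "\<exists>q\<in>A. \<exists>f\<in>A. \<exists>g\<in>A. \<exists>x\<in>A. valid_at A n (?r q f g x) \<and> P (?r q f g x)"
    then obtain q f g x where c: "q \<in> A" "f \<in> A" "g \<in> A" "x \<in> A" "valid_at A n (?r q f g x)" "P (?r q f g x)" by blast
    then show "\<exists>u. hf_sat UNIV e (h(n := u)) \<phi>" using v P by blast
  qed
  then show "(\<exists>q\<in>A. \<exists>f\<in>A. \<exists>g\<in>A. \<exists>x\<in>A. valid_at A n (?r q f g x) \<and> P (?r q f g x)) \<longleftrightarrow> hf_sat UNIV e h (HExS n \<phi>)"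
    by (simp add: HF_UNIV)
qed

text \<open>The predicates for the two algebras are built along the same recursion; that keeps the
  defining ring formula common to both.\<close>

lemma hf_form_definable:
  fixes X :: "'x set" and Y :: "'y set" and \<phi> :: hf_form
  assumes inf: "infinite (UNIV :: 'k::field set)" "infinite (UNIV :: 'l::field set)"
  shows "\<exists>(P :: (nat \<Rightarrow> ('x, 'k) ncp) \<Rightarrow> _) (Q :: (nat \<Rightarrow> ('y, 'l) ncp) \<Rightarrow> _).
    rng_definable (free_alg X) (free_alg Y) P Q \<and> form_ok X P \<phi> \<and> form_ok Y Q \<phi>"
proof -
  let ?D = "rng_definable (free_alg X :: ('x, 'k) ncp set) (free_alg Y :: ('y, 'l) ncp set)"
  have pair: "\<exists>(P1 :: ('x, 'k) ncp \<Rightarrow> _) P2 (Q1 :: ('y, 'l) ncp \<Rightarrow> _) Q2.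
      hterm_ok X P1 s \<and> hterm_ok X P2 u \<and> hterm_ok Y Q1 s \<and> hterm_ok Y Q2 u \<and>
      ?D (hterm_pair (free_alg X) P1 P2 eqc) (hterm_pair (free_alg Y) Q1 Q2 eqc) \<and>
      ?D (hterm_pair (free_alg X) P1 P2 memc) (hterm_pair (free_alg Y) Q1 Q2 memc)" for s u
  proof -
    from hf_term_definable[OF inf, of X Y s] obtain P1 :: "('x, 'k) ncp \<Rightarrow> _" and Q1 :: "('y, 'l) ncp \<Rightarrow> _" where
      1: "?D (quaternary P1) (quaternary Q1)"
        "hterm_ok X P1 s" "hterm_ok Y Q1 s" by (elim exE conjE)
    from hf_term_definable[OF inf, of X Y u] obtain P2 :: "('x, 'k) ncp \<Rightarrow> _" and Q2 :: "('y, 'l) ncp \<Rightarrow> _" where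
      2: "?D (quaternary P2) (quaternary Q2)"
        "hterm_ok X P2 u" "hterm_ok Y Q2 u" by (elim exE conjE)
    note sub = rng.D_sub4[where P = P1 and Q = Q1, OF 1(1)] rng.D_sub4[where P = P2 and Q = Q2, OF 2(1)]
    have "?D (hterm_pair (free_alg X) P1 P2 eqc) (hterm_pair (free_alg Y) Q1 Q2 eqc)"
      unfolding hterm_pair_def[abs_def] by (intro rng_intros sub D_eqc)
    moreover have "?D (hterm_pair (free_alg X) P1 P2 memc) (hterm_pair (free_alg Y) Q1 Q2 memc)"
      unfolding hterm_pair_def[abs_def] by (intro rng_intros sub D_memc)
    ultimately show ?thesis using 1(2,3) 2(2,3) by blast
  qed
  show ?thesis
  proof (induction \<phi>)
    case (HEq s u)
    from pair[of s u] show ?case using form_ok_HEq[OF inf(1)] form_ok_HEq[OF inf(2)] by meson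
  next
    case (HMem s u)
    from pair[of s u] show ?case using form_ok_HMem[OF inf(1)] form_ok_HMem[OF inf(2)] by meson
  next
    case (HNot \<phi>)
    then show ?case using form_ok_HNot rng.D_not by meson
  next
    case (HAnd \<phi> \<psi>)
    from HAnd.IH(1) obtain P1 Q1 where 1: "?D P1 Q1" "form_ok X P1 \<phi>" "form_ok Y Q1 \<phi>" by blast
    from HAnd.IH(2) obtain P2 Q2 where 2: "?D P2 Q2" "form_ok X P2 \<psi>" "form_ok Y Q2 \<psi>" by blast
    show ?case using rng.D_and[OF 1(1) 2(1)] form_ok_HAnd[OF 1(2) 2(2)] form_ok_HAnd[OF 1(3) 2(3)] by blast
  next
    case (HExF n \<phi>)
    then obtain P Q where PQ: "?D P Q" "form_ok X P \<phi>" "form_ok Y Q \<phi>" by blast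
    show ?case
      using rng.D_upd[OF rng.D_and[OF D_ksc PQ(1)], where n = "5 * n + 1"] form_ok_HExF[OF PQ(2)] form_ok_HExF[OF PQ(3)]
      by blast
  next
    case (HExS n \<phi>)
    then obtain P Q where PQ: "?D P Q" "form_ok X P \<phi>" "form_ok Y Q \<phi>" by blast
    have "?D (\<lambda>r. valid_at (free_alg X) n r \<and> P r) (\<lambda>r. valid_at (free_alg Y) n r \<and> Q r)"
      unfolding valid_at_def by (rule rng.D_and[OF D_validc PQ(1)])
    from rng.D_upd[OF rng.D_upd[OF rng.D_upd[OF rng.D_upd[OF this, where n = "5 * n + 5"],
        where n = "5 * n + 4"], where n = "5 * n + 3"], where n = "5 * n + 2"]
    show ?case using form_ok_HExS[OF inf(1) PQ(2)] form_ok_HExS[OF inf(2) PQ(3)] by blast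
  qed
qed

section \<open>Evaluating translated sentences at a definable environment\<close>

lemma hf_models_sentence:
  assumes "hf_sentence \<phi>"
  shows "hf_models (UNIV :: 'k::field set) \<phi> \<longleftrightarrow> hf_sat (UNIV :: 'k set) e h \<phi>"
proof -
  have "hf_sat (UNIV :: 'k set) e' h' \<phi> = hf_sat UNIV e h \<phi>" for e' h'
    using assms by (intro hf_sat_cong) (simp_all add: hf_sentence_def)
  then show ?thesis unfolding hf_models_def HF_UNIV by blast
qed

text \<open>Correctness of a translation is known only at environments of valid codes, so one is
  built from t alone. Here t t = t P(t) with P = x, whose only root is 0; together with F = G = 0
  this codes the relation {(0, 0)}, and its node 0 is the atom 0.\<close>

lemma (in theta_elem) codes_zero:
  "codes (\<lambda>i. if i = 0 then t else if i mod 5 = 2 then t * t else 0) (\<lambda>_. 0) (\<lambda>_. Atom 0)"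
proof -
  have ev: "t * t = t * ev t [:0, 1:]" "0 = t * ev t 0" by (simp_all add: sc_1)
  have "rlcode A t (t * t) 0 0" unfolding rlcode_ev using ev by blast
  moreover have "relof (t * t) 0 0 = {(0, 0)}"
    using relof_ev[of "[:0, 1:]" 0 0] unfolding ev[symmetric] by auto
  ultimately have "code (t * t) 0 0 0 (Atom 0)"
    by (auto simp: code_def den_Atom_iff intro!: exI[of _ 0])
  moreover have "(5 * n + 3) mod 5 = 3" "(5 * n + 4) mod 5 = 4" "(5 * n + 5) mod 5 = 0" "(5 * n + 1) mod 5 = 1" 
    "(5 * n + 2) mod 5 = 2" for n :: nat
    by presburger+
  moreover have "range (\<lambda>i::nat. if i = 0 then t else if i mod 5 = 2 then t * t else 0) \<subseteq> A"
    using tA free_alg_mult[OF tA tA] free_alg_zero by auto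
  ultimately show ?thesis unfolding codes_def by simp
qed

text \<open>Collapses the infinite environment of \<open>codes_zero\<close> to three ring variables:
  2 for t, 1 for t t and 0 for zero.\<close>

definition zero_env :: "nat \<Rightarrow> nat" where
  "zero_env i = (if i = 0 then 2 else if i mod 5 = 2 then 1 else 0)"

definition at_zero_codes :: "'a::ring set \<Rightarrow> ((nat \<Rightarrow> 'a) \<Rightarrow> bool) \<Rightarrow> (nat \<Rightarrow> 'a) \<Rightarrow> bool" where
  "at_zero_codes A P e \<longleftrightarrow> theta A (e 2) \<and> e 1 = e 2 * e 2 \<and> e 0 = 0 \<and> P (\<lambda>i. e (zero_env i))"

definition ex_zero_codes :: "'a::ring set \<Rightarrow> ((nat \<Rightarrow> 'a) \<Rightarrow> bool) \<Rightarrow> (nat \<Rightarrow> 'a) \<Rightarrow> bool" where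
  "ex_zero_codes A P e \<longleftrightarrow> (\<exists>t\<in>A. \<exists>u\<in>A. \<exists>z\<in>A. at_zero_codes A P (e(2 := t, 1 := u, 0 := z)))"

theorem hf_elem_equiv_if_rng_elem_equiv:
  fixes X :: "'x set" and Y :: "'y set"
  assumes inf: "infinite (UNIV :: 'k::field set)" "infinite (UNIV :: 'l::field set)"
    and ne: "X \<noteq> {}" "Y \<noteq> {}"
    and eq: "rng_elem_equiv (free_alg X :: ('x, 'k) ncp set) (free_alg Y :: ('y, 'l) ncp set)"
  shows "hf_elem_equiv (UNIV :: 'k set) (UNIV :: 'l set)"
  unfolding hf_elem_equiv_def
proof (intro allI impI)
  fix \<phi> assume \<phi>: "hf_sentence \<phi>"
  let ?A = "free_alg X :: ('x, 'k) ncp set" and ?B = "free_alg Y :: ('y, 'l) ncp set"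
  let ?D = "rng_definable ?A ?B"
  obtain P Q where PQ: "?D P Q" "form_ok X P \<phi>" "form_ok Y Q \<phi>"
    using hf_form_definable[OF inf, of X Y \<phi>] by blast
  have "?D (\<lambda>e. at_zero_codes ?A P e) (\<lambda>e. at_zero_codes ?B Q e)"
    unfolding at_zero_codes_def by (intro rng_intros D_theta rng.D_ren[OF PQ(1)])
  from rng.D_upd[OF rng.D_upd[OF rng.D_upd[OF this, where n = 0], where n = 1], where n = 2]
  have D: "?D (\<lambda>e. ex_zero_codes ?A P e) (\<lambda>e. ex_zero_codes ?B Q e)" unfolding ex_zero_codes_def .
  have sem: "ex_zero_codes (free_alg Z) S e \<longleftrightarrow> hf_models (UNIV :: 'm set) \<phi>"
    if Z: "Z \<noteq> {}" and S: "form_ok Z S \<phi>" for Z :: "'z set" and S :: "(nat \<Rightarrow> ('z, 'm::field) ncp) \<Rightarrow> bool" and e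
  proof -
    let ?C = "free_alg Z :: ('z, 'm) ncp set"
    have env: "(\<lambda>i. (e(2 := t, 1 := t * t, 0 := 0)) (zero_env i)) = (\<lambda>i. if i = 0 then t else if i mod 5 = 2 then t * t else 0)" for t
      by (auto simp: zero_env_def fun_eq_iff)
    have S': "S (\<lambda>i. if i = 0 then t else if i mod 5 = 2 then t * t else 0) \<longleftrightarrow> hf_models (UNIV :: 'm set) \<phi>"
      if "theta ?C t" "t \<in> ?C" for t
    proof -
      have t: "theta_elem Z t" using that by (simp add: theta_elem_def)
      show ?thesis
        unfolding hf_models_sentence[OF \<phi>, of "\<lambda>_. 0" "\<lambda>_. Atom 0"]
        by (rule form_okD[OF S t theta_elem.codes_zero[OF t]])
    qed
    obtain z where "z \<in> Z" using Z by blast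
    then have t0: "theta ?C (single [z] 1)" "single [z] 1 \<in> ?C" by (simp_all add: theta_letter)
    have "ex_zero_codes ?C S e \<longleftrightarrow> (\<exists>t\<in>?C. \<exists>u\<in>?C. \<exists>z\<in>?C. theta ?C t \<and> u = t * t \<and> z = 0 \<and>
        S (\<lambda>i. (e(2 := t, 1 := u, 0 := z)) (zero_env i)))"
      unfolding ex_zero_codes_def at_zero_codes_def by simp
    also have "\<dots> \<longleftrightarrow> (\<exists>t\<in>?C. theta ?C t \<and> S (\<lambda>i. (e(2 := t, 1 := t * t, 0 := 0)) (zero_env i)))"
      using free_alg_mult free_alg_zero by blast
    \<comment> \<open>The truth value no longer depends on t, so a letter discharges the existential
      quantifier next.\<close>
    also have "\<dots> \<longleftrightarrow> (\<exists>t\<in>?C. theta ?C t \<and> hf_models (UNIV :: 'm set) \<phi>)"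
      unfolding env using S' by blast
    also have "\<dots> \<longleftrightarrow> hf_models (UNIV :: 'm set) \<phi>" using t0 by blast
    finally show ?thesis .
  qed
  have "?D (\<lambda>_. hf_models (UNIV :: 'k set) \<phi>) (\<lambda>_. hf_models (UNIV :: 'l set) \<phi>)"
    using D unfolding sem[OF ne(1) PQ(2)] sem[OF ne(2) PQ(3)] .
  then show "hf_models (UNIV :: 'k set) \<phi> \<longleftrightarrow> hf_models (UNIV :: 'l set) \<phi>"
    by (rule rng_elem_equiv_const[OF eq]) (use free_alg_zero in blast)+
qed

section \<open>The number of generators\<close>

text \<open>Unfolds to r = \<Sum> (c_j a_j + t a_j b_j) with each c_j in K t, that is, to t times a
  combination of the a_j with scalars and right multipliers. There is one formula for each
  n.\<close>

primrec gen :: "'a::ring set \<Rightarrow> 'a \<Rightarrow> nat \<Rightarrow> (nat \<Rightarrow> 'a) \<Rightarrow> 'a \<Rightarrow> bool" where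
  "gen A t 0 a r \<longleftrightarrow> r = 0"
| "gen A t (Suc n) a r \<longleftrightarrow> (\<exists>c\<in>A. \<exists>b\<in>A. \<exists>s\<in>A. c \<in> ksc A t \<and> gen A t n a s \<and> r = c * a n + t * a n * b + s)"

text \<open>With \<open>t\<close> acting as a placeholder for the unit, this says that every element is a sum of
  scalar and right multiples of \<open>n\<close> fixed elements.\<close>

definition gens :: "'a::ring set \<Rightarrow> nat \<Rightarrow> bool" where
  "gens A n \<longleftrightarrow> (\<exists>t\<in>A. theta A t \<and> (\<exists>a. range a \<subseteq> A \<and> (\<forall>p\<in>A. \<exists>r\<in>A. r = t * p \<and> gen A t n a r)))"

lemma gen_cong: "(\<And>j. j < n \<Longrightarrow> a j = b j) \<Longrightarrow> gen A t n a r = gen A t n b r"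
  by (induction n arbitrary: r) auto

lemma D_gen: "rng_definable A B (\<lambda>e. gen A (e i) n (\<lambda>j. e (f j)) (e m)) (\<lambda>e. gen B (e i) n (\<lambda>j. e (f j)) (e m))"
proof (induction n arbitrary: i f m)
  case 0
  show ?case unfolding gen.simps by (intro rng_intros)
next
  case (Suc n)
  show ?case unfolding gen.simps by (intro rng_intros D_ksc Suc.IH)
qed

text \<open>Variables below n hold the tuple and variable n holds t, the layout that
  \<open>D_block\<close> quantifies.\<close>

definition gens_body :: "nat \<Rightarrow> 'a::ring set \<Rightarrow> (nat \<Rightarrow> 'a) \<Rightarrow> bool" where
  "gens_body n A e \<longleftrightarrow> (\<forall>p\<in>A. \<exists>r\<in>A. r = e n * p \<and> gen A (e n) n (\<lambda>j. e j) r)"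

definition gens_matrix :: "nat \<Rightarrow> 'a::ring set \<Rightarrow> (nat \<Rightarrow> 'a) \<Rightarrow> bool" where
  "gens_matrix n A e \<longleftrightarrow> theta A (e n) \<and> (\<exists>a. range a \<subseteq> A \<and> gens_body n A (\<lambda>j. if j < n then a j else e j))"

lemma D_gens: "rng_definable A B (\<lambda>_. gens A n) (\<lambda>_. gens B n)"
proof -
  have "rng_definable A B (gens_body n A) (gens_body n B)"
    unfolding gens_body_def[abs_def] by (intro rng_intros D_gen)
  from rng.D_block[OF this, of n] have "rng_definable A B (gens_matrix n A) (gens_matrix n B)"
    unfolding gens_matrix_def[abs_def] by (intro rng_intros D_theta)
  from rng.D_upd[OF this, of n]
  show ?thesis
  proof (rule rng.D_cong)
    have eq: "(\<exists>t\<in>C. gens_matrix n C (e(n := t))) = gens C n" for C :: "'c::ring set" and e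
    proof -
      have "gen C t n (\<lambda>j. if j < n then a j else (e(n := t)) j) r = gen C t n a r" for t a r
        by (rule gen_cong) simp
      then show ?thesis unfolding gens_matrix_def gens_body_def gens_def by simp
    qed
    show "(\<exists>t\<in>A. gens_matrix n A (e(n := t))) = gens A n" for e by (rule eq)
    show "(\<exists>t\<in>B. gens_matrix n B (e(n := t))) = gens B n" for e by (rule eq)
  qed
qed

section \<open>Letters generate, and the space of linear forms bounds the number of
  generators\<close>

lemma (in theta_elem) gen_intro:
  assumes "\<And>j. a j \<in> A" "\<And>j. b j \<in> A"
  shows "t * (\<Sum>j<n. sc (\<alpha> j) * a j + a j * b j) \<in> A \<and> gen A t n a (t * (\<Sum>j<n. sc (\<alpha> j) * a j + a j * b j))"
proof (induction n)
  case 0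
  show ?case by (simp add: free_alg_zero)
next
  case (Suc n)
  let ?s = "\<lambda>n. t * (\<Sum>j<n. sc (\<alpha> j) * a j + a j * b j)"
  have eq: "?s (Suc n) = sc (\<alpha> n) * t * a n + t * a n * b n + ?s n"
    by (simp add: distrib_left sc_left_commute[of t] mult.assoc add_ac)
  have "sc (\<alpha> n) * t \<in> ksc A t" by (simp add: ksc_eq)
  then have "gen A t (Suc n) a (?s (Suc n))"
    unfolding gen.simps eq using Suc.IH assms(2)[of n] sc_t_in[of "\<alpha> n"] by blast
  moreover have "?s (Suc n) \<in> A"
    unfolding eq using Suc.IH
    by (intro free_alg_add[OF free_alg_add[OF free_alg_mult free_alg_mult[OF free_alg_mult]]] sc_t_in tA assms) simp
  ultimately show ?case by blast
qed

lemma (in theta_elem) gen_elim: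
  assumes "\<And>j. a j \<in> A"
  shows "gen A t n a r \<Longrightarrow> \<exists>\<alpha> b. (\<forall>j. b j \<in> A) \<and> r = t * (\<Sum>j<n. sc (\<alpha> j) * a j + a j * b j)"
proof (induction n arbitrary: r)
  case 0
  then show ?case by (intro exI[of _ "\<lambda>_. 0"]) (simp add: free_alg_zero)
next
  case (Suc n)
  then obtain c b' s where c: "b' \<in> A" "c \<in> ksc A t" "gen A t n a s" "r = c * a n + t * a n * b' + s" by auto
  obtain \<beta> where \<beta>: "c = sc \<beta> * t" using c(2) ksc_eq by blast
  obtain \<alpha> b where ab: "\<forall>j. b j \<in> A" "s = t * (\<Sum>j<n. sc (\<alpha> j) * a j + a j * b j)" using Suc.IH[OF c(3)] by blast
  have "r = t * (\<Sum>j<Suc n. sc ((\<alpha>(n := \<beta>)) j) * a j + a j * (b(n := b')) j)"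
    by (simp add: c(4) \<beta> ab(2) distrib_left sc_left_commute[of t] mult.assoc add_ac)
  moreover have "\<forall>j. (b(n := b')) j \<in> A" using ab(1) c(1) by simp
  ultimately show ?case by blast
qed

text \<open>The letters generate because p is the sum of x * \<open>lder x p\<close>. The constant
  term of \<open>lder x p\<close> becomes the scalar coefficient of x, and the rest is a right
  multiplier within the algebra.\<close>

lemma gens_card:
  fixes X :: "'x set"
  assumes "finite X" "X \<noteq> {}"
  shows "gens (free_alg X :: ('x, 'k::field) ncp set) (card X)"
proof -
  let ?A = "free_alg X :: ('x, 'k) ncp set"
  define n where "n = card X"
  obtain h where h: "bij_betw h {0..<n} X" unfolding n_def using ex_bij_betw_nat_finite[OF assms(1)] by blast
  obtain z where "z \<in> X" using assms(2) by blast
  define t where "t = (single [z] 1 :: ('x, 'k) ncp)"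
  have t: "theta ?A t" "t \<in> ?A" using theta_letter[OF \<open>z \<in> X\<close>] by (simp_all add: t_def)
  interpret theta_elem X t by unfold_locales (use t in simp_all)
  define a where "a j = (if j < n then single [h j] 1 else 0 :: ('x, 'k) ncp)" for j
  have hX: "h j \<in> X" if "j < n" for j using h that by (auto simp: bij_betw_def)
  have aA: "a j \<in> A" for j using theta_letter(2)[OF hX[of j], where 'k = 'k] by (simp add: a_def free_alg_zero)
  have "\<exists>r\<in>A. r = t * p \<and> gen A t n a r" if p: "p \<in> A" for p
  proof -
    define \<alpha> where "\<alpha> j = lookup p [h j]" for j
    define b where "b j = (if j < n then lder (h j) p - sc (\<alpha> j) else 0)" for j
    have bA: "b j \<in> A" for j
      using p unfolding free_alg_iff b_def by (auto simp: lookup_minus lookup_single when_def \<alpha>_def split: if_splits)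
    have summand: "sc (\<alpha> j) * a j + a j * b j = single [h j] 1 * lder (h j) p" if "j < n" for j
      using that by (simp add: a_def b_def right_diff_distrib sc_commute)
    have "p = (\<Sum>j<n. sc (\<alpha> j) * a j + a j * b j)"
    proof (rule poly_mapping_eqI)
      fix w
      have "lookup (\<Sum>j<n. sc (\<alpha> j) * a j + a j * b j) w = (\<Sum>j<n. lookup (single [h j] 1 * lder (h j) p) w)"
        unfolding lookup_sum using summand by (intro sum.cong) auto
      also have "\<dots> = lookup p w"
      proof (cases w)
        case Nil
        then show ?thesis using p by (auto simp: lookup_single_Cons_mult free_alg_iff)
      next
        case (Cons y v)
        have "(\<Sum>j<n. lookup (single [h j] 1 * lder (h j) p) w) = (\<Sum>j\<in>{0..<n}. (\<lambda>x. if y = x then lookup p w else 0) (h j))"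
          unfolding Cons by (intro sum.cong) (auto simp: lookup_single_Cons_mult)
        also have "\<dots> = (\<Sum>x\<in>X. if y = x then lookup p w else 0)"
          by (rule sum.reindex_bij_betw[OF h])
        also have "\<dots> = (if y \<in> X then lookup p w else 0)"
          using assms(1) by simp
        also have "\<dots> = lookup p w" using p Cons by (auto simp: free_alg_iff)
        finally show ?thesis .
      qed
      finally show "lookup p w = lookup (\<Sum>j<n. sc (\<alpha> j) * a j + a j * b j) w" by simp
    qed
    then show ?thesis using gen_intro[where a = a and b = b and n = n and \<alpha> = \<alpha>, OF aA bA] by auto
  qed
  moreover have "range a \<subseteq> A" using aA by blast
  ultimately show ?thesis unfolding gens_def n_def using t by blast
qed

interpretation sc_space: vector_space "\<lambda>c p. sc c * (p :: ('x, 'k::field) ncp)"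
  by unfold_locales (simp_all add: distrib_left distrib_right single_add sc_1 sc_mult_sc flip: mult.assoc)

text \<open>Products a_j b_j have no words of length below 2. Comparing linear parts, every letter
  is a scalar combination of the linear parts of the a_j, and the letters are linearly
  independent.\<close>

lemma card_le_if_gens:
  fixes X :: "'x set"
  assumes "finite X" "gens (free_alg X :: ('x, 'k::field) ncp set) n"
  shows "card X \<le> n"
proof -
  obtain t a where t: "t \<in> (free_alg X :: ('x, 'k) ncp set)" "theta (free_alg X) t"
    and a: "range a \<subseteq> free_alg X" and gen: "\<And>p. p \<in> free_alg X \<Longrightarrow> gen (free_alg X) t n a (t * p)"
    using assms(2) unfolding gens_def by blast
  interpret theta_elem X t by unfold_locales (use t in simp_all)
  have aA: "a j \<in> A" for j using a by auto
  define lin where "lin p = (\<Sum>y\<in>X. sc (lookup p [y]) * single [y] 1)" for p :: "('x, 'k) ncp"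
  have lin: "lookup (lin p) w = (if \<exists>y\<in>X. w = [y] then lookup p w else 0)" for p w
  proof -
    have "lookup (lin p) w = (\<Sum>y\<in>X. if w = [y] then lookup p w else 0)"
      unfolding lin_def lookup_sum lookup_sc_mult by (intro sum.cong) (auto simp: lookup_single when_def)
    also have "\<dots> = (if \<exists>y\<in>X. w = [y] then lookup p w else 0)"
    proof (cases "\<exists>y\<in>X. w = [y]")
      case True
      then obtain y where "y \<in> X" "w = [y]" by blast
      then show ?thesis using assms(1) by simp
    next
      case False
      then show ?thesis by (simp add: sum.neutral)
    qed
    finally show ?thesis .
  qed
  define E where "E = (\<lambda>x. single [x] (1 :: 'k)) ` X"
  define V where "V = (\<lambda>j. lin (a j)) ` {..<n}"
  have "E \<subseteq> sc_space.span V"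
  proof
    fix e assume "e \<in> E"
    then obtain x where x: "x \<in> X" "e = single [x] 1" by (auto simp: E_def)
    have "e \<in> A" using theta_letter(2)[OF x(1)] x(2) by simp
    from gen_elim[OF aA gen[OF this]]
    obtain \<alpha> b where b: "\<forall>j. b j \<in> A" "t * e = t * (\<Sum>j<n. sc (\<alpha> j) * a j + a j * b j)"
      by blast
    then have e: "e = (\<Sum>j<n. sc (\<alpha> j) * a j + a j * b j)" by (simp add: free_mult_left_cancel[OF t0])
    have Nil: "lookup p [] = 0" if "p \<in> A" for p using that by (auto simp: free_alg_iff)
    \<comment> \<open>Both cuts of a one-letter word leave the empty word on one side, where the
      corresponding factor vanishes.\<close>
    have "lookup (a j * b j) [y] = 0" for j y
      using Nil[OF aA] Nil[of "b j"] b(1) by (simp add: lookup_mult_list atMost_Suc)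
    then have ly: "lookup e [y] = (\<Sum>j<n. \<alpha> j * lookup (a j) [y])" for y
      using e by (simp add: lookup_sum lookup_add lookup_sc_mult)
    have "e = (\<Sum>j<n. sc (\<alpha> j) * lin (a j))"
    proof (rule poly_mapping_eqI)
      fix w
      show "lookup e w = lookup (\<Sum>j<n. sc (\<alpha> j) * lin (a j)) w"
      proof (cases "\<exists>y\<in>X. w = [y]")
        case True
        then show ?thesis using ly by (auto simp: lookup_sum lookup_sc_mult lin)
      next
        case False
        then have "w \<noteq> [x]" using x(1) by blast
        then show ?thesis using False x(2) by (simp add: lookup_sum lookup_sc_mult lin lookup_single when_def)
      qed
    qed
    moreover have "(\<Sum>j<n. sc (\<alpha> j) * lin (a j)) \<in> sc_space.span V"
      by (intro sc_space.span_sum sc_space.span_scale sc_space.span_base) (simp add: V_def)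
    ultimately show "e \<in> sc_space.span V" by simp
  qed
  moreover have inj: "inj_on (\<lambda>x. single [x] (1 :: 'k)) X"
    by (rule inj_onI) (metis list.inject lookup_single_eq lookup_single_not_eq zero_neq_one)
  have "sc_space.independent E"
  proof
    assume "sc_space.dependent E"
    moreover have "finite E" using assms(1) by (simp add: E_def)
    ultimately obtain u v where uv: "v \<in> E" "u v \<noteq> 0" "(\<Sum>v\<in>E. sc (u v) * v) = 0"
      unfolding sc_space.dependent_finite[OF \<open>finite E\<close>] by blast
    obtain x where x: "x \<in> X" "v = single [x] 1" using uv(1) by (auto simp: E_def)
    have "0 = lookup (\<Sum>y\<in>X. sc (u (single [y] 1)) * single [y] 1) [x]"
      using uv(3) unfolding E_def sum.reindex[OF inj] by simp
    also have "\<dots> = (\<Sum>y\<in>X. if y = x then u v else 0)"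
      unfolding lookup_sum lookup_sc_mult using x by (intro sum.cong) (auto simp: lookup_single when_def)
    also have "\<dots> = u v" using x(1) assms(1) by simp
    finally show False using uv(2) by simp
  qed
  ultimately have "card E \<le> card V"
    using sc_space.independent_span_bound[of V E] by (simp add: V_def)
  moreover have "card E = card X" unfolding E_def by (rule card_image[OF inj])
  moreover have "card V \<le> n" unfolding V_def using card_image_le[of "{..<n}"] by simp
  ultimately show ?thesis by simp
qed

theorem card_eq_if_rng_elem_equiv:
  fixes X :: "'x set" and Y :: "'y set"
  assumes "finite X" "X \<noteq> {}" "finite Y" "Y \<noteq> {}"
    and eq: "rng_elem_equiv (free_alg X :: ('x, 'k::field) ncp set) (free_alg Y :: ('y, 'l::field) ncp set)"
  shows "card X = card Y"
proof -
  have "gens (free_alg X :: ('x, 'k) ncp set) n = gens (free_alg Y :: ('y, 'l) ncp set) n" for n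
    by (rule rng_elem_equiv_const[OF eq D_gens]) (use free_alg_zero in blast)+
  then show ?thesis
    using gens_card[OF assms(1,2), where 'k = 'k] gens_card[OF assms(3,4), where 'k = 'l]
      card_le_if_gens[OF assms(1), where 'k = 'k] card_le_if_gens[OF assms(3), where 'k = 'l]
    by (metis le_antisym)
qed

section \<open>Interpreting the free algebra in hereditarily finite sets\<close>

lemma hf_D_Ex:
  assumes "hf_definable TYPE('k::field) TYPE('l::field) (unary P) (unary Q)"
  shows "hf_definable TYPE('k) TYPE('l) (\<lambda>e. \<exists>a. P a e) (\<lambda>e. \<exists>b. Q b e)"
  using hf.D_Bex[where P = P and Q = Q, OF assms] by simp

lemma hf_D_All:
  assumes "hf_definable TYPE('k::field) TYPE('l::field) (unary P) (unary Q)"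
  shows "hf_definable TYPE('k) TYPE('l) (\<lambda>e. \<forall>a. P a e) (\<lambda>e. \<forall>b. Q b e)"
  using hf.D_Ball[where P = P and Q = Q, OF assms] by simp

definition atom_add :: "'k::field hf \<Rightarrow> 'k hf \<Rightarrow> 'k hf \<Rightarrow> bool" where
  "atom_add x y z \<longleftrightarrow> (\<exists>a b. x = Atom a \<and> y = Atom b \<and> z = Atom (a + b))"

lemma hf_D_atom_add:
  "hf_definable TYPE('k::field) TYPE('l::field) (\<lambda>e. atom_add (e i) (e j) (e k)) (\<lambda>e. atom_add (e i) (e j) (e k))"
  unfolding hf_definable_def atom_add_def
  by (rule exI[of _ "HExF 0 (HExF 1 (HAnd (HEq (HVar i) (HElem (FVar 0))) (HAnd (HEq (HVar j) (HElem (FVar 1)))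
      (HEq (HVar k) (HElem (FAdd (FVar 0) (FVar 1)))))))"]) simp

definition is_empty :: "'k hf \<Rightarrow> bool" where
  "is_empty x \<longleftrightarrow> \<not> is_atom x \<and> (\<forall>z. \<not> hf_mem z x)"

definition is_upair :: "'k hf \<Rightarrow> 'k hf \<Rightarrow> 'k hf \<Rightarrow> bool" where
  "is_upair p a b \<longleftrightarrow> \<not> is_atom p \<and> (\<forall>z. hf_mem z p \<longleftrightarrow> z = a \<or> z = b)"

definition is_pr :: "'k hf \<Rightarrow> 'k hf \<Rightarrow> 'k hf \<Rightarrow> bool" where
  "is_pr p a b \<longleftrightarrow> (\<exists>u v. is_upair u a a \<and> is_upair v a b \<and> is_upair p u v)"

text \<open>Zermelo numerals, which serve as letters. Their number is external, so each size of the
  alphabet has its own formulas.\<close>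

primrec is_num :: "nat \<Rightarrow> 'k hf \<Rightarrow> bool" where
  "is_num 0 x \<longleftrightarrow> is_empty x"
| "is_num (Suc n) x \<longleftrightarrow> (\<exists>y. is_num n y \<and> is_upair x y y)"

primrec is_letter :: "nat \<Rightarrow> 'k hf \<Rightarrow> bool" where
  "is_letter 0 x \<longleftrightarrow> False"
| "is_letter (Suc n) x \<longleftrightarrow> is_letter n x \<or> is_num n x"

text \<open>Words are iterated pairs. The finite witness M contains the tail of each of its
  non-empty elements; as membership is well-founded, the tails can end only in the empty
  word.\<close>

definition is_word :: "nat \<Rightarrow> 'k hf \<Rightarrow> bool" where
  "is_word n w \<longleftrightarrow> (\<exists>M. hf_mem w M \<and>
     (\<forall>u. hf_mem u M \<longrightarrow> is_empty u \<or> (\<exists>i v. is_letter n i \<and> hf_mem v M \<and> is_pr u i v)))"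

text \<open>Only the support is stored, so a word without an entry receives the default coefficient
  0.\<close>

definition is_val :: "'k::field hf \<Rightarrow> 'k hf \<Rightarrow> 'k hf \<Rightarrow> bool" where
  "is_val p w c \<longleftrightarrow> (\<exists>z. is_pr z w c \<and> hf_mem z p) \<or> c = Atom 0 \<and> \<not> (\<exists>z d. is_pr z w d \<and> hf_mem z p)"

text \<open>Zero coefficients are forbidden to make codes unique, so that equality of polynomials is
  equality of sets.\<close>

definition is_poly :: "nat \<Rightarrow> 'k::field hf \<Rightarrow> bool" where
  "is_poly n p \<longleftrightarrow> \<not> is_atom p \<and>
     (\<forall>z. hf_mem z p \<longrightarrow> (\<exists>w c. is_pr z w c \<and> is_word n w \<and> is_atom c \<and> \<not> c = Atom 0)) \<and>
     (\<forall>w c d z z'. is_pr z w c \<and> is_pr z' w d \<and> hf_mem z p \<and> hf_mem z' p \<longrightarrow> c = d)"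

text \<open>Derivatives arising in the recursion for products may have a constant term;
  \<open>is_poly\<close> therefore covers the unital algebra and \<open>is_elem\<close> cuts out the
  elements proper.\<close>

definition is_elem :: "nat \<Rightarrow> 'k::field hf \<Rightarrow> bool" where
  "is_elem n p \<longleftrightarrow> is_poly n p \<and> \<not> (\<exists>z c w. is_empty w \<and> is_pr z w c \<and> hf_mem z p)"

definition is_sum :: "nat \<Rightarrow> 'k::field hf \<Rightarrow> 'k hf \<Rightarrow> 'k hf \<Rightarrow> bool" where
  "is_sum n p q r \<longleftrightarrow> (\<forall>w a b c. is_word n w \<and> is_val p w a \<and> is_val q w b \<and> is_val r w c \<longrightarrow> atom_add a b c)"

definition is_lder :: "nat \<Rightarrow> 'k::field hf \<Rightarrow> 'k hf \<Rightarrow> 'k hf \<Rightarrow> bool" where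
  "is_lder n i p p' \<longleftrightarrow> (\<forall>w v a b. is_word n w \<and> is_pr v i w \<and> is_val p' w a \<and> is_val p v b \<longrightarrow> a = b)"

definition is_const_prod :: "'k::field hf \<Rightarrow> 'k hf \<Rightarrow> 'k hf \<Rightarrow> bool" where
  "is_const_prod p q r \<longleftrightarrow> (\<forall>w a b c z. is_empty w \<and> is_val p w a \<and> is_val q w b \<and> is_val r w c \<and> z = Atom 0 \<longrightarrow>
     atom_muladd z a b c)"

text \<open>The Leibniz rule \<open>\<partial>\<^sub>i (p q) = (\<partial>\<^sub>i p) q + p(0) \<partial>\<^sub>i q\<close>, with \<open>r = p q\<close> and \<open>r' = (\<partial>\<^sub>i p) q\<close>.\<close>

definition is_leibniz :: "nat \<Rightarrow> 'k::field hf \<Rightarrow> 'k hf \<Rightarrow> 'k hf \<Rightarrow> 'k hf \<Rightarrow> 'k hf \<Rightarrow> bool" where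
  "is_leibniz n i p q r r' \<longleftrightarrow> (\<forall>w v u a b c d. is_word n w \<and> is_pr v i w \<and> is_empty u \<and>
     is_val r v d \<and> is_val r' w a \<and> is_val p u b \<and> is_val q v c \<longrightarrow> atom_muladd a b c d)"

definition is_step :: "nat \<Rightarrow> 'k::field hf \<Rightarrow> 'k hf \<Rightarrow> 'k hf \<Rightarrow> 'k hf \<Rightarrow> bool" where
  "is_step n q M p r \<longleftrightarrow> is_const_prod p q r \<and> (\<forall>i. is_letter n i \<longrightarrow>
     (\<exists>p' r' z. is_pr z p' r' \<and> hf_mem z M \<and> is_lder n i p p' \<and> is_leibniz n i p q r r'))"

text \<open>M tabulates pairs (s, s q) for the fixed right factor q. The recursion stops at s = 0,
  whose product must be 0; it gets there because derivatives shorten words.\<close>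

definition is_prod :: "nat \<Rightarrow> 'k::field hf \<Rightarrow> 'k hf \<Rightarrow> 'k hf \<Rightarrow> bool" where
  "is_prod n p q r \<longleftrightarrow> (\<exists>M. (\<exists>z. is_pr z p r \<and> hf_mem z M) \<and>
     (\<forall>z p r. is_pr z p r \<and> hf_mem z M \<longrightarrow> is_poly n p \<and> is_poly n r \<and> (is_empty p \<and> is_empty r \<or> \<not> is_empty p \<and> is_step n q M p r)))"

subsection \<open>Definability\<close>

lemmas hf_intros = hf.D_not hf.D_and hf.D_or hf.D_imp hf.D_iff hf.D_True hf.D_False hf_D_Ex hf_D_All
  hf.D_var_eq hf_definable_mem hf_definable_is_atom hf_definable_atom_zero hf_definable_atom_muladd hf_D_atom_add

context
  fixes K :: "'k::field itself" and L :: "'l::field itself"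
begin

abbreviation "HD \<equiv> hf_definable TYPE('k) TYPE('l)"

lemma D_empty: "HD (\<lambda>e. is_empty (e i)) (\<lambda>e. is_empty (e i))"
  unfolding is_empty_def by (intro hf_intros)

lemma D_upair: "HD (\<lambda>e. is_upair (e i) (e j) (e k)) (\<lambda>e. is_upair (e i) (e j) (e k))"
  unfolding is_upair_def by (intro hf_intros)

lemma D_pr: "HD (\<lambda>e. is_pr (e i) (e j) (e k)) (\<lambda>e. is_pr (e i) (e j) (e k))"
  unfolding is_pr_def by (intro hf_intros D_upair)

lemma D_num: "HD (\<lambda>e. is_num n (e i)) (\<lambda>e. is_num n (e i))"
proof (induction n arbitrary: i)
  case 0
  show ?case unfolding is_num.simps by (rule D_empty)
next
  case (Suc n)
  show ?case unfolding is_num.simps by (intro hf_intros Suc.IH D_upair)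
qed

lemma D_letter: "HD (\<lambda>e. is_letter n (e i)) (\<lambda>e. is_letter n (e i))"
proof (induction n arbitrary: i)
  case 0
  show ?case unfolding is_letter.simps by (rule hf.D_False)
next
  case (Suc n)
  show ?case unfolding is_letter.simps by (intro hf_intros Suc.IH D_num)
qed

lemma D_word: "HD (\<lambda>e. is_word n (e i)) (\<lambda>e. is_word n (e i))"
  unfolding is_word_def by (intro hf_intros D_empty D_letter D_pr)

lemma D_val: "HD (\<lambda>e. is_val (e i) (e j) (e k)) (\<lambda>e. is_val (e i) (e j) (e k))"
  unfolding is_val_def by (intro hf_intros D_pr)

lemma D_poly: "HD (\<lambda>e. is_poly n (e i)) (\<lambda>e. is_poly n (e i))"
  unfolding is_poly_def by (intro hf_intros D_pr D_word)

lemma D_elem: "HD (\<lambda>e. is_elem n (e i)) (\<lambda>e. is_elem n (e i))"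
  unfolding is_elem_def by (intro hf_intros D_pr D_poly D_empty)

lemma D_sum: "HD (\<lambda>e. is_sum n (e i) (e j) (e k)) (\<lambda>e. is_sum n (e i) (e j) (e k))"
  unfolding is_sum_def by (intro hf_intros D_word D_val)

lemma D_lder: "HD (\<lambda>e. is_lder n (e i) (e j) (e k)) (\<lambda>e. is_lder n (e i) (e j) (e k))"
  unfolding is_lder_def by (intro hf_intros D_word D_val D_pr)

lemma D_const_prod: "HD (\<lambda>e. is_const_prod (e i) (e j) (e k)) (\<lambda>e. is_const_prod (e i) (e j) (e k))"
  unfolding is_const_prod_def by (intro hf_intros D_empty D_val)

lemma D_leibniz: "HD (\<lambda>e. is_leibniz n (e i) (e p) (e q) (e r) (e r')) (\<lambda>e. is_leibniz n (e i) (e p) (e q) (e r) (e r'))"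
  unfolding is_leibniz_def by (intro hf_intros D_word D_val D_pr D_empty)

lemma D_step: "HD (\<lambda>e. is_step n (e q) (e m) (e p) (e r)) (\<lambda>e. is_step n (e q) (e m) (e p) (e r))"
  unfolding is_step_def by (intro hf_intros D_const_prod D_letter D_pr D_lder D_leibniz)

lemma D_prod: "HD (\<lambda>e. is_prod n (e i) (e j) (e k)) (\<lambda>e. is_prod n (e i) (e j) (e k))"
  unfolding is_prod_def by (intro hf_intros D_pr D_poly D_empty D_step)

end

subsection \<open>Sets, pairs and words\<close>

definition hs :: "'k hf set \<Rightarrow> 'k hf" where
  "hs S = HSet (Abs_fset S)"

lemma hf_mem_hs: "finite S \<Longrightarrow> hf_mem x (hs S) \<longleftrightarrow> x \<in> S"
  by (simp add: hs_def Abs_fset_inverse)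

lemma not_is_atom_hs: "\<not> is_atom (hs S)"
  by (simp add: hs_def is_atom_def)

lemma hf_eqI:
  assumes "\<not> is_atom x" "\<not> is_atom y" "\<And>z. hf_mem z x \<longleftrightarrow> hf_mem z y"
  shows "x = y"
  using assms by (cases x; cases y) (auto simp: is_atom_def intro: fset_eqI)

lemma finite_hf_mem: "finite {z. hf_mem z x}"
  by (cases x) auto

definition upair :: "'k hf \<Rightarrow> 'k hf \<Rightarrow> 'k hf" where
  "upair a b = hs {a, b}"

definition pr :: "'k hf \<Rightarrow> 'k hf \<Rightarrow> 'k hf" where
  "pr a b = upair (upair a a) (upair a b)"

lemma is_empty_iff: "is_empty x \<longleftrightarrow> x = hs {}"
  using hf_eqI[of x "hs {}"] by (auto simp: is_empty_def hf_mem_hs not_is_atom_hs)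

lemma is_upair_iff: "is_upair p a b \<longleftrightarrow> p = upair a b"
  using hf_eqI[of p "upair a b"] by (auto simp: is_upair_def upair_def hf_mem_hs not_is_atom_hs)

lemma is_pr_iff: "is_pr p a b \<longleftrightarrow> p = pr a b"
  by (simp add: is_pr_def is_upair_iff pr_def)

lemma upair_eq_iff: "upair a b = upair c d \<longleftrightarrow> {a, b} = {c, d}"
proof
  assume "upair a b = upair c d"
  then have "hf_mem z (upair a b) = hf_mem z (upair c d)" for z by simp
  then show "{a, b} = {c, d}" by (simp add: upair_def hf_mem_hs set_eq_iff)
qed (simp add: upair_def)

lemma pr_eq_iff: "pr a b = pr c d \<longleftrightarrow> a = c \<and> b = d"
  by (auto simp: pr_def upair_eq_iff doubleton_eq_iff)

text \<open>Supplies the induction that decodes words, as the second component of a pair has smaller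
  rank, and separates the numerals. The inserted 0 keeps \<open>Max\<close> defined for the empty
  set.\<close>

primrec hf_rank :: "'k hf \<Rightarrow> nat" where
  "hf_rank (Atom a) = 0"
| "hf_rank (HSet S) = Suc (Max (fset (finsert 0 (hf_rank |`| S))))"

lemma hf_rank_mem: "hf_mem x y \<Longrightarrow> hf_rank x < hf_rank y"
  by (cases y) (auto simp: less_Suc_eq_le)

lemma hf_rank_pr: "hf_rank b < hf_rank (pr a b)"
proof -
  have "hf_mem b (upair a b)" "hf_mem (upair a b) (pr a b)"
    by (simp_all add: upair_def pr_def hf_mem_hs)
  then show ?thesis using hf_rank_mem less_trans by blast
qed

lemma pr_ne_empty: "pr a b \<noteq> hs {}"
proof
  assume "pr a b = hs {}"
  moreover have "hf_mem (upair a b) (pr a b)" by (simp add: pr_def upair_def[of "upair a a"] hf_mem_hs)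
  ultimately show False by (simp add: hf_mem_hs)
qed

primrec num :: "nat \<Rightarrow> 'k hf" where
  "num 0 = hs {}"
| "num (Suc n) = upair (num n) (num n)"

lemma is_num_iff: "is_num n x \<longleftrightarrow> x = num n"
  by (induction n arbitrary: x) (simp_all add: is_empty_iff is_upair_iff)

lemma is_letter_iff: "is_letter n x \<longleftrightarrow> (\<exists>i<n. x = num i)"
  by (induction n) (auto simp: is_num_iff less_Suc_eq)

lemma hf_rank_num: "hf_rank (num n :: 'k hf) = n + 1"
proof (induction n)
  case 0
  show ?case by (simp add: hs_def Abs_fset_inverse)
next
  case (Suc n)
  then show ?case by (simp add: upair_def hs_def Abs_fset_inverse)
qed

lemma num_eq_iff: "(num m :: 'k hf) = num n \<longleftrightarrow> m = n"
proof
  assume "(num m :: 'k hf) = num n"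
  then have "hf_rank (num m :: 'k hf) = hf_rank (num n :: 'k hf)" by (rule arg_cong)
  then show "m = n" unfolding hf_rank_num by simp
qed (rule arg_cong)

subsection \<open>Polynomials\<close>

primrec wenc :: "('x \<Rightarrow> nat) \<Rightarrow> 'x list \<Rightarrow> 'k hf" where
  "wenc idx [] = hs {}"
| "wenc idx (x # w) = pr (num (idx x)) (wenc idx w)"

definition penc :: "('x \<Rightarrow> nat) \<Rightarrow> ('x, 'k::field) ncp \<Rightarrow> 'k hf" where
  "penc idx p = hs ((\<lambda>w. pr (wenc idx w) (Atom (lookup p w))) ` keys p)"

lemma hf_mem_penc: "hf_mem z (penc idx p) \<longleftrightarrow> (\<exists>w. lookup p w \<noteq> 0 \<and> z = pr (wenc idx w) (Atom (lookup p w)))"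
  by (auto simp: penc_def hf_mem_hs in_keys_iff)

lemma not_is_atom_penc: "\<not> is_atom (penc idx p)"
  by (simp add: penc_def not_is_atom_hs)

locale alg_enc =
  fixes X :: "'x set" and n :: nat and idx :: "'x \<Rightarrow> nat"
  assumes idx: "bij_betw idx X {..<n}"
begin

definition W :: "'x list set" where
  "W = lists X"

lemma Nil_in_W [simp]: "[] \<in> W"
  and Cons_in_W [simp]: "x # w \<in> W \<longleftrightarrow> x \<in> X \<and> w \<in> W"
  and append_in_W: "v @ w \<in> W \<longleftrightarrow> v \<in> W \<and> w \<in> W"
  by (auto simp: W_def)

lemma letter_iff: "is_letter n (i :: 'k hf) \<longleftrightarrow> (\<exists>x\<in>X. i = num (idx x))"
  using idx unfolding is_letter_iff bij_betw_def by (metis (no_types, lifting) image_iff lessThan_iff)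

lemma wenc_inj: "v \<in> W \<Longrightarrow> w \<in> W \<Longrightarrow> (wenc idx v :: 'k hf) = wenc idx w \<longleftrightarrow> v = w"
proof (induction v arbitrary: w)
  case Nil
  then show ?case using pr_ne_empty by (cases w) (auto simp: eq_commute[of "hs {}"])
next
  case (Cons x v)
  show ?case
  proof (cases w)
    case Nil
    then show ?thesis using pr_ne_empty by simp
  next
    case (Cons y u)
    moreover have "idx x = idx y \<longleftrightarrow> x = y"
      using idx Cons.prems Cons unfolding bij_betw_def inj_on_def by auto
    ultimately show ?thesis using Cons.IH[of u] Cons.prems by (auto simp: pr_eq_iff num_eq_iff)
  qed
qed

text \<open>Decoding goes by induction on the rank, which drops from a pair to its tail. Conversely,
  the set of codes of all suffixes of the word is the required witness.\<close>

lemma is_word_iff: "is_word n (w :: 'k hf) \<longleftrightarrow> (\<exists>v\<in>W. w = wenc idx v)"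
proof
  assume "is_word n w"
  then obtain M where M: "hf_mem w M"
    "\<And>u. hf_mem u M \<Longrightarrow> u = hs {} \<or> (\<exists>i v. is_letter n i \<and> hf_mem v M \<and> u = pr i v)"
    unfolding is_word_def is_empty_iff is_pr_iff by blast
  have "hf_mem u M \<Longrightarrow> \<exists>v\<in>W. u = wenc idx v" for u
  proof (induction "hf_rank u" arbitrary: u rule: less_induct)
    case less
    from M(2)[OF less.prems] show ?case
    proof
      assume "u = hs {}"
      then show ?thesis by (intro bexI[of _ "[]"]) simp_all
    next
      assume "\<exists>i v. is_letter n i \<and> hf_mem v M \<and> u = pr i v"
      then obtain x v where xv: "x \<in> X" "hf_mem v M" "u = pr (num (idx x)) v" unfolding letter_iff by blast
      then obtain v' where "v' \<in> W" "v = wenc idx v'" using less.hyps hf_rank_pr by blast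
      then show ?thesis using xv by (intro bexI[of _ "x # v'"]) simp_all
    qed
  qed
  then show "\<exists>v\<in>W. w = wenc idx v" using M(1) by blast
next
  assume "\<exists>v\<in>W. w = wenc idx v"
  then obtain v where v: "v \<in> W" "w = wenc idx v" by blast
  define S where "S = (\<lambda>k. wenc idx (drop k v) :: 'k hf) ` {..length v}"
  have fin: "finite S" by (simp add: S_def)
  have "w \<in> S" using v(2) unfolding S_def by (intro image_eqI[of _ _ 0]) simp_all
  moreover have "u = hs {} \<or> (\<exists>i v'. is_letter n i \<and> v' \<in> S \<and> u = pr i v')" if "u \<in> S" for u
  proof -
    obtain k where k: "k \<le> length v" "u = wenc idx (drop k v)" using \<open>u \<in> S\<close> by (auto simp: S_def)
    show ?thesis
    proof (cases "k = length v")
      case False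
      then have d: "drop k v = v ! k # drop (Suc k) v" using k(1) by (simp add: Cons_nth_drop_Suc)
      have "v ! k \<in> X" using v(1) k(1) False by (simp add: W_def in_lists_conv_set)
      moreover have "wenc idx (drop (Suc k) v) \<in> S" using k(1) False by (simp add: S_def)
      ultimately show ?thesis using k(2) unfolding d letter_iff by auto
    qed (use k in simp)
  qed
  ultimately show "is_word n w"
    unfolding is_word_def is_empty_iff is_pr_iff by (intro exI[of _ "hs S"]) (simp add: hf_mem_hs fin)
qed

lemma all_words: "(\<forall>w. is_word n w \<longrightarrow> \<Phi> w) \<longleftrightarrow> (\<forall>v\<in>W. \<Phi> (wenc idx v))"
  unfolding is_word_iff by blast

lemma is_val_iff:
  fixes p :: "('x, 'k::field) ncp"
  assumes "keys p \<subseteq> W" "v \<in> W"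
  shows "is_val (penc idx p) (wenc idx v) c \<longleftrightarrow> c = Atom (lookup p v)"
proof -
  have "lookup p w \<noteq> 0 \<and> pr (wenc idx v) d = pr (wenc idx w) (Atom (lookup p w)) \<longleftrightarrow>
      lookup p w \<noteq> 0 \<and> w = v \<and> d = Atom (lookup p w)" for w d
    using assms by (auto simp: pr_eq_iff wenc_inj in_keys_iff subset_iff)
  then have "(\<exists>z. is_pr z (wenc idx v) d \<and> hf_mem z (penc idx p)) \<longleftrightarrow> lookup p v \<noteq> 0 \<and> d = Atom (lookup p v)" for d
    unfolding is_pr_iff hf_mem_penc by auto
  note ex = this
  have "(\<exists>z d. is_pr z (wenc idx v) d \<and> hf_mem z (penc idx p)) \<longleftrightarrow> lookup p v \<noteq> 0"
    using ex by (subst ex_comm) simp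
  then show ?thesis unfolding is_val_def ex by auto
qed

lemma penc_inj:
  fixes p q :: "('x, 'k::field) ncp"
  assumes "keys p \<subseteq> W" "keys q \<subseteq> W"
  shows "penc idx p = penc idx q \<longleftrightarrow> p = q"
proof
  assume eq: "penc idx p = penc idx q"
  show "p = q"
  proof (rule poly_mapping_eqI)
    fix w
    show "lookup p w = lookup q w"
    proof (cases "w \<in> W")
      case True
      have "is_val (penc idx p) (wenc idx w) (Atom (lookup p w))" using is_val_iff[OF assms(1) True] by simp
      then show ?thesis using is_val_iff[OF assms(2) True] unfolding eq by simp
    next
      case False
      then have "w \<notin> keys p" "w \<notin> keys q" using assms by blast+
      then show ?thesis by (simp add: in_keys_iff)
    qed
  qed
qed simp

lemma is_poly_iff: "is_poly n (p :: 'k::field hf) \<longleftrightarrow> (\<exists>P. keys P \<subseteq> W \<and> p = penc idx P)"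
proof
  assume p: "is_poly n p"
  define f where "f v = (if v \<in> W \<and> (\<exists>c. hf_mem (pr (wenc idx v) (Atom c)) p)
      then (THE c. hf_mem (pr (wenc idx v) (Atom c)) p) else 0)" for v
  have un: "c = d" if "hf_mem (pr w (Atom c)) p" "hf_mem (pr w (Atom d)) p" for w c d
  proof -
    have "Atom c = Atom d" using p that unfolding is_poly_def is_pr_iff by blast
    then show ?thesis by simp
  qed
  have el: "\<exists>v\<in>W. \<exists>c. c \<noteq> 0 \<and> z = pr (wenc idx v) (Atom c)" if "hf_mem z p" for z
    using p that unfolding is_poly_def is_pr_iff is_word_iff is_atom_def by blast
  have f: "f v = c" if "v \<in> W" "hf_mem (pr (wenc idx v) (Atom c)) p" for v c
    using that un by (auto simp: f_def intro!: the_equality)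
  have f0: "hf_mem (pr (wenc idx v) (Atom (f v))) p" "v \<in> W" if "f v \<noteq> 0" for v
  proof -
    have "v \<in> W \<and> (\<exists>c. hf_mem (pr (wenc idx v) (Atom c)) p)" using that unfolding f_def by argo
    then show "hf_mem (pr (wenc idx v) (Atom (f v))) p" "v \<in> W" using f by blast+
  qed
  \<comment> \<open>The support of the decoded function f injects into the finitely many members of
    p, so f is a polynomial.\<close>
  have "inj_on (\<lambda>v. pr (wenc idx v) (Atom (f v))) {v. f v \<noteq> 0}"
    using f0(2) by (intro inj_onI) (auto simp: pr_eq_iff simp flip: wenc_inj[where 'k = 'k])
  moreover have "finite ((\<lambda>v. pr (wenc idx v) (Atom (f v))) ` {v. f v \<noteq> 0})"
    by (rule finite_subset[OF _ finite_hf_mem[of p]]) (use f0 in blast)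
  ultimately have fin: "finite {v. f v \<noteq> 0}" using finite_imageD by blast
  define P where "P = Abs_poly_mapping f"
  have P: "lookup P = f" unfolding P_def using fin by simp
  have keys: "keys P \<subseteq> W" using f0(2) by (auto simp: in_keys_iff P)
  moreover have "p = penc idx P"
  proof (rule hf_eqI)
    show "\<not> is_atom p" using p by (simp add: is_poly_def)
    show "\<not> is_atom (penc idx P)" by (rule not_is_atom_penc)
    fix z
    have "hf_mem z p \<longleftrightarrow> (\<exists>v. f v \<noteq> 0 \<and> z = pr (wenc idx v) (Atom (f v)))"
    proof
      assume z: "hf_mem z p"
      then obtain v c where vc: "v \<in> W" "c \<noteq> 0" "z = pr (wenc idx v) (Atom c)" using el by blast
      then have "f v = c" using f z by blast
      then show "\<exists>v. f v \<noteq> 0 \<and> z = pr (wenc idx v) (Atom (f v))" using vc by blast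
    qed (use f0 in blast)
    then show "hf_mem z p \<longleftrightarrow> hf_mem z (penc idx P)" unfolding hf_mem_penc P .
  qed
  ultimately show "\<exists>P. keys P \<subseteq> W \<and> p = penc idx P" by blast
next
  assume "\<exists>P. keys P \<subseteq> W \<and> p = penc idx P"
  then obtain P where P: "keys P \<subseteq> W" "p = penc idx P" by blast
  have W: "w \<in> W" if "lookup P w \<noteq> 0" for w using P(1) that by (auto simp: in_keys_iff)
  show "is_poly n p"
    unfolding is_poly_def is_pr_iff P(2) hf_mem_penc is_word_iff
  proof (intro conjI allI impI)
    show "\<not> is_atom (penc idx P)" by (rule not_is_atom_penc)
  next
    fix z assume "\<exists>w. lookup P w \<noteq> 0 \<and> z = pr (wenc idx w) (Atom (lookup P w))"
    then obtain w where "lookup P w \<noteq> 0" "z = pr (wenc idx w) (Atom (lookup P w))" by blast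
    then show "\<exists>w c. z = pr w c \<and> (\<exists>v\<in>W. w = wenc idx v) \<and> is_atom c \<and> c \<noteq> Atom 0"
      using W unfolding is_atom_def by blast
  next
    fix w c d z z' assume "z = pr w c \<and> z' = pr w d \<and> (\<exists>w. lookup P w \<noteq> 0 \<and> z = pr (wenc idx w) (Atom (lookup P w))) \<and>
      (\<exists>w. lookup P w \<noteq> 0 \<and> z' = pr (wenc idx w) (Atom (lookup P w)))"
    then obtain v v' where v: "lookup P v \<noteq> 0" "lookup P v' \<noteq> 0" "wenc idx v = w" "wenc idx v' = w"
        "c = Atom (lookup P v)" "d = Atom (lookup P v')" by (auto simp: pr_eq_iff)
    then have "v = v'" using W wenc_inj[of v v', where 'k = 'k] by simp
    then show "c = d" using v by simp
  qed
qed

lemma is_elem_iff: "is_elem n (p :: 'k::field hf) \<longleftrightarrow> (\<exists>P\<in>free_alg X. p = penc idx P)"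
proof -
  have "(\<exists>z c w. is_empty w \<and> is_pr z w c \<and> hf_mem z (penc idx P)) \<longleftrightarrow> lookup P [] \<noteq> 0"
    if "keys P \<subseteq> W" for P :: "('x, 'k) ncp"
  proof -
    have Nil: "hs {} = (wenc idx w :: 'k hf) \<longleftrightarrow> w = []" if "lookup P w \<noteq> 0" for w
      using wenc_inj[of "[]" w, where 'k = 'k] that \<open>keys P \<subseteq> W\<close> by (auto simp: in_keys_iff subset_iff)
    show ?thesis unfolding is_empty_iff is_pr_iff hf_mem_penc
    proof
      assume "lookup P [] \<noteq> 0"
      then show "\<exists>z c w. w = hs {} \<and> z = pr w c \<and> (\<exists>w. lookup P w \<noteq> 0 \<and> z = pr (wenc idx w) (Atom (lookup P w)))"
        by (metis wenc.simps(1))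
    qed (use Nil in \<open>auto simp: pr_eq_iff\<close>)
  qed
  moreover have "P \<in> free_alg X \<longleftrightarrow> keys P \<subseteq> W \<and> lookup P [] = 0" for P :: "('x, 'k) ncp"
    by (auto simp: free_alg_def in_keys_iff W_def)
  ultimately show ?thesis unfolding is_elem_def is_poly_iff by blast
qed

lemma poly_eq_iff_words:
  fixes p q :: "('x, 'k::field) ncp"
  assumes "keys p \<subseteq> W" "keys q \<subseteq> W"
  shows "p = q \<longleftrightarrow> (\<forall>v\<in>W. lookup p v = lookup q v)"
proof
  assume *: "\<forall>v\<in>W. lookup p v = lookup q v"
  have "lookup p w = lookup q w" for w
    using * assms unfolding subset_iff in_keys_iff by metis
  then show "p = q" by (rule poly_mapping_eqI)
qed simp

lemma is_sum_iff:
  fixes p q r :: "('x, 'k::field) ncp"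
  assumes "keys p \<subseteq> W" "keys q \<subseteq> W" "keys r \<subseteq> W"
  shows "is_sum n (penc idx p) (penc idx q) (penc idx r) \<longleftrightarrow> r = p + q"
proof -
  have "is_sum n (penc idx p) (penc idx q) (penc idx r) \<longleftrightarrow> (\<forall>w. is_word n w \<longrightarrow>
      (\<forall>a b c. is_val (penc idx p) w a \<and> is_val (penc idx q) w b \<and> is_val (penc idx r) w c \<longrightarrow> atom_add a b c))"
    unfolding is_sum_def by blast
  also have "\<dots> \<longleftrightarrow> (\<forall>v\<in>W. lookup r v = lookup (p + q) v)"
    unfolding all_words using assms by (auto simp: is_val_iff atom_add_def lookup_add)
  also have "\<dots> \<longleftrightarrow> r = p + q"
    using Poly_Mapping.keys_add[of p q] assms by (intro poly_eq_iff_words[symmetric]) auto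
  finally show ?thesis .
qed

lemma keys_lder: "keys p \<subseteq> W \<Longrightarrow> keys (lder x p) \<subseteq> W"
  by (auto simp: in_keys_iff subset_iff)

lemma keys_mult_words:
  fixes p q :: "('x, 'k::field) ncp"
  assumes "keys p \<subseteq> W" "keys q \<subseteq> W"
  shows "keys (p * q) \<subseteq> W"
proof -
  have "keys (p * q) \<subseteq> {u + v | u v. u \<in> keys p \<and> v \<in> keys q}" by (rule keys_mult)
  also have "\<dots> \<subseteq> W" using assms by (auto simp: plus_list_def subset_iff append_in_W)
  finally show ?thesis .
qed

lemma is_lder_iff:
  fixes p p' :: "('x, 'k::field) ncp"
  assumes "keys p \<subseteq> W" "keys p' \<subseteq> W" "x \<in> X"
  shows "is_lder n (num (idx x)) (penc idx p) (penc idx p') \<longleftrightarrow> p' = lder x p"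
proof -
  have xv: "pr (num (idx x)) (wenc idx v) = (wenc idx (x # v) :: 'k hf)" for v by simp
  have "is_lder n (num (idx x)) (penc idx p) (penc idx p') \<longleftrightarrow> (\<forall>w. is_word n w \<longrightarrow>
      (\<forall>a b. is_val (penc idx p') w a \<and> is_val (penc idx p) (pr (num (idx x)) w) b \<longrightarrow> a = b))"
    unfolding is_lder_def is_pr_iff by blast
  also have "\<dots> \<longleftrightarrow> (\<forall>v\<in>W. lookup p' v = lookup (lder x p) v)"
    unfolding all_words xv using assms by (simp add: is_val_iff del: wenc.simps)
  also have "\<dots> \<longleftrightarrow> p' = lder x p"
    by (rule poly_eq_iff_words[symmetric, OF assms(2) keys_lder[OF assms(1)]])
  finally show ?thesis .
qed

lemma is_const_prod_iff:
  fixes p q r :: "('x, 'k::field) ncp"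
  assumes "keys p \<subseteq> W" "keys q \<subseteq> W" "keys r \<subseteq> W"
  shows "is_const_prod (penc idx p) (penc idx q) (penc idx r) \<longleftrightarrow> lookup r [] = lookup p [] * lookup q []"
proof -
  have "hs {} = (wenc idx [] :: 'k hf)" by simp
  then show ?thesis
    unfolding is_const_prod_def is_empty_iff using assms
    by (auto simp: is_val_iff atom_muladd_def simp del: wenc.simps)
qed

lemma is_leibniz_iff:
  fixes p q r r' :: "('x, 'k::field) ncp"
  assumes "keys p \<subseteq> W" "keys q \<subseteq> W" "keys r \<subseteq> W" "keys r' \<subseteq> W" "x \<in> X"
  shows "is_leibniz n (num (idx x)) (penc idx p) (penc idx q) (penc idx r) (penc idx r') \<longleftrightarrow>
    (\<forall>v\<in>W. lookup r (x # v) = lookup r' v + lookup p [] * lookup q (x # v))"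
proof -
  have xv: "pr (num (idx x)) (wenc idx v) = (wenc idx (x # v) :: 'k hf)" for v by simp
  have e: "hs {} = (wenc idx [] :: 'k hf)" by simp
  have "is_leibniz n (num (idx x)) (penc idx p) (penc idx q) (penc idx r) (penc idx r') \<longleftrightarrow> (\<forall>w. is_word n w \<longrightarrow>
      (\<forall>a b c d. is_val (penc idx r) (pr (num (idx x)) w) d \<and> is_val (penc idx r') w a \<and> is_val (penc idx p) (hs {}) b \<and>
        is_val (penc idx q) (pr (num (idx x)) w) c \<longrightarrow> atom_muladd a b c d))"
    unfolding is_leibniz_def is_pr_iff is_empty_iff by blast
  also have "\<dots> \<longleftrightarrow> (\<forall>v\<in>W. lookup r (x # v) = lookup r' v + lookup p [] * lookup q (x # v))"
    unfolding all_words xv e using assms by (simp add: is_val_iff atom_muladd_def del: wenc.simps)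
  finally show ?thesis .
qed

section \<open>Products certified by tables of left derivatives\<close>

lemma lookup_mult_Nil: "lookup (p * q) [] = lookup p [] * lookup (q :: ('x, 'k::field) ncp) []"
  by (simp add: lookup_mult_list)

lemma lookup_mult_Cons:
  "lookup (p * q) (x # v) = lookup (lder x p * q) v + lookup p [] * lookup (q :: ('x, 'k::field) ncp) (x # v)"
  unfolding lookup_mult_list by (simp add: sum.atMost_Suc_shift del: sum.atMost_Suc)

lemma penc_empty_iff:
  fixes p :: "('x, 'k::field) ncp"
  assumes "keys p \<subseteq> W"
  shows "is_empty (penc idx p) \<longleftrightarrow> p = 0"
  using penc_inj[OF assms, of 0] by (simp add: is_empty_iff penc_def)

text \<open>Induction on a strict bound m for the lengths of the words in p, which a derivative
  lowers by one; m = 0 means p = 0. The constant term of r is fixed by \<open>is_const_prod\<close>,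
  and the words starting with x by the Leibniz rule together with the entry for
  \<open>lder x p\<close>.\<close>

lemma is_prod_sound:
  fixes p q r :: "('x, 'k::field) ncp"
  assumes q: "keys q \<subseteq> W" and M: "\<And>z p r. is_pr z p r \<Longrightarrow> hf_mem z M \<Longrightarrow>
      is_poly n p \<and> is_poly n r \<and> (is_empty p \<and> is_empty r \<or> \<not> is_empty p \<and> is_step n (penc idx q) M p r)"
  shows "\<lbrakk>keys p \<subseteq> W; keys r \<subseteq> W; hf_mem (pr (penc idx p) (penc idx r)) M; \<And>w. m \<le> length w \<Longrightarrow> lookup p w = 0\<rbrakk> \<Longrightarrow> r = p * q"
proof (induction m arbitrary: p r)
  case 0
  have "p = 0" using 0(4) by (intro poly_mapping_eqI) simp
  moreover have "p = 0 \<and> r = 0 \<or> p \<noteq> 0"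
    using M[OF _ 0(3), of "penc idx p" "penc idx r"] penc_empty_iff 0(1,2) by (auto simp: is_pr_iff)
  ultimately show ?case by simp
next
  case (Suc m)
  note prems = Suc.prems
  have "p = 0 \<and> r = 0 \<or> is_step n (penc idx q) M (penc idx p) (penc idx r)"
    using M[OF _ prems(3), of "penc idx p" "penc idx r"] penc_empty_iff prems(1,2) by (auto simp: is_pr_iff)
  then show ?case
  proof
    assume st: "is_step n (penc idx q) M (penc idx p) (penc idx r)"
    then have c: "lookup r [] = lookup (p * q) []"
      using is_const_prod_iff[OF prems(1) q prems(2)] by (simp add: is_step_def lookup_mult_Nil)
    have "lookup r v = lookup (p * q) v" if "v \<in> W" for v
    proof (cases v)
      case (Cons x u)
      then have x: "x \<in> X" "u \<in> W" using \<open>v \<in> W\<close> by auto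
      then have "is_letter n (num (idx x) :: 'k hf)" unfolding letter_iff by blast
      then obtain p'' r'' where s: "hf_mem (pr p'' r'') M" "is_lder n (num (idx x)) (penc idx p) p''"
          "is_leibniz n (num (idx x)) (penc idx p) (penc idx q) (penc idx r) r''"
        using st unfolding is_step_def is_pr_iff by blast
      have "is_poly n p''" "is_poly n r''" using M[OF _ s(1)] by (auto simp: is_pr_iff)
      then obtain p' r' where p': "keys p' \<subseteq> W" "p'' = penc idx p'" and r': "keys r' \<subseteq> W" "r'' = penc idx r'"
        unfolding is_poly_iff by blast
      have ld: "p' = lder x p" using s(2) is_lder_iff[OF prems(1) p'(1) x(1)] p'(2) by simp
      have "r' = p' * q"
        by (rule Suc.IH[OF p'(1) r'(1)]) (use s(1) p'(2) r'(2) ld prems(4) in simp_all)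
      moreover have "lookup r (x # u) = lookup r' u + lookup p [] * lookup q (x # u)"
        using s(3) is_leibniz_iff[OF prems(1) q prems(2) r'(1) x(1)] r'(2) x(2) by simp
      ultimately show ?thesis using Cons ld by (simp add: lookup_mult_Cons)
    qed (use c in simp)
    then show ?thesis using poly_eq_iff_words[OF prems(2) keys_mult_words[OF prems(1) q]] by blast
  qed simp
qed

text \<open>Iterated derivatives form a tree with finite branching X and depth at most m, since each
  step shortens the words. The tree is cut at 0, in accordance with \<open>is_prod\<close>.\<close>

lemma lder_closed_set:
  fixes p :: "('x, 'k::field) ncp"
  assumes "finite X"
  shows "\<lbrakk>keys p \<subseteq> W; \<And>w. m \<le> length w \<Longrightarrow> lookup p w = 0\<rbrakk> \<Longrightarrow>
    \<exists>S. finite S \<and> p \<in> S \<and> (\<forall>s\<in>S. keys s \<subseteq> W \<and> (s = 0 \<or> (\<forall>x\<in>X. lder x s \<in> S)))"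
proof (induction m arbitrary: p)
  case 0
  have "p = 0" using 0(2) by (intro poly_mapping_eqI) simp
  then show ?case by (intro exI[of _ "{0}"]) simp
next
  case (Suc m)
  have "\<forall>x. \<exists>S. finite S \<and> lder x p \<in> S \<and> (\<forall>s\<in>S. keys s \<subseteq> W \<and> (s = 0 \<or> (\<forall>x\<in>X. lder x s \<in> S)))"
    using Suc.IH[OF keys_lder[OF Suc.prems(1)]] Suc.prems(2) by simp
  then obtain S where S: "\<And>x. finite (S x)" "\<And>x. lder x p \<in> S x"
    "\<And>x s. s \<in> S x \<Longrightarrow> keys s \<subseteq> W \<and> (s = 0 \<or> (\<forall>y\<in>X. lder y s \<in> S x))"
    by metis
  show ?case
  proof (intro exI[of _ "insert p (\<Union>x\<in>X. S x)"] conjI ballI)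
    show "finite (insert p (\<Union>x\<in>X. S x))" using assms S(1) by simp
    fix s assume s: "s \<in> insert p (\<Union>x\<in>X. S x)"
    then show "keys s \<subseteq> W" using Suc.prems(1) S(3) by blast
    show "s = 0 \<or> (\<forall>x\<in>X. lder x s \<in> insert p (\<Union>x\<in>X. S x))"
      using s S(2,3) by blast
  qed simp
qed

lemma is_prod_iff:
  fixes p q r :: "('x, 'k::field) ncp"
  assumes p: "keys p \<subseteq> W" and q: "keys q \<subseteq> W" and r: "keys r \<subseteq> W"
  shows "is_prod n (penc idx p) (penc idx q) (penc idx r) \<longleftrightarrow> r = p * q"
proof
  assume "is_prod n (penc idx p) (penc idx q) (penc idx r)"
  then obtain M where M: "hf_mem (pr (penc idx p) (penc idx r)) M"
    "\<And>z p r. is_pr z p r \<Longrightarrow> hf_mem z M \<Longrightarrow>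
      is_poly n p \<and> is_poly n r \<and> (is_empty p \<and> is_empty r \<or> \<not> is_empty p \<and> is_step n (penc idx q) M p r)"
    unfolding is_prod_def is_pr_iff by blast
  have "lookup p w = 0" if "Suc (deg p) \<le> length w" for w
    using length_le_deg[of p w] that by fastforce
  from is_prod_sound[OF q M(2) p r M(1) this] show "r = p * q" .
next
  assume eq: "r = p * q"
  have "finite X" using idx bij_betw_finite by blast
  have vanish: "lookup p w = 0" if "Suc (deg p) \<le> length w" for w
    using length_le_deg[of p w] that by fastforce
  have "\<exists>S. finite S \<and> p \<in> S \<and> (\<forall>s\<in>S. keys s \<subseteq> W \<and> (s = 0 \<or> (\<forall>x\<in>X. lder x s \<in> S)))"
    by (rule lder_closed_set[OF \<open>finite X\<close> p]) (rule vanish)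
  then
  obtain S where S0: "finite S \<and> p \<in> S \<and> (\<forall>s\<in>S. keys s \<subseteq> W \<and> (s = 0 \<or> (\<forall>x\<in>X. lder x s \<in> S)))"
    by (elim exE)
  have S: "finite S" "p \<in> S" using S0 by simp_all
  have S3: "keys s \<subseteq> W" if "s \<in> S" for s using S0 that by simp
  have S4: "lder x s \<in> S" if "s \<in> S" "s \<noteq> 0" "x \<in> X" for s x using S0 that by blast
  \<comment> \<open>The table lists the true products of all iterated derivatives with q, so each of
    its rows satisfies the Leibniz rule.\<close>
  define M where "M = hs ((\<lambda>s. pr (penc idx s) (penc idx (s * q))) ` S)"
  have M: "hf_mem z M \<longleftrightarrow> (\<exists>s\<in>S. z = pr (penc idx s) (penc idx (s * q)))" for z
    unfolding M_def using S(1) by (auto simp: hf_mem_hs)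
  have "is_step n (penc idx q) M (penc idx s) (penc idx (s * q))" if s: "s \<in> S" "s \<noteq> 0" for s
    unfolding is_step_def
  proof (intro conjI allI impI)
    note ks = S3[OF s(1)]
    note ksq = keys_mult_words[OF ks q]
    show "is_const_prod (penc idx s) (penc idx q) (penc idx (s * q))"
      unfolding is_const_prod_iff[OF ks q ksq] by (rule lookup_mult_Nil)
    fix i :: "'k hf" assume "is_letter n i"
    then obtain x where x: "x \<in> X" "i = num (idx x)" unfolding letter_iff by blast
    note kl = keys_lder[OF ks, of x]
    have "hf_mem (pr (penc idx (lder x s)) (penc idx (lder x s * q))) M"
      unfolding M using S4[OF s x(1)] by blast
    moreover have "is_lder n i (penc idx s) (penc idx (lder x s))"
      unfolding x(2) is_lder_iff[OF ks kl x(1)] ..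
    moreover have "is_leibniz n i (penc idx s) (penc idx q) (penc idx (s * q)) (penc idx (lder x s * q))"
      unfolding x(2) is_leibniz_iff[OF ks q ksq keys_mult_words[OF kl q] x(1)] by (simp add: lookup_mult_Cons)
    ultimately show "\<exists>p' r' z. is_pr z p' r' \<and> hf_mem z M \<and> is_lder n i (penc idx s) p' \<and>
        is_leibniz n i (penc idx s) (penc idx q) (penc idx (s * q)) r'"
      unfolding is_pr_iff by blast
  qed
  then have step: "s = 0 \<or> is_step n (penc idx q) M (penc idx s) (penc idx (s * q))" if "s \<in> S" for s
    using that by blast
  show "is_prod n (penc idx p) (penc idx q) (penc idx r)"
    unfolding is_prod_def is_pr_iff
  proof (rule exI[of _ M], intro conjI allI impI)
    show "\<exists>z. z = pr (penc idx p) (penc idx r) \<and> hf_mem z M" unfolding M eq using S(2) by blast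
    fix z p' r' assume "z = pr p' r' \<and> hf_mem z M"
    then obtain s where s: "s \<in> S" "p' = penc idx s" "r' = penc idx (s * q)" unfolding M by (auto simp: pr_eq_iff)
    note ks = S3[OF s(1)]
    note ksq = keys_mult_words[OF ks q]
    show "is_poly n p'" "is_poly n r'" unfolding is_poly_iff using s ks ksq by blast+
    show "is_empty p' \<and> is_empty r' \<or> \<not> is_empty p' \<and> is_step n (penc idx q) M p' r'"
      unfolding s(2,3) penc_empty_iff[OF ks] penc_empty_iff[OF ksq] using step[OF s(1)] by auto
  qed
qed

end

subsection \<open>Translating formulas about the free algebra\<close>

context alg_enc
begin

text \<open>Since polynomial codes are unique, a term translates to the graph of its value, in
  contrast to \<open>hterm_ok\<close>.\<close>

definition rterm_ok :: "('k::field hf \<Rightarrow> (nat \<Rightarrow> 'k hf) \<Rightarrow> bool) \<Rightarrow> rng_term \<Rightarrow> bool" where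
  "rterm_ok P s \<longleftrightarrow> (\<forall>g x. range g \<subseteq> free_alg X \<longrightarrow> x \<in> free_alg X \<longrightarrow>
     (P (penc idx x) (\<lambda>i. penc idx (g i)) \<longleftrightarrow> x = rng_term_val g s))"

definition rform_ok :: "((nat \<Rightarrow> 'k::field hf) \<Rightarrow> bool) \<Rightarrow> rng_form \<Rightarrow> bool" where
  "rform_ok P \<phi> \<longleftrightarrow> (\<forall>g. range g \<subseteq> free_alg X \<longrightarrow>
     (P (\<lambda>i. penc idx (g i)) \<longleftrightarrow> rng_sat (free_alg X) g \<phi>))"

lemma free_alg_keys: "p \<in> free_alg X \<Longrightarrow> keys p \<subseteq> W"
  by (auto simp: free_alg_def W_def)

lemma rng_term_val_in:
  assumes "range g \<subseteq> free_alg X"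
  shows "rng_term_val g s \<in> free_alg X"
  using assms by (induction s) (auto simp: free_alg_zero free_alg_add free_alg_mult)

lemma ex_elem: "(\<exists>a. is_elem n a \<and> \<Phi> a) \<longleftrightarrow> (\<exists>p\<in>free_alg X. \<Phi> (penc idx p))"
  unfolding is_elem_iff by blast

lemma rterm_ok_RVar: "rterm_ok (\<lambda>(x :: 'k::field hf) h. x = h m) (RVar m)"
  unfolding rterm_ok_def
proof (intro allI impI)
  fix g :: "nat \<Rightarrow> ('x, 'k) ncp" and x :: "('x, 'k) ncp" assume g: "range g \<subseteq> free_alg X" and x: "x \<in> free_alg X"
  have "g m \<in> free_alg X" using g by auto
  then show "penc idx x = penc idx (g m) \<longleftrightarrow> x = rng_term_val g (RVar m)"
    using penc_inj[OF free_alg_keys[OF x] free_alg_keys] by simp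
qed

lemma rterm_ok_RZero: "rterm_ok (\<lambda>x h. is_empty x) RZero"
  unfolding rterm_ok_def by (intro allI impI) (simp add: penc_empty_iff[OF free_alg_keys])

lemma rterm_ok_binop:
  fixes P Q :: "'k::field hf \<Rightarrow> (nat \<Rightarrow> 'k hf) \<Rightarrow> bool" and f :: "('x, 'k) ncp \<Rightarrow> ('x, 'k) ncp \<Rightarrow> ('x, 'k) ncp"
  assumes "rterm_ok P s" "rterm_ok Q u"
    and S: "\<And>x y z. \<lbrakk>keys x \<subseteq> W; keys y \<subseteq> W; keys z \<subseteq> W\<rbrakk> \<Longrightarrow> S (penc idx x) (penc idx y) (penc idx z) \<longleftrightarrow> z = f x y"
    and v: "\<And>g. rng_term_val g v = f (rng_term_val g s) (rng_term_val g u)"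
  shows "rterm_ok (\<lambda>x h. \<exists>a. is_elem n a \<and> (\<exists>b. is_elem n b \<and> P a h \<and> Q b h \<and> S a b x)) v"
  unfolding rterm_ok_def ex_elem
proof (intro allI impI)
  fix g :: "nat \<Rightarrow> ('x, 'k) ncp" and x :: "('x, 'k) ncp" assume g: "range g \<subseteq> free_alg X" and x: "x \<in> free_alg X"
  have P: "P (penc idx y) (\<lambda>i. penc idx (g i)) \<longleftrightarrow> y = rng_term_val g s" if "y \<in> free_alg X" for y
    using assms(1) g that unfolding rterm_ok_def by blast
  have Q: "Q (penc idx y) (\<lambda>i. penc idx (g i)) \<longleftrightarrow> y = rng_term_val g u" if "y \<in> free_alg X" for y
    using assms(2) g that unfolding rterm_ok_def by blast
  have R: "S (penc idx y) (penc idx z) (penc idx x) \<longleftrightarrow> x = f y z" if "y \<in> free_alg X" "z \<in> free_alg X" for y z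
    by (intro S free_alg_keys that x)
  show "(\<exists>y\<in>free_alg X. \<exists>z\<in>free_alg X. P (penc idx y) (\<lambda>i. penc idx (g i)) \<and> Q (penc idx z) (\<lambda>i. penc idx (g i)) \<and>
      S (penc idx y) (penc idx z) (penc idx x)) \<longleftrightarrow> x = rng_term_val g v"
    using P Q R v rng_term_val_in[OF g, of s] rng_term_val_in[OF g, of u] by auto
qed

lemma rterm_ok_RAdd:
  "rterm_ok P s \<Longrightarrow> rterm_ok Q u \<Longrightarrow>
    rterm_ok (\<lambda>x h. \<exists>a. is_elem n a \<and> (\<exists>b. is_elem n b \<and> P a h \<and> Q b h \<and> is_sum n a b x)) (RAdd s u)"
  by (rule rterm_ok_binop[where f = "(+)"]) (simp_all add: is_sum_iff)

lemma rterm_ok_RMul: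
  "rterm_ok P s \<Longrightarrow> rterm_ok Q u \<Longrightarrow>
    rterm_ok (\<lambda>x h. \<exists>a. is_elem n a \<and> (\<exists>b. is_elem n b \<and> P a h \<and> Q b h \<and> is_prod n a b x)) (RMul s u)"
  by (rule rterm_ok_binop[where f = "(*)"]) (simp_all add: is_prod_iff)

lemma rform_ok_REq:
  fixes P Q :: "'k::field hf \<Rightarrow> (nat \<Rightarrow> 'k hf) \<Rightarrow> bool"
  assumes "rterm_ok P s" "rterm_ok Q u"
  shows "rform_ok (\<lambda>h. \<exists>a. is_elem n a \<and> P a h \<and> Q a h) (REq s u)"
  unfolding rform_ok_def ex_elem
proof (intro allI impI)
  fix g :: "nat \<Rightarrow> ('x, 'k) ncp" assume g: "range g \<subseteq> free_alg X"
  have P: "P (penc idx y) (\<lambda>i. penc idx (g i)) \<longleftrightarrow> y = rng_term_val g s" if "y \<in> free_alg X" for y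
    using assms(1) g that unfolding rterm_ok_def by blast
  have Q: "Q (penc idx y) (\<lambda>i. penc idx (g i)) \<longleftrightarrow> y = rng_term_val g u" if "y \<in> free_alg X" for y
    using assms(2) g that unfolding rterm_ok_def by blast
  show "(\<exists>p\<in>free_alg X. P (penc idx p) (\<lambda>i. penc idx (g i)) \<and> Q (penc idx p) (\<lambda>i. penc idx (g i))) \<longleftrightarrow>
      rng_sat (free_alg X) g (REq s u)"
    using P Q rng_term_val_in[OF g, of s] by auto
qed

lemma rform_ok_RNot: "rform_ok P \<phi> \<Longrightarrow> rform_ok (\<lambda>h. \<not> P h) (RNot \<phi>)"
  unfolding rform_ok_def by simp

lemma rform_ok_RAnd: "rform_ok P \<phi> \<Longrightarrow> rform_ok Q \<psi> \<Longrightarrow> rform_ok (\<lambda>h. P h \<and> Q h) (RAnd \<phi> \<psi>)"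
  unfolding rform_ok_def by simp

lemma rform_ok_REx:
  fixes P :: "(nat \<Rightarrow> 'k::field hf) \<Rightarrow> bool"
  assumes "rform_ok P \<phi>"
  shows "rform_ok (\<lambda>h. \<exists>a\<in>UNIV. is_elem n ((h(m := a)) m) \<and> P (h(m := a))) (REx m \<phi>)"
  unfolding rform_ok_def
proof (intro allI impI)
  fix g :: "nat \<Rightarrow> ('x, 'k) ncp" assume g: "range g \<subseteq> free_alg X"
  have upd: "(\<lambda>i. penc idx (g i))(m := penc idx p) = (\<lambda>i. penc idx ((g(m := p)) i))" for p
    by auto
  have "P ((\<lambda>i. penc idx (g i))(m := penc idx p)) \<longleftrightarrow> rng_sat (free_alg X) (g(m := p)) \<phi>" if "p \<in> free_alg X" for p
    unfolding upd using assms range_upd_subset[OF g that, of m] unfolding rform_ok_def by blast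
  then show "(\<exists>a\<in>UNIV. is_elem n (((\<lambda>i. penc idx (g i))(m := a)) m) \<and> P ((\<lambda>i. penc idx (g i))(m := a))) \<longleftrightarrow>
      rng_sat (free_alg X) g (REx m \<phi>)"
    unfolding bex_UNIV fun_upd_same ex_elem by simp
qed

end

lemma rng_term_definable:
  fixes s :: rng_term
  assumes X: "alg_enc X n idx" and Y: "alg_enc Y n idy"
  shows "\<exists>(P :: 'k::field hf \<Rightarrow> _) (Q :: 'l::field hf \<Rightarrow> _).
    hf_definable TYPE('k) TYPE('l) (unary P) (unary Q) \<and>
    alg_enc.rterm_ok X idx P s \<and> alg_enc.rterm_ok Y idy Q s"
  (is "\<exists>P Q. ?D (unary P) (unary Q) \<and> _ P \<and> _ Q")
proof (induction s)
  case (RVar m)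
  show ?case
    by (intro exI conjI, rule_tac[2] alg_enc.rterm_ok_RVar[OF X], rule_tac[2] alg_enc.rterm_ok_RVar[OF Y]) (rule hf.D_var_eq)
next
  case RZero
  show ?case
    by (intro exI conjI, rule_tac[2] alg_enc.rterm_ok_RZero[OF X], rule_tac[2] alg_enc.rterm_ok_RZero[OF Y]) (rule D_empty)
next
  case (RAdd s u)
  obtain P1 Q1 P2 Q2 where 1: "?D (unary P1) (unary Q1)" "alg_enc.rterm_ok X idx P1 s" "alg_enc.rterm_ok Y idy Q1 s"
    and 2: "?D (unary P2) (unary Q2)" "alg_enc.rterm_ok X idx P2 u" "alg_enc.rterm_ok Y idy Q2 u"
    using RAdd.IH by (elim exE conjE)
  show ?case
    by (intro exI conjI, rule_tac[2] alg_enc.rterm_ok_RAdd[OF X 1(2) 2(2)], rule_tac[2] alg_enc.rterm_ok_RAdd[OF Y 1(3) 2(3)])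
      (intro hf_intros D_elem D_sum hf.D_sub1[where P = P1 and Q = Q1, OF 1(1)] hf.D_sub1[where P = P2 and Q = Q2, OF 2(1)])
next
  case (RMul s u)
  obtain P1 Q1 P2 Q2 where 1: "?D (unary P1) (unary Q1)" "alg_enc.rterm_ok X idx P1 s" "alg_enc.rterm_ok Y idy Q1 s"
    and 2: "?D (unary P2) (unary Q2)" "alg_enc.rterm_ok X idx P2 u" "alg_enc.rterm_ok Y idy Q2 u"
    using RMul.IH by (elim exE conjE)
  show ?case
    by (intro exI conjI, rule_tac[2] alg_enc.rterm_ok_RMul[OF X 1(2) 2(2)], rule_tac[2] alg_enc.rterm_ok_RMul[OF Y 1(3) 2(3)])
      (intro hf_intros D_elem D_prod hf.D_sub1[where P = P1 and Q = Q1, OF 1(1)] hf.D_sub1[where P = P2 and Q = Q2, OF 2(1)])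
qed

lemma rng_form_definable:
  fixes \<phi> :: rng_form
  assumes X: "alg_enc X n idx" and Y: "alg_enc Y n idy"
  shows "\<exists>(P :: (nat \<Rightarrow> 'k::field hf) \<Rightarrow> _) (Q :: (nat \<Rightarrow> 'l::field hf) \<Rightarrow> _).
    hf_definable TYPE('k) TYPE('l) P Q \<and> alg_enc.rform_ok X idx P \<phi> \<and> alg_enc.rform_ok Y idy Q \<phi>"
  (is "\<exists>P Q. ?D P Q \<and> _ P \<and> _ Q")
proof (induction \<phi>)
  case (REq s u)
  from rng_term_definable[OF X Y, of s] obtain P1 :: "'k hf \<Rightarrow> _" and Q1 :: "'l hf \<Rightarrow> _" where
    1: "?D (unary P1) (unary Q1)"
      "alg_enc.rterm_ok X idx P1 s" "alg_enc.rterm_ok Y idy Q1 s" by (elim exE conjE)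
  from rng_term_definable[OF X Y, of u] obtain P2 :: "'k hf \<Rightarrow> _" and Q2 :: "'l hf \<Rightarrow> _" where
    2: "?D (unary P2) (unary Q2)"
      "alg_enc.rterm_ok X idx P2 u" "alg_enc.rterm_ok Y idy Q2 u" by (elim exE conjE)
  show ?case
    by (intro exI conjI, rule_tac[2] alg_enc.rform_ok_REq[OF X 1(2) 2(2)], rule_tac[2] alg_enc.rform_ok_REq[OF Y 1(3) 2(3)])
      (intro hf_intros D_elem hf.D_sub1[where P = P1 and Q = Q1, OF 1(1)] hf.D_sub1[where P = P2 and Q = Q2, OF 2(1)])
next
  case (RNot \<phi>)
  then obtain P Q where
    PQ: "?D P Q" "alg_enc.rform_ok X idx P \<phi>" "alg_enc.rform_ok Y idy Q \<phi>" by (elim exE conjE)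
  show ?case
    by (intro exI conjI, rule hf.D_not[OF PQ(1)], rule alg_enc.rform_ok_RNot[OF X PQ(2)], rule alg_enc.rform_ok_RNot[OF Y PQ(3)])
next
  case (RAnd \<phi> \<psi>)
  from RAnd.IH(1) obtain P Q where
    1: "?D P Q" "alg_enc.rform_ok X idx P \<phi>" "alg_enc.rform_ok Y idy Q \<phi>" by (elim exE conjE)
  from RAnd.IH(2) obtain P' Q' where
    2: "?D P' Q'" "alg_enc.rform_ok X idx P' \<psi>" "alg_enc.rform_ok Y idy Q' \<psi>" by (elim exE conjE)
  show ?case
    by (intro exI conjI, rule hf.D_and[OF 1(1) 2(1)], rule alg_enc.rform_ok_RAnd[OF X 1(2) 2(2)],
      rule alg_enc.rform_ok_RAnd[OF Y 1(3) 2(3)])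
next
  case (REx m \<phi>)
  then obtain P Q where
    PQ: "?D P Q" "alg_enc.rform_ok X idx P \<phi>" "alg_enc.rform_ok Y idy Q \<phi>" by (elim exE conjE)
  show ?case
    by (intro exI conjI, rule hf.D_upd[OF hf.D_and[OF D_elem PQ(1)], where n = m],
      rule alg_enc.rform_ok_REx[OF X PQ(2)], rule alg_enc.rform_ok_REx[OF Y PQ(3)])
qed

lemma rng_models_sentence:
  fixes R :: "'a::ring set"
  assumes "rng_sentence \<phi>" "0 \<in> R"
  shows "rng_models R \<phi> \<longleftrightarrow> rng_sat R (\<lambda>_. 0) \<phi>"
proof -
  have eq: "rng_sat R g \<phi> = rng_sat R (\<lambda>_. 0) \<phi>" for g
    using assms by (intro rng_sat_cong) (simp add: rng_sentence_def)
  have "range (\<lambda>_::nat. 0) \<subseteq> R" using assms(2) by auto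
  then show ?thesis unfolding rng_models_def by (subst eq) blast
qed

theorem rng_elem_equiv_if_hf_elem_equiv:
  fixes X :: "'x set" and Y :: "'y set"
  assumes "finite X" "finite Y" and card: "card X = card Y"
    and eq: "hf_elem_equiv (UNIV :: 'k::field set) (UNIV :: 'l::field set)"
  shows "rng_elem_equiv (free_alg X :: ('x, 'k) ncp set) (free_alg Y :: ('y, 'l) ncp set)"
  unfolding rng_elem_equiv_def
proof (intro allI impI)
  fix \<phi> assume \<phi>: "rng_sentence \<phi>"
  obtain idx where "bij_betw idx X {0..<card X}" using ex_bij_betw_finite_nat[OF assms(1)] by blast
  then have X: "alg_enc X (card X) idx" by (simp add: alg_enc_def atLeast0LessThan)
  obtain idy where "bij_betw idy Y {0..<card Y}" using ex_bij_betw_finite_nat[OF assms(2)] by blast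
  then have Y: "alg_enc Y (card X) idy" by (simp add: alg_enc_def atLeast0LessThan card)
  from rng_form_definable[OF X Y, of \<phi>] obtain P :: "(nat \<Rightarrow> 'k hf) \<Rightarrow> _" and Q :: "(nat \<Rightarrow> 'l hf) \<Rightarrow> _" where
    PQ: "hf_definable TYPE('k) TYPE('l) P Q" "alg_enc.rform_ok X idx P \<phi>" "alg_enc.rform_ok Y idy Q \<phi>" by (elim exE conjE)
  have sem: "S (\<lambda>_. hs {}) \<longleftrightarrow> rng_models (free_alg Z :: ('z, 'm) ncp set) \<phi>"
    if Z: "alg_enc Z (card X) idz" and S: "alg_enc.rform_ok Z idz S \<phi>"
    for Z :: "'z set" and idz and S :: "(nat \<Rightarrow> 'm::field hf) \<Rightarrow> bool"
  proof -
    have "penc idz (0 :: ('z, 'm) ncp) = hs {}" by (simp add: penc_def)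
    moreover have "range (\<lambda>_::nat. 0 :: ('z, 'm) ncp) \<subseteq> free_alg Z" using free_alg_zero by auto
    ultimately show ?thesis
      using S[unfolded alg_enc.rform_ok_def[OF Z], rule_format, of "\<lambda>_. 0"]
      unfolding rng_models_sentence[OF \<phi> free_alg_zero] by simp
  qed
  \<comment> \<open>The code of 0 is the empty set, which is definable without parameters; assigning
    it to all variables turns the translation into a constant.\<close>
  have "hf_definable TYPE('k) TYPE('l) (\<lambda>e. \<exists>z. is_empty z \<and> P (\<lambda>_. z)) (\<lambda>e. \<exists>z. is_empty z \<and> Q (\<lambda>_. z))"
    by (intro hf_intros D_empty hf.D_ren[OF PQ(1), where \<sigma> = "\<lambda>_. 0"])
  then have "hf_definable TYPE('k) TYPE('l) (\<lambda>e. rng_models (free_alg X :: ('x, 'k) ncp set) \<phi>)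
      (\<lambda>e. rng_models (free_alg Y :: ('y, 'l) ncp set) \<phi>)"
    unfolding is_empty_iff using sem[OF X PQ(2)] sem[OF Y PQ(3)] by simp
  then show "rng_models (free_alg X :: ('x, 'k) ncp set) \<phi> \<longleftrightarrow> rng_models (free_alg Y :: ('y, 'l) ncp set) \<phi>"
    by (rule hf_elem_equiv_const[OF eq])
qed

theorem theorem9p3:
  fixes X :: "'x set" and Y :: "'y set"
  assumes "infinite (UNIV :: 'k1::field set)"
    and "infinite (UNIV :: 'k2::field set)"
    and "finite X" and "X \<noteq> {}"
    and "finite Y" and "Y \<noteq> {}"
  shows "rng_elem_equiv (free_alg X :: ('x list \<Rightarrow>\<^sub>0 'k1) set)
                        (free_alg Y :: ('y list \<Rightarrow>\<^sub>0 'k2) set) \<longleftrightarrow>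
         card X = card Y \<and> hf_elem_equiv (UNIV :: 'k1 set) (UNIV :: 'k2 set)"
  using card_eq_if_rng_elem_equiv[OF assms(3-6)] hf_elem_equiv_if_rng_elem_equiv[OF assms(1,2,4,6)]
    rng_elem_equiv_if_hf_elem_equiv[OF assms(3,5)] by blast

end
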